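(* The Cycle plus Triangles problem is polynomial-time reducible to the restriction of the Unfair Independent Set in Cycle problem to instances that consist of $k$ sets of size $3$ that form a partition of $[n]$ where $n=3k$.
   Context: Write $[n]=\{1,\ldots,n\}$. A subset of $[n]$ is stable if it contains no two consecutive elements and does not contain both $1$ and $n$ (i.e., it is independent in the cycle on $[n]$). Cycle plus Triangles problem: the input consists of an integer $k$ and a graph $G$ on $3k$ vertices whose edge set is the disjoint union of (the edge sets of) a Hamilton cycle and $k$ pairwise vertex-disjoint triangles; only the graph $G$ is given, not the decomposition. The goal is to find an independent set of size $k$ in $G$. Unfair Independent Set in Cycle problem: the input consists of integers $n$ and $k$ with $n\ge 2k$ and $\ell$ subsets $V_1,\ldots,V_\ell$ of $[n]$, where $\ell\le n-2k+1$ and $|V_i|\ge 2$ for all $i\in[\ell]$. The goal is to find a stable $k$-subset $S$ of $[n]$ such that $|S\cap V_i|\le |V_i|/2$ for all $i\in[\ell]$. A search problem $P$ is polynomial-time reducible to a search problem $Q$ if there are polynomial-time computable maps, one taking each instance of $P$ to an instance of $Q$, and one taking each instance of $P$ together with any solution of the corresponding $Q$-instance to a solution of the $P$-instance. *)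

theory Defs
  imports
    Complex_Main
    "HOL-Library.Disjoint_Sets"
    "HOL-Computational_Algebra.Polynomial"
begin

section \<open>Polynomial-time computation\<close>

text \<open>
  The machine model is the multi-stack machine with structured control: finitely many registers,
  each holding a bit string that is accessed at its head only, and unit cost for every elementary
  operation. A tape of a Turing machine is a pair of stacks (left and right of the head) and
  the control state and the symbols of a larger alphabet are coded by blocks of constantly many
  bits; conversely, each stack is a tape. Hence running times agree with those
  of multi-tape Turing machines up to constant factors.
\<close>

type_synonym store = "nat \<Rightarrow> bool list"

datatype prog =
    Skip
  | Push nat bool
  | Pop nat
  | Seq prog prog
  | Branch nat prog prog prog  \<comment> \<open>continue according to the head of a register: empty, 0, 1\<close>
  | While nat prog             \<comment> \<open>loop as long as a register is nonempty\<close>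

text \<open>\<open>exec p s t s'\<close>: started in store \<open>s\<close>, program \<open>p\<close> halts after \<open>t\<close> steps in store \<open>s'\<close>.\<close>

inductive exec :: "prog \<Rightarrow> store \<Rightarrow> nat \<Rightarrow> store \<Rightarrow> bool" where
  exec_Skip: "exec Skip s 1 s"
| exec_Push: "exec (Push r b) s 1 (s(r := b # s r))"
| exec_Pop: "exec (Pop r) s 1 (s(r := tl (s r)))"
| exec_Seq: "exec p s t s' \<Longrightarrow> exec q s' t' s'' \<Longrightarrow> exec (Seq p q) s (t + t') s''"
| exec_Branch:
    "exec (case s r of [] \<Rightarrow> p | b # _ \<Rightarrow> if b then p1 else p0) s t s' \<Longrightarrow>
     exec (Branch r p p0 p1) s (1 + t) s'"
| exec_While_stop: "s r = [] \<Longrightarrow> exec (While r p) s 1 s"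
| exec_While_step:
    "s r \<noteq> [] \<Longrightarrow> exec p s t s' \<Longrightarrow> exec (While r p) s' t' s'' \<Longrightarrow>
     exec (While r p) s (1 + t + t') s''"

lemma exec_deterministic:
  assumes "exec p s t s1" and "exec p s t' s2"
  shows "t = t' \<and> s1 = s2"
  using assms
proof (induction arbitrary: t' s2 rule: exec.induct)
  case (exec_Skip s)
  then show ?case by (auto elim: exec.cases)
next
  case (exec_Push r b s)
  then show ?case by (auto elim: exec.cases)
next
  case (exec_Pop r s)
  then show ?case by (auto elim: exec.cases)
next
  case (exec_Seq p s t s' q t0 s'')
  from exec_Seq.prems show ?case by cases (use exec_Seq.IH in blast)
next
  case (exec_Branch s r p p1 p0 t s')
  from exec_Branch.prems show ?case by cases (use exec_Branch.IH in blast)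
next
  case (exec_While_stop s r p)
  then show ?case by (auto elim: exec.cases)
next
  case (exec_While_step s r p t s' t0 s'')
  from exec_While_step.prems show ?case
    by cases (use exec_While_step in blast)+
qed

text \<open>The inputs are placed in the first registers; all other registers are empty.\<close>

definition input_store :: "bool list list \<Rightarrow> store" where
  "input_store xs r = (if r < length xs then xs ! r else [])"

text \<open>
  \<open>poly_time_on A inp out\<close>: some program, started on the input strings \<open>inp a\<close>, halts with the
  string \<open>out a\<close> in register 0, within time polynomial in the total input length, for every
  \<open>a \<in> A\<close>. Nothing is required on inputs outside \<open>A\<close>.
\<close>

definition poly_time_on ::
    "'a set \<Rightarrow> ('a \<Rightarrow> bool list list) \<Rightarrow> ('a \<Rightarrow> bool list) \<Rightarrow> bool" where
  "poly_time_on A inp out \<longleftrightarrow>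
     (\<exists>p (q :: nat poly). \<forall>a\<in>A. \<exists>t s.
        exec p (input_store (inp a)) t s \<and>
        t \<le> poly q (\<Sum>x\<leftarrow>inp a. length x) \<and>
        s 0 = out a)"


section \<open>Search problems and reductions\<close>

text \<open>
  The string encoding of a solution may refer to the instance it solves, e.g. to the length
  of a characteristic vector.
\<close>

record ('i, 's) search_problem =
  instances :: "'i set"
  solutions :: "'i \<Rightarrow> 's set"
  enc_instance :: "'i \<Rightarrow> bool list"
  enc_solution :: "'i \<Rightarrow> 's \<Rightarrow> bool list"

definition restrict_problem ::
    "('i, 's) search_problem \<Rightarrow> 'i set \<Rightarrow> ('i, 's) search_problem" where
  "restrict_problem P A = P\<lparr>instances := instances P \<inter> A\<rparr>"

definition poly_time_reducible ::
    "('i, 's) search_problem \<Rightarrow> ('j, 't) search_problem \<Rightarrow> bool" where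
  "poly_time_reducible P Q \<longleftrightarrow>
     (\<exists>f g.
        (\<forall>x\<in>instances P. f x \<in> instances Q) \<and>
        (\<forall>x\<in>instances P. \<forall>y\<in>solutions Q (f x). g x y \<in> solutions P x) \<and>
        poly_time_on (instances P)
          (\<lambda>x. [enc_instance P x])
          (\<lambda>x. enc_instance Q (f x)) \<and>
        poly_time_on (SIGMA x : instances P. solutions Q (f x))
          (\<lambda>(x, y). [enc_instance P x, enc_solution Q (f x) y])
          (\<lambda>(x, y). enc_solution P x (g x y)))"


section \<open>Encodings\<close>

text \<open>
  A set of vertices is given by its characteristic vector and a graph by its adjacency matrix.
  Integers are written in unary; each of them is at most (up to a constant factor) the number of
  elements of the ground set, so that this is polynomially equivalent to binary for
  Cycle plus Triangles and for the partition instances considered below.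
\<close>

definition unary :: "nat \<Rightarrow> bool list" where
  "unary m = replicate m True @ [False]"

definition char_vec :: "nat \<Rightarrow> nat set \<Rightarrow> bool list" where
  "char_vec n S = map (\<lambda>i. i \<in> S) [1..<n + 1]"

definition adj_matrix :: "nat \<Rightarrow> nat set set \<Rightarrow> bool list" where
  "adj_matrix n E = concat (map (\<lambda>u. map (\<lambda>v. {u, v} \<in> E) [1..<n + 1]) [1..<n + 1])"


section \<open>Cycle plus Triangles\<close>

text \<open>A graph with vertex set \<open>{1..n}\<close> is given by its edges, which are two-element sets.\<close>

definition cycle_edges :: "nat list \<Rightarrow> nat set set" where
  "cycle_edges vs = {{vs ! i, vs ! (Suc i mod length vs)} | i. i < length vs}"

definition hamilton_cycle_on :: "nat set \<Rightarrow> nat list \<Rightarrow> bool" where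
  "hamilton_cycle_on V vs \<longleftrightarrow> distinct vs \<and> set vs = V \<and> length vs \<ge> 3"

definition triangle_edges :: "nat set \<Rightarrow> nat set set" where
  "triangle_edges T = {e. e \<subseteq> T \<and> card e = 2}"

definition cycle_plus_triangles_graph :: "nat \<Rightarrow> nat set set \<Rightarrow> bool" where
  "cycle_plus_triangles_graph k E \<longleftrightarrow>
     (\<exists>vs \<T>.
        hamilton_cycle_on {1..3 * k} vs \<and>
        card \<T> = k \<and> (\<forall>T\<in>\<T>. T \<subseteq> {1..3 * k} \<and> card T = 3) \<and> disjoint \<T> \<and>
        cycle_edges vs \<inter> (\<Union>T\<in>\<T>. triangle_edges T) = {} \<and>
        E = cycle_edges vs \<union> (\<Union>T\<in>\<T>. triangle_edges T))"

definition independent_set :: "nat set set \<Rightarrow> nat set \<Rightarrow> bool" where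
  "independent_set E S \<longleftrightarrow> (\<forall>u\<in>S. \<forall>v\<in>S. {u, v} \<notin> E)"

definition cycle_plus_triangles :: "(nat \<times> nat set set, nat set) search_problem" where
  "cycle_plus_triangles =
     \<lparr>instances = {(k, E). cycle_plus_triangles_graph k E},
      solutions = (\<lambda>(k, E). {S. S \<subseteq> {1..3 * k} \<and> card S = k \<and> independent_set E S}),
      enc_instance = (\<lambda>(k, E). unary k @ adj_matrix (3 * k) E),
      enc_solution = (\<lambda>(k, E) S. char_vec (3 * k) S)\<rparr>"


section \<open>Unfair Independent Set in Cycle\<close>

definition stable :: "nat \<Rightarrow> nat set \<Rightarrow> bool" where
  "stable n S \<longleftrightarrow> S \<subseteq> {1..n} \<and> (\<forall>i. \<not> (i \<in> S \<and> i + 1 \<in> S)) \<and> \<not> (1 \<in> S \<and> n \<in> S)"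

text \<open>An instance is a triple of \<open>n\<close>, \<open>k\<close> and the list of the sets \<open>V\<^sub>1, \<dots>, V\<^sub>\<ell>\<close>.\<close>

definition unfair_independent_set_in_cycle ::
    "(nat \<times> nat \<times> nat set list, nat set) search_problem" where
  "unfair_independent_set_in_cycle =
     \<lparr>instances = {(n, k, Vs). 2 * k \<le> n \<and> length Vs \<le> n - 2 * k + 1 \<and>
        (\<forall>V\<in>set Vs. V \<subseteq> {1..n} \<and> card V \<ge> 2)},
      solutions = (\<lambda>(n, k, Vs). {S. stable n S \<and> card S = k \<and>
        (\<forall>V\<in>set Vs. real (card (S \<inter> V)) \<le> real (card V) / 2)}),
      enc_instance = (\<lambda>(n, k, Vs).
        unary n @ unary k @ unary (length Vs) @ concat (map (char_vec n) Vs)),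
      enc_solution = (\<lambda>(n, k, Vs) S. char_vec n S)\<rparr>"

definition triple_partition_instances :: "(nat \<times> nat \<times> nat set list) set" where
  "triple_partition_instances =
     {(n, k, Vs). n = 3 * k \<and> length Vs = k \<and> (\<forall>V\<in>set Vs. card V = 3) \<and>
        distinct Vs \<and> partition_on {1..n} (set Vs)}"


section \<open>The encodings are injective\<close>

lemma unary_append_inject: "unary m @ xs = unary n @ ys \<longleftrightarrow> m = n \<and> xs = ys"
proof (induction m arbitrary: n)
  case 0
  show ?case by (cases n) (auto simp: unary_def)
next
  case (Suc m)
  then show ?case by (cases n) (auto simp: unary_def)
qed

lemma char_vec_inject:
  assumes "S \<subseteq> {1..n}" "S' \<subseteq> {1..n}" "char_vec n S = char_vec n S'"
  shows "S = S'"
proof -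
  have "\<forall>i\<in>{1..n}. i \<in> S \<longleftrightarrow> i \<in> S'"
    using assms(3) by (auto simp: char_vec_def)
  with assms(1,2) show ?thesis by blast
qed

lemma concat_map_inject:
  assumes "concat (map f xs) = concat (map g ys)" "length xs = length ys"
    and "\<forall>x\<in>set xs. length (f x) = n" "\<forall>y\<in>set ys. length (g y) = n"
  shows "map f xs = map g ys"
  using assms(2,1,3,4) by (induction xs ys rule: list_induct2) auto

lemma adj_matrix_inject:
  assumes "\<forall>e\<in>E \<union> E'. \<exists>u\<in>{1..n}. \<exists>v\<in>{1..n}. e = {u, v}"
    and "adj_matrix n E = adj_matrix n E'"
  shows "E = E'"
proof -
  have "map (\<lambda>u. map (\<lambda>v. {u, v} \<in> E) [1..<n + 1]) [1..<n + 1] =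
        map (\<lambda>u. map (\<lambda>v. {u, v} \<in> E') [1..<n + 1]) [1..<n + 1]"
    using assms(2) unfolding adj_matrix_def by (rule concat_map_inject) auto
  then have *: "{u, v} \<in> E \<longleftrightarrow> {u, v} \<in> E'"
    if "u \<in> set [1..<n + 1]" "v \<in> set [1..<n + 1]" for u v
    using that unfolding map_eq_conv by blast
  have **: "{u, v} \<in> E \<longleftrightarrow> {u, v} \<in> E'" if "u \<in> {1..n}" "v \<in> {1..n}" for u v
    by (rule *) (use that in auto)
  show ?thesis
  proof (rule set_eqI)
    fix e
    show "e \<in> E \<longleftrightarrow> e \<in> E'"
    proof (cases "e \<in> E \<union> E'")
      case True
      with assms(1) obtain u v where "u \<in> {1..n}" "v \<in> {1..n}" "e = {u, v}" by blast
      then show ?thesis using ** by simp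
    qed simp
  qed
qed

lemma cycle_plus_triangles_edge:
  assumes "cycle_plus_triangles_graph k E" "e \<in> E"
  shows "\<exists>u\<in>{1..3 * k}. \<exists>v\<in>{1..3 * k}. e = {u, v}"
proof -
  from assms(1) obtain vs \<T> where
    *: "distinct vs" "set vs = {1..3 * k}" "\<forall>T\<in>\<T>. T \<subseteq> {1..3 * k}"
       "E = cycle_edges vs \<union> (\<Union>T\<in>\<T>. triangle_edges T)"
    unfolding cycle_plus_triangles_graph_def hamilton_cycle_on_def by blast
  consider "e \<in> cycle_edges vs" | T where "T \<in> \<T>" "e \<in> triangle_edges T"
    using assms(2) *(4) by blast
  then show ?thesis
  proof cases
    case 1
    then obtain i where i: "i < length vs" "e = {vs ! i, vs ! (Suc i mod length vs)}"
      by (auto simp: cycle_edges_def)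
    moreover from i(1) have "Suc i mod length vs < length vs"
      by (intro mod_less_divisor) auto
    ultimately show ?thesis using *(2) nth_mem by blast
  next
    case 2
    then obtain u v where "e = {u, v}"
      by (auto simp: triangle_edges_def card_2_iff)
    moreover from 2 *(3) have "e \<subseteq> {1..3 * k}"
      by (auto simp: triangle_edges_def)
    ultimately show ?thesis by blast
  qed
qed

lemma enc_instance_inj_cycle_plus_triangles:
  "inj_on (enc_instance cycle_plus_triangles) (instances cycle_plus_triangles)"
proof (rule inj_onI, clarsimp simp: cycle_plus_triangles_def unary_append_inject)
  fix k E E'
  assume "cycle_plus_triangles_graph k E" "cycle_plus_triangles_graph k E'"
    and eq: "adj_matrix (3 * k) E = adj_matrix (3 * k) E'"
  then have "\<forall>e\<in>E \<union> E'. \<exists>u\<in>{1..3 * k}. \<exists>v\<in>{1..3 * k}. e = {u, v}"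
    using cycle_plus_triangles_edge by blast
  then show "E = E'" using eq by (rule adj_matrix_inject)
qed

lemma enc_solution_inj_cycle_plus_triangles:
  "inj_on (enc_solution cycle_plus_triangles x) (solutions cycle_plus_triangles x)"
proof (cases x)
  case (Pair k E)
  show ?thesis
  proof (rule inj_onI)
    fix S S'
    assume "S \<in> solutions cycle_plus_triangles x" "S' \<in> solutions cycle_plus_triangles x"
      and "enc_solution cycle_plus_triangles x S = enc_solution cycle_plus_triangles x S'"
    then have "S \<subseteq> {1..3 * k}" "S' \<subseteq> {1..3 * k}" "char_vec (3 * k) S = char_vec (3 * k) S'"
      by (simp_all add: Pair cycle_plus_triangles_def)
    then show "S = S'" by (rule char_vec_inject)
  qed
qed

lemma enc_instance_inj_unfair:
  "inj_on (enc_instance unfair_independent_set_in_cycle)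
     (instances unfair_independent_set_in_cycle)"
proof (rule inj_onI, clarsimp simp: unfair_independent_set_in_cycle_def unary_append_inject)
  fix n :: nat and Vs Vs' :: "nat set list"
  assume V: "\<forall>V\<in>set Vs. V \<subseteq> {Suc 0..n} \<and> 2 \<le> card V"
      "\<forall>V\<in>set Vs'. V \<subseteq> {Suc 0..n} \<and> 2 \<le> card V"
    and len: "length Vs = length Vs'"
    and eq: "concat (map (char_vec n) Vs) = concat (map (char_vec n) Vs')"
  have "map (char_vec n) Vs = map (char_vec n) Vs'"
    using eq len by (rule concat_map_inject[where n = n]) (auto simp: char_vec_def)
  moreover have "inj_on (char_vec n) (set Vs \<union> set Vs')"
    using V by (intro inj_onI) (rule char_vec_inject[of _ n], auto)
  ultimately show "Vs = Vs'"
    by (simp add: inj_on_map_eq_map)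
qed

lemma enc_solution_inj_unfair:
  "inj_on (enc_solution unfair_independent_set_in_cycle x)
     (solutions unfair_independent_set_in_cycle x)"
proof (cases x rule: prod_cases3)
  case (fields n k Vs)
  show ?thesis
  proof (rule inj_onI)
    fix S S'
    assume "S \<in> solutions unfair_independent_set_in_cycle x"
        "S' \<in> solutions unfair_independent_set_in_cycle x"
      and "enc_solution unfair_independent_set_in_cycle x S =
        enc_solution unfair_independent_set_in_cycle x S'"
    then have "S \<subseteq> {1..n}" "S' \<subseteq> {1..n}" "char_vec n S = char_vec n S'"
      by (simp_all add: fields unfair_independent_set_in_cycle_def stable_def)
    then show "S = S'" by (rule char_vec_inject)
  qed
qed

end

(*  G is 4-regular. Let F be a partition of its vertices into triangles whose complement C is a Hamilton
    cycle. A triangle of G outside F has the form {a, m, b}, where a m b is a path of C and a b is an edge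
    of a triangle {a, b, w} of F. If a factor contains {a, m, b}, then w must be covered by the triangle
    formed by w and its two neighbours in C. Iterating, the middles m form an orbit m_1, ..., m_r, and
    passing to the other factor replaces m_i by m_(i+1) in the cycle C. Hence the complement of every
    triangle factor of G is a Hamilton cycle, and unit propagation from any triangle either ends in a
    contradiction or stays inside some factor. So a factor is found greedily in polynomial time; walking
    along its complement numbers the vertices cyclically, and the triangles become the sets V_i.

    For the machine, the algorithm is written as a program whose steps define binary relations on n points
    by first-order formulas and whose loops run over the n points; every such program compiles to
    one that takes polynomial time. *)

theory Submission imports Defs begin

section \<open>Running times of programs\<close>

text \<open>Covering the vertices by disjoint triangles is an exact cover problem, and a greedy
  choice could run into a dead end. It does not here for the reason known from 2-SAT: if a
  decomposition exists, every union of triangles that is closed under propagation and free of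
  conflicts lies inside the factor of some decomposition (\<open>exchange\<close>). So an accepted
  choice is never revised, and one pass over all triples suffices. The orbit of middles closes up
  because passing from \<open>m\<close> to \<open>w\<close> is injective: \<open>w\<close>
  determines its mates \<open>a\<close> and \<open>b\<close>, and these have only one common
  neighbour on the cycle, as there is no 4-cycle. This requires \<open>5 \<le> n\<close>. It holds
  because for k = 1 the cycle edges would be triangle edges, so n is at least 6. The map on
  solutions receives only the instance and a solution. It runs the same deterministic program again
  and so obtains the same numbering of the vertices.\<close>

definition runs :: "prog \<Rightarrow> store \<Rightarrow> nat \<Rightarrow> store \<Rightarrow> bool" where
  "runs p s T s' \<longleftrightarrow> (\<exists>t\<le>T. exec p s t s')"

lemma runs_mono: "runs p s T s' \<Longrightarrow> T \<le> T' \<Longrightarrow> runs p s T' s'"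
  unfolding runs_def by (meson le_trans)

lemma runs_Skip: "runs Skip s 1 s"
  unfolding runs_def using exec_Skip by blast

lemma runs_Push: "runs (Push r b) s 1 (s(r := b # s r))"
  unfolding runs_def using exec_Push by blast

lemma runs_Pop: "runs (Pop r) s 1 (s(r := tl (s r)))"
  unfolding runs_def using exec_Pop by blast

lemma runs_Push': "s' = s(r := b # s r) \<Longrightarrow> runs (Push r b) s 1 s'"
  using runs_Push by simp

lemma runs_Pop': "s' = s(r := tl (s r)) \<Longrightarrow> runs (Pop r) s 1 s'"
  using runs_Pop by simp

lemma runs_Seq: "runs p s T s' \<Longrightarrow> runs q s' T' s'' \<Longrightarrow> runs (Seq p q) s (T + T') s''"
  unfolding runs_def by (meson add_mono exec_Seq)

lemma runs_Branch:
  "runs (case s r of [] \<Rightarrow> p | b # _ \<Rightarrow> if b then p1 else p0) s T s' \<Longrightarrow>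
   runs (Branch r p p0 p1) s (1 + T) s'"
  unfolding runs_def by (elim exE conjE, rule_tac x = "1 + t" in exI) (auto intro: exec_Branch[simplified])

lemma runs_While_stop: "s r = [] \<Longrightarrow> runs (While r p) s 1 s"
  unfolding runs_def using exec_While_stop by blast

lemma runs_While_step:
  "s r \<noteq> [] \<Longrightarrow> runs p s T s' \<Longrightarrow> runs (While r p) s' T' s'' \<Longrightarrow>
   runs (While r p) s (1 + T + T') s''"
  unfolding runs_def by (meson add_le_mono exec_While_step order_refl)

text \<open>Each round costs one test plus \<open>T\<close>, and the final test costs 1. The
  invariant leaves the store open, because a compiled loop body is known only up to the relations
  that its store represents.\<close>

lemma runs_While_inv:
  assumes "I 0 s"
    and "\<And>j s. j < m \<Longrightarrow> I j s \<Longrightarrow> s r \<noteq> [] \<and> (\<exists>s'. runs p s T s' \<and> I (Suc j) s')"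
    and "\<And>s. I m s \<Longrightarrow> s r = []"
  shows "\<exists>s'. runs (While r p) s (m * (T + 1) + 1) s' \<and> I m s'"
proof -
  have "\<exists>s'. runs (While r p) s ((m - j) * (T + 1) + 1) s' \<and> I m s'" if "I j s" "j \<le> m" for j s
    using that(2,1)
  proof (induction j arbitrary: s rule: inc_induct)
    case base
    then show ?case using assms(3) runs_While_stop by fastforce
  next
    case (step j)
    then obtain s1 where s1: "s r \<noteq> []" "runs p s T s1" "I (Suc j) s1" using assms(2) by blast
    then obtain s2 where s2: "runs (While r p) s1 ((m - Suc j) * (T + 1) + 1) s2" "I m s2"
      using step.IH by blast
    have "1 + T + ((m - Suc j) * (T + 1) + 1) = (m - j) * (T + 1) + 1"
      using step.hyps by (subst Suc_diff_Suc[symmetric]) auto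
    with runs_While_step[OF s1(1,2) s2(1)] s2(2) show ?case by metis
  qed
  from this[OF assms(1)] show ?thesis by simp
qed

text \<open>For loops whose store after \<open>j\<close> rounds is known in closed form;
  \<open>f\<close> is that trace.\<close>

lemma runs_While:
  assumes "\<And>j. j < m \<Longrightarrow> f j r \<noteq> [] \<and> runs p (f j) T (f (Suc j))" "f m r = []"
    and "f 0 = s" "f m = s'" "m * (T + 1) + 1 \<le> T'"
  shows "runs (While r p) s T' s'"
proof -
  have "\<exists>s'. runs (While r p) s (m * (T + 1) + 1) s' \<and> s' = f m"
    by (rule runs_While_inv[where I = "\<lambda>j s. s = f j"]) (use assms in auto)
  with assms(4,5) show ?thesis by (auto intro: runs_mono)
qed

lemma replicate_True_step: "j < m \<Longrightarrow> replicate (m - j) True = True # replicate (m - Suc j) True"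
  by (metis Suc_diff_Suc replicate_Suc)

section \<open>Register layout\<close>

abbreviation (input) r_out :: nat where "r_out \<equiv> 0"
abbreviation (input) r_in2 :: nat where "r_in2 \<equiv> 1"
abbreviation (input) r_n :: nat where "r_n \<equiv> 2"
abbreviation (input) r_k :: nat where "r_k \<equiv> 3"
abbreviation (input) r_buf :: nat where "r_buf \<equiv> 4"
abbreviation (input) r_c :: nat where "r_c \<equiv> 5"
abbreviation (input) r_idx :: nat where "r_idx \<equiv> 6"
abbreviation (input) r_tmp :: nat where "r_tmp \<equiv> 7"
abbreviation (input) r_stk :: nat where "r_stk \<equiv> 8"
abbreviation (input) r_bit :: nat where "r_bit \<equiv> 9"

text \<open>Residues modulo 4 above the ten fixed registers supply unboundedly many registers of
  four kinds. \<open>rel r\<close> holds the matrix of relation \<open>r\<close>;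
  \<open>var d\<close>, \<open>cnt d\<close> and \<open>flg d\<close> hold the value, the remaining
  rounds and the truth value found so far for the variable bound at nesting depth
  \<open>d\<close>.\<close>

definition rel :: "nat \<Rightarrow> nat" where "rel r = 10 + 4 * r"
definition var :: "nat \<Rightarrow> nat" where "var d = 11 + 4 * d"
definition cnt :: "nat \<Rightarrow> nat" where "cnt d = 12 + 4 * d"
definition flg :: "nat \<Rightarrow> nat" where "flg d = 13 + 4 * d"

lemma reg_inj [simp]:
  "rel a = rel b \<longleftrightarrow> a = b" "var a = var b \<longleftrightarrow> a = b" "cnt a = cnt b \<longleftrightarrow> a = b" "flg a = flg b \<longleftrightarrow> a = b"
  by (auto simp: rel_def var_def cnt_def flg_def)

lemma reg_ge: "10 \<le> rel a" "10 \<le> var a" "10 \<le> cnt a" "10 \<le> flg a"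
  by (auto simp: rel_def var_def cnt_def flg_def)

lemma reg_neq [simp]:
  "rel a \<noteq> var b" "rel a \<noteq> cnt b" "rel a \<noteq> flg b"
  "var a \<noteq> rel b" "var a \<noteq> cnt b" "var a \<noteq> flg b"
  "cnt a \<noteq> rel b" "cnt a \<noteq> var b" "cnt a \<noteq> flg b"
  "flg a \<noteq> rel b" "flg a \<noteq> var b" "flg a \<noteq> cnt b"
  unfolding rel_def var_def cnt_def flg_def by presburger+

lemma reg_neq_small [simp]:
  assumes "i < 10"
  shows "rel a \<noteq> i" "var a \<noteq> i" "cnt a \<noteq> i" "flg a \<noteq> i"
    "i \<noteq> rel a" "i \<noteq> var a" "i \<noteq> cnt a" "i \<noteq> flg a"
  using assms by (auto simp: rel_def var_def cnt_def flg_def)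

section \<open>Copying, moving, reading and comparing\<close>

text \<open>A stack can be read only by consuming it, so the source is rebuilt from
  \<open>r_tmp\<close>. The target is not cleared: repeated copies add up, which is how
  \<open>readp\<close> multiplies.\<close>

definition copyp :: "nat \<Rightarrow> nat \<Rightarrow> prog" where
  "copyp a b = Seq (While a (Seq (Pop a) (Seq (Push b True) (Push r_tmp True))))
                   (While r_tmp (Seq (Pop r_tmp) (Push a True)))"

lemma runs_copyp:
  assumes "s a = replicate m True" "s r_tmp = []" "a \<noteq> b" "a \<noteq> r_tmp" "b \<noteq> r_tmp" "m \<le> n"
    and s': "s' = s(b := replicate m True @ s b)"
  shows "runs (copyp a b) s (7 * n + 2) s'"
proof -
  let ?s1 = "s(a := [], b := replicate m True @ s b, r_tmp := replicate m True)"
  have 1: "runs (While a (Seq (Pop a) (Seq (Push b True) (Push r_tmp True)))) s (4 * m + 1) ?s1"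
  proof (rule runs_While[where m = m and T = "1 + (1 + 1)" and f = "\<lambda>j. s(a := replicate (m - j) True,
        b := replicate j True @ s b, r_tmp := replicate j True)"], rule conjI)
    fix j assume "j < m"
    then show "runs (Seq (Pop a) (Seq (Push b True) (Push r_tmp True)))
        (s(a := replicate (m - j) True, b := replicate j True @ s b, r_tmp := replicate j True)) (1 + (1 + 1))
        (s(a := replicate (m - Suc j) True, b := replicate (Suc j) True @ s b, r_tmp := replicate (Suc j) True))"
      by (intro runs_Seq[OF runs_Pop runs_Seq[OF runs_Push runs_Push']])
        (use assms in \<open>auto simp: fun_eq_iff replicate_True_step\<close>)
  qed (use assms in \<open>auto simp: fun_eq_iff replicate_True_step\<close>)
  have 2: "runs (While r_tmp (Seq (Pop r_tmp) (Push a True))) ?s1 (3 * m + 1) s'"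
  proof (rule runs_While[where m = m and T = "1 + 1" and f = "\<lambda>j. s(a := replicate j True,
        b := replicate m True @ s b, r_tmp := replicate (m - j) True)"], rule conjI)
    fix j assume "j < m"
    then show "runs (Seq (Pop r_tmp) (Push a True))
        (s(a := replicate j True, b := replicate m True @ s b, r_tmp := replicate (m - j) True)) (1 + 1)
        (s(a := replicate (Suc j) True, b := replicate m True @ s b, r_tmp := replicate (m - Suc j) True))"
      by (intro runs_Seq[OF runs_Pop runs_Push'])
        (use assms in \<open>auto simp: fun_eq_iff replicate_True_step\<close>)
  qed (use assms in \<open>auto simp: fun_eq_iff replicate_True_step\<close>)
  show ?thesis
    unfolding copyp_def using runs_Seq[OF 1 2] by (rule runs_mono) (use assms in auto)
qed

definition shiftp :: "nat \<Rightarrow> nat \<Rightarrow> prog" where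
  "shiftp a b = Branch a Skip (Seq (Pop a) (Push b False)) (Seq (Pop a) (Push b True))"

lemma runs_shiftp:
  assumes "a \<noteq> b"
  shows "runs (shiftp a b) s 3 (s(a := tl (s a), b := (case s a of [] \<Rightarrow> s b | x # _ \<Rightarrow> x # s b)))"
proof (cases "s a")
  case Nil
  have "runs (shiftp a b) s (1 + 1) s"
    unfolding shiftp_def by (intro runs_Branch) (use Nil runs_Skip in simp)
  then have "runs (shiftp a b) s 3 s" by (rule runs_mono) simp
  then show ?thesis using Nil assms by (simp add: fun_upd_idem)
next
  case (Cons x xs)
  have "runs (Seq (Pop a) (Push b x)) s (1 + 1) (s(a := tl (s a), b := x # s b))"
    by (rule runs_Seq[OF runs_Pop runs_Push']) (use assms in auto)
  then have "runs (shiftp a b) s (1 + (1 + 1)) (s(a := tl (s a), b := x # s b))"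
    unfolding shiftp_def by (intro runs_Branch) (use Cons in auto)
  then show ?thesis using Cons by (simp add: numeral_3_eq_3)
qed

text \<open>Moving reverses: two moves restore the order, and one move straightens a string that was
  assembled backwards in \<open>r_buf\<close>.\<close>

definition movep :: "nat \<Rightarrow> nat \<Rightarrow> prog" where
  "movep a b = While a (shiftp a b)"

lemma runs_movep:
  assumes "a \<noteq> b" "length (s a) \<le> m" "s' = s(a := [], b := rev (s a) @ s b)"
  shows "runs (movep a b) s (4 * m + 1) s'"
  unfolding movep_def
proof (rule runs_While[where m = "length (s a)" and T = 3 and f = "\<lambda>j. s(a := drop j (s a),
        b := rev (take j (s a)) @ s b)"], rule conjI)
  fix j assume "j < length (s a)"
  then have "drop j (s a) = s a ! j # drop (Suc j) (s a)" by (simp add: Cons_nth_drop_Suc)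
  with \<open>j < length (s a)\<close> show "runs (shiftp a b) (s(a := drop j (s a), b := rev (take j (s a)) @ s b)) 3
        (s(a := drop (Suc j) (s a), b := rev (take (Suc j) (s a)) @ s b))"
    using assms by - (rule back_subst[where P="runs (shiftp a b) _ _", OF runs_shiftp],
      auto simp: fun_eq_iff take_Suc_conv_app_nth)
qed (use assms in \<open>auto simp: fun_eq_iff\<close>)

definition clearp :: "nat \<Rightarrow> prog" where
  "clearp a = While a (Pop a)"

lemma runs_clearp:
  assumes "length (s a) \<le> m" "s' = s(a := [])"
  shows "runs (clearp a) s (2 * m + 1) s'"
  unfolding clearp_def
proof (rule runs_While[where m = "length (s a)" and T = 1 and f = "\<lambda>j. s(a := drop j (s a))"], rule conjI)
  fix j assume "j < length (s a)"
  show "runs (Pop a) (s(a := drop j (s a))) 1 (s(a := drop (Suc j) (s a)))"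
    by (rule runs_Pop') (simp add: drop_Suc tl_drop)
qed (use assms in auto)

definition setp :: "nat \<Rightarrow> prog" where
  "setp a = Branch a Skip Skip (Push r_bit True)"

lemma runs_setp:
  assumes "s r_bit = []" "s' = s(r_bit := (if s a \<noteq> [] \<and> hd (s a) then [True] else []))"
  shows "runs (setp a) s 2 s'"
proof -
  have "runs (setp a) s (1 + 1) s'"
    unfolding setp_def
    by (rule runs_Branch) (use assms runs_Skip[of s] runs_Push[of r_bit True s] in \<open>auto split: list.splits
      simp: fun_upd_idem\<close>)
  then show ?thesis by (simp only: one_add_one)
qed

definition testp :: "nat \<Rightarrow> prog \<Rightarrow> prog \<Rightarrow> prog" where
  "testp a p q = Branch a q q (Seq (Pop a) p)"

lemma runs_testp:
  assumes "s a = (if b then [True] else [])"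
    and "b \<Longrightarrow> runs p (s(a := [])) T s'" "\<not> b \<Longrightarrow> runs q (s(a := [])) T s'"
  shows "runs (testp a p q) s (2 + T) s'"
proof (cases b)
  case True
  then have "runs (Seq (Pop a) p) s (1 + T) s'"
    using assms by (intro runs_Seq[OF runs_Pop]) auto
  then have "runs (testp a p q) s (1 + (1 + T)) s'" unfolding testp_def
    by (intro runs_Branch) (use assms True in auto)
  then show ?thesis by simp
next
  case False
  then have "runs q s T s'" using assms by (simp add: fun_upd_idem)
  then have "runs (testp a p q) s (1 + T) s'" unfolding testp_def
    by (intro runs_Branch) (use assms False in auto)
  then show ?thesis by (rule runs_mono) simp
qed

definition bit_at :: "bool list \<Rightarrow> nat \<Rightarrow> bool" where
  "bit_at xs i \<longleftrightarrow> i < length xs \<and> xs ! i"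

text \<open>The address \<open>u * n + v\<close> is built in unary in \<open>r_idx\<close>, and the
  bits before it are parked on \<open>r_stk\<close>. Shifting from an exhausted stack does nothing,
  so a bit missing at the end of a matrix reads as \<open>False\<close>.\<close>

definition readp :: "nat \<Rightarrow> nat \<Rightarrow> nat \<Rightarrow> prog" where
  "readp a x y =
     Seq (copyp x r_c)
     (Seq (While r_c (Seq (Pop r_c) (copyp r_n r_idx)))
     (Seq (copyp y r_idx)
     (Seq (While r_idx (Seq (Pop r_idx) (shiftp a r_stk)))
     (Seq (setp a)
          (movep r_stk a)))))"

lemma index_less: "u < n \<Longrightarrow> v < n \<Longrightarrow> u * n + v < n * (n :: nat)"
proof -
  assume a: "u < n" "v < n"
  then have "u * n + n \<le> n * n" by (metis Suc_leI add.commute mult_Suc mult_le_mono1)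
  with a show ?thesis by linarith
qed

lemma runs_readp:
  assumes "s x = replicate u True" "s y = replicate v True" "s r_n = replicate n True"
    and "u < n" "v < n" "10 \<le> x" "10 \<le> y" "10 \<le> a" "a \<noteq> x" "a \<noteq> y"
    and "s r_c = []" "s r_idx = []" "s r_tmp = []" "s r_stk = []" "s r_bit = []"
    and s': "s' = s(r_bit := (if bit_at (s a) (u * n + v) then [True] else []))"
  shows "runs (readp a x y) s (16 * n * n + 18 * n + 12) s'"
proof -
  note [simp] = assms(1-3,9-15)
  have [simp]: "x \<noteq> i" "y \<noteq> i" "a \<noteq> i" "i \<noteq> x" "i \<noteq> y" "i \<noteq> a" if "i < 10" for i
    using assms that by auto
  let ?m = "u * n + v"
  have m: "?m < n * n" using assms index_less by blast
  have 1: "runs (copyp x r_c) s (7 * n + 2) (s(r_c := replicate u True))"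
    by (rule runs_copyp[where m = u]) (use assms in auto)
  have 2: "runs (While r_c (Seq (Pop r_c) (copyp r_n r_idx))) (s(r_c := replicate u True))
      (7 * n * n + 4 * n + 1) (s(r_idx := replicate (u * n) True))"
  proof (rule runs_While[where m = u and T = "1 + (7 * n + 2)" and
      f = "\<lambda>j. s(r_c := replicate (u - j) True, r_idx := replicate (j * n) True)"], rule conjI)
    fix j assume "j < u"
    then show "runs (Seq (Pop r_c) (copyp r_n r_idx)) (s(r_c := replicate (u - j) True, r_idx := replicate (j * n) True))
       (1 + (7 * n + 2)) (s(r_c := replicate (u - Suc j) True, r_idx := replicate (Suc j * n) True))"
      by (intro runs_Seq[OF runs_Pop] runs_copyp[where m = n]) 
        (auto simp: fun_eq_iff replicate_True_step replicate_add)
  next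
    have "u * (7 * n + 4) \<le> n * (7 * n + 4)" using assms by (intro mult_le_mono1) auto
    then show "u * (1 + (7 * n + 2) + 1) + 1 \<le> 7 * n * n + 4 * n + 1" by (simp add: algebra_simps)
  qed (auto simp: fun_eq_iff replicate_True_step)
  have 3: "runs (copyp y r_idx) (s(r_idx := replicate (u * n) True)) (7 * n + 2) (s(r_idx := replicate ?m True))"
    by (rule runs_copyp[where m = v]) (use assms in \<open>auto simp: fun_eq_iff simp flip: replicate_add add.commute\<close>)
  have 4: "runs (While r_idx (Seq (Pop r_idx) (shiftp a r_stk))) (s(r_idx := replicate ?m True)) (5 * n * n + 1)
      (s(a := drop ?m (s a), r_stk := rev (take ?m (s a))))"
  proof (rule runs_While[where m = ?m and T = "1 + 3" and
      f = "\<lambda>j. s(r_idx := replicate (?m - j) True, a := drop j (s a), r_stk := rev (take j (s a)))"], rule conjI)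
    fix j assume j: "j < ?m"
    let ?f = "\<lambda>j. s(r_idx := replicate (?m - j) True, a := drop j (s a), r_stk := rev (take j (s a)))"
    have *: "(case drop j (s a) of [] \<Rightarrow> rev (take j (s a)) | x # _ \<Rightarrow> x # rev (take j (s a))) = rev (take (Suc j) (s a))"
      by (cases "j < length (s a)") (auto simp: take_Suc_conv_app_nth simp flip: Cons_nth_drop_Suc)
    show "runs (Seq (Pop r_idx) (shiftp a r_stk)) (?f j) (1 + 3) (?f (Suc j))"
      by (rule runs_Seq[OF runs_Pop], rule back_subst[where P="runs (shiftp a r_stk) _ _", OF runs_shiftp])
        (use j * in \<open>auto simp: fun_eq_iff replicate_True_step drop_Suc tl_drop cong: list.case_cong\<close>)
  next
    show "?m * (1 + 3 + 1) + 1 \<le> 5 * n * n + 1" using m by simp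
  qed (auto simp: fun_eq_iff)
  have 5: "runs (setp a) (s(a := drop ?m (s a), r_stk := rev (take ?m (s a)))) 2
      (s(a := drop ?m (s a), r_stk := rev (take ?m (s a)), r_bit := (if bit_at (s a) ?m then [True] else [])))"
    by (rule runs_setp) (auto simp: fun_eq_iff bit_at_def hd_drop_conv_nth)
  have 6: "runs (movep r_stk a) (s(a := drop ?m (s a), r_stk := rev (take ?m (s a)), r_bit := (if bit_at (s a) ?m then [True] else [])))
      (4 * (n * n) + 1) s'"
    by (rule runs_movep) (use m s' in \<open>auto simp: fun_eq_iff\<close>)
  have "runs (readp a x y) s ((7 * n + 2) + ((7 * n * n + 4 * n + 1) + ((7 * n + 2) + ((5 * n * n + 1) +
      (2 + (4 * (n * n) + 1)))))) s'"
    unfolding readp_def using 1 2 3 4 5 6 by (intro runs_Seq)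
  then show ?thesis by (rule runs_mono) (simp add: algebra_simps)
qed

text \<open>Popping in parallel computes the truncated difference of the two values, which is
  nonempty iff the first is smaller; popping an empty stack is harmless.\<close>

definition lessp :: "nat \<Rightarrow> nat \<Rightarrow> prog" where
  "lessp x y =
     Seq (copyp x r_c)
     (Seq (copyp y r_idx)
     (Seq (While r_c (Seq (Pop r_c) (Pop r_idx)))
     (Seq (setp r_idx)
          (clearp r_idx))))"

lemma runs_lessp:
  assumes "s x = replicate u True" "s y = replicate v True"
    and "u < n" "v < n" "10 \<le> x" "10 \<le> y"
    and "s r_c = []" "s r_idx = []" "s r_tmp = []" "s r_bit = []"
    and s': "s' = s(r_bit := (if u < v then [True] else []))"
  shows "runs (lessp x y) s (19 * n + 8) s'"
proof -
  note [simp] = assms(1,2,7-10)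
  have [simp]: "x \<noteq> i" "y \<noteq> i" "i \<noteq> x" "i \<noteq> y" if "i < 10" for i
    using assms that by auto
  have 1: "runs (copyp x r_c) s (7 * n + 2) (s(r_c := replicate u True))"
    by (rule runs_copyp[where m = u]) (use assms in auto)
  have 2: "runs (copyp y r_idx) (s(r_c := replicate u True)) (7 * n + 2)
      (s(r_c := replicate u True, r_idx := replicate v True))"
    by (rule runs_copyp[where m = v]) (use assms in auto)
  have 3: "runs (While r_c (Seq (Pop r_c) (Pop r_idx))) (s(r_c := replicate u True, r_idx := replicate v True))
      (3 * n + 1) (s(r_idx := replicate (v - u) True))"
  proof (rule runs_While[where m = u and T = "1 + 1" and
      f = "\<lambda>j. s(r_c := replicate (u - j) True, r_idx := replicate (v - j) True)"], rule conjI)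
    fix j assume "j < u"
    have "tl (replicate (v - j) True) = replicate (v - Suc j) True" by (cases "v - j") auto
    with \<open>j < u\<close> show "runs (Seq (Pop r_c) (Pop r_idx)) (s(r_c := replicate (u - j) True, r_idx := replicate (v - j) True))
       (1 + 1) (s(r_c := replicate (u - Suc j) True, r_idx := replicate (v - Suc j) True))"
      by (intro runs_Seq[OF runs_Pop runs_Pop'])
        (auto simp: fun_eq_iff replicate_True_step)
  qed (use assms in \<open>auto simp: fun_eq_iff replicate_True_step\<close>)
  have 4: "runs (setp r_idx) (s(r_idx := replicate (v - u) True)) 2
      (s(r_idx := replicate (v - u) True, r_bit := (if u < v then [True] else [])))"
    by (rule runs_setp) (auto simp: fun_eq_iff)
  have 5: "runs (clearp r_idx) (s(r_idx := replicate (v - u) True, r_bit := (if u < v then [True] else [])))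
      (2 * n + 1) s'"
    by (rule runs_clearp) (use s' assms in \<open>auto simp: fun_eq_iff\<close>)
  have "runs (lessp x y) s ((7 * n + 2) + ((7 * n + 2) + ((3 * n + 1) + (2 + (2 * n + 1))))) s'"
    unfolding lessp_def using 1 2 3 4 5 by (intro runs_Seq)
  then show ?thesis by (rule runs_mono) simp
qed

definition forvar :: "nat \<Rightarrow> prog \<Rightarrow> prog" where
  "forvar d p =
     Seq (copyp r_n (cnt d))
     (Seq (While (cnt d) (Seq (Pop (cnt d)) (Seq p (Push (var d) True))))
          (clearp (var d)))"

text \<open>The assumptions \<open>ins\<close> make the invariant blind to the two loop registers,
  which the loop itself changes between rounds; the body has to return both as it found
  them.\<close>

lemma runs_forvar:
  assumes "s r_n = replicate n True" "s r_tmp = []" "s (var d) = []" "s (cnt d) = []" "I 0 s"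
    and ins: "\<And>j s xs ys. I j (s(var d := xs)) = I j s" "\<And>j s xs. I j (s(cnt d := xs)) = I j s"
    and step: "\<And>j s. j < n \<Longrightarrow> I j s \<Longrightarrow> s (var d) = replicate j True \<Longrightarrow>
      \<exists>s'. runs p s T s' \<and> I (Suc j) s' \<and> s' (var d) = s (var d) \<and> s' (cnt d) = s (cnt d)"
  shows "\<exists>s'. runs (forvar d p) s (n * (T + 12) + 4) s' \<and> I n s' \<and> s' (var d) = [] \<and> s' (cnt d) = []"
proof -
  let ?s1 = "s(cnt d := replicate n True)"
  have 1: "runs (copyp r_n (cnt d)) s (7 * n + 2) ?s1"
    by (rule runs_copyp[where m = n]) (use assms in auto)
  let ?J = "\<lambda>j s. I j s \<and> s (var d) = replicate j True \<and> s (cnt d) = replicate (n - j) True"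
  have "\<exists>s2. runs (While (cnt d) (Seq (Pop (cnt d)) (Seq p (Push (var d) True)))) ?s1 
      (n * (1 + (T + 1) + 1) + 1) s2 \<and> ?J n s2"
  proof (rule runs_While_inv[where I = ?J and m = n and T = "1 + (T + 1)"])
    fix j s assume j: "j < n" and J: "?J j s"
    let ?t = "s(cnt d := tl (s (cnt d)))"
    obtain t' where t': "runs p ?t T t'" "I (Suc j) t'" "t' (var d) = ?t (var d)" "t' (cnt d) = ?t (cnt d)"
      using step[OF j, of ?t] J ins by auto
    have "runs (Seq (Pop (cnt d)) (Seq p (Push (var d) True))) s (1 + (T + 1)) (t'(var d := True # t' (var d)))"
      by (intro runs_Seq[OF runs_Pop] runs_Seq[OF t'(1)] runs_Push)
    moreover have "?J (Suc j) (t'(var d := True # t' (var d)))"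
      using t' J j ins by (auto simp: replicate_True_step)
    ultimately show "s (cnt d) \<noteq> [] \<and> (\<exists>s'. runs (Seq (Pop (cnt d)) (Seq p (Push (var d) True))) s (1 + (T + 1)) s' \<and> ?J (Suc j) s')"
      using J j by (auto simp: replicate_True_step)
  qed (use assms in auto)
  then obtain s2 where 2: "runs (While (cnt d) (Seq (Pop (cnt d)) (Seq p (Push (var d) True)))) ?s1 
      (n * (1 + (T + 1) + 1) + 1) s2" and J: "?J n s2" by blast
  have 3: "runs (clearp (var d)) s2 (2 * n + 1) (s2(var d := []))"
    by (rule runs_clearp) (use J in auto)
  have "runs (forvar d p) s ((7 * n + 2) + ((n * (1 + (T + 1) + 1) + 1) + (2 * n + 1))) (s2(var d := []))"
    unfolding forvar_def using 1 2 3 by (intro runs_Seq)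
  then have "runs (forvar d p) s (n * (T + 12) + 4) (s2(var d := []))"
    by (rule runs_mono) (simp add: algebra_simps)
  then show ?thesis using J ins by (intro exI[of _ "s2(var d := [])"]) auto
qed

lemma runs_forvar_fun:
  assumes "s r_n = replicate n True" "s r_tmp = []" "f 0 = s" "s (var d) = []" "s (cnt d) = []"
    "f n (var d) = []" "f n (cnt d) = []"
    and step: "\<And>j s. j < n \<Longrightarrow> (\<And>i. i \<noteq> var d \<Longrightarrow> i \<noteq> cnt d \<Longrightarrow> s i = f j i) \<Longrightarrow> s (var d) = replicate j True \<Longrightarrow>
      \<exists>s'. runs p s T s' \<and> (\<forall>i. i \<noteq> var d \<longrightarrow> i \<noteq> cnt d \<longrightarrow> s' i = f (Suc j) i) \<and>
        s' (var d) = s (var d) \<and> s' (cnt d) = s (cnt d)"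
  shows "runs (forvar d p) s (n * (T + 12) + 4) (f n)"
proof -
  have "\<exists>s'. runs (forvar d p) s (n * (T + 12) + 4) s' \<and>
      (\<forall>i. i \<noteq> var d \<longrightarrow> i \<noteq> cnt d \<longrightarrow> s' i = f n i) \<and> s' (var d) = [] \<and> s' (cnt d) = []"
    by (rule runs_forvar[where I = "\<lambda>j s. \<forall>i. i \<noteq> var d \<longrightarrow> i \<noteq> cnt d \<longrightarrow> s i = f j i"])
      (use assms in auto)
  then obtain s' where s': "runs (forvar d p) s (n * (T + 12) + 4) s'"
    "\<And>i. i \<noteq> var d \<Longrightarrow> i \<noteq> cnt d \<Longrightarrow> s' i = f n i" "s' (var d) = []" "s' (cnt d) = []" by blast
  have "s' = f n" using s' assms by (metis ext)
  with s' show ?thesis by simp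
qed

section \<open>First-order formulas over binary relations\<close>

datatype fm = Rel nat nat nat | Less nat nat | Neg fm | Conj fm fm | Exi nat fm

type_synonym rels = "nat \<Rightarrow> nat \<Rightarrow> nat \<Rightarrow> bool"

primrec sat :: "fm \<Rightarrow> nat \<Rightarrow> rels \<Rightarrow> (nat \<Rightarrow> nat) \<Rightarrow> bool" where
  "sat (Rel r x y) n S e \<longleftrightarrow> S r (e x) (e y)"
| "sat (Less x y) n S e \<longleftrightarrow> e x < e y"
| "sat (Neg \<phi>) n S e \<longleftrightarrow> \<not> sat \<phi> n S e"
| "sat (Conj \<phi> \<psi>) n S e \<longleftrightarrow> sat \<phi> n S e \<and> sat \<psi> n S e"
| "sat (Exi x \<phi>) n S e \<longleftrightarrow> (\<exists>v<n. sat \<phi> n S (e(x := v)))"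

text \<open>The variable \<open>x\<close> lives in register \<open>var (\<rho> x)\<close>; all \<open>var j\<close>, \<open>cnt j\<close> and \<open>flg j\<close> with \<open>j \<ge> d\<close> are
  free for quantifiers.\<close>

primrec branch_fm :: "fm \<Rightarrow> (nat \<Rightarrow> nat) \<Rightarrow> nat \<Rightarrow> prog \<Rightarrow> prog \<Rightarrow> prog" where
  "branch_fm (Rel r x y) \<rho> d p q = Seq (readp (rel r) (var (\<rho> x)) (var (\<rho> y))) (testp r_bit p q)"
| "branch_fm (Less x y) \<rho> d p q = Seq (lessp (var (\<rho> x)) (var (\<rho> y))) (testp r_bit p q)"
| "branch_fm (Neg \<phi>) \<rho> d p q = branch_fm \<phi> \<rho> d q p"
| "branch_fm (Conj \<phi> \<psi>) \<rho> d p q = branch_fm \<phi> \<rho> d (branch_fm \<psi> \<rho> d p q) q"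
| "branch_fm (Exi x \<phi>) \<rho> d p q =
     Seq (forvar d (branch_fm \<phi> (\<rho>(x := d)) (Suc d) (Branch (flg d) (Push (flg d) True) Skip Skip) Skip))
         (testp (flg d) p q)"

primrec time_fm :: "fm \<Rightarrow> nat \<Rightarrow> nat" where
  "time_fm (Rel r x y) n = 16 * n * n + 18 * n + 12 + 2"
| "time_fm (Less x y) n = 19 * n + 8 + 2"
| "time_fm (Neg \<phi>) n = time_fm \<phi> n"
| "time_fm (Conj \<phi> \<psi>) n = time_fm \<phi> n + time_fm \<psi> n"
| "time_fm (Exi x \<phi>) n = n * (time_fm \<phi> n + 2 + 12) + 4 + 2"

text \<open>
  A matrix stored in a relation register may be a proper prefix of the full row-major list of
  \<open>n\<^sup>2\<close> bits; missing bits are \<open>False\<close>. In particular, an unused register is the empty relation.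
\<close>

definition represents :: "nat \<Rightarrow> rels \<Rightarrow> (nat \<Rightarrow> nat) \<Rightarrow> (nat \<Rightarrow> nat) \<Rightarrow> nat \<Rightarrow> store \<Rightarrow> bool" where
  "represents n S e \<rho> d s \<longleftrightarrow>
     s r_n = replicate n True \<and>
     s r_c = [] \<and> s r_idx = [] \<and> s r_tmp = [] \<and> s r_stk = [] \<and> s r_bit = [] \<and>
     (\<forall>x. \<rho> x < d \<and> e x < n \<and> s (var (\<rho> x)) = replicate (e x) True) \<and>
     (\<forall>j\<ge>d. s (var j) = [] \<and> s (cnt j) = [] \<and> s (flg j) = []) \<and>
     (\<forall>r. length (s (rel r)) \<le> n * n \<and>
       (\<forall>u<n. \<forall>v<n. S r u v \<longleftrightarrow> bit_at (s (rel r)) (u * n + v)))"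

text \<open>Enters the scope of a variable stored at depth \<open>d\<close>. Inside it
  \<open>represents\<close> does not constrain \<open>cnt d\<close>, \<open>flg d\<close> and
  \<open>r_buf\<close>, so earlier rounds may already have raised the flag or written
  output.\<close>

lemma good_bind:
  assumes "represents n S e \<rho> d s" "j < n" "s' (var d) = replicate j True"
    and "\<And>i. i \<noteq> var d \<Longrightarrow> i \<noteq> cnt d \<Longrightarrow> i \<noteq> flg d \<Longrightarrow> i \<noteq> r_buf \<Longrightarrow> s' i = s i"
  shows "represents n S (e(x := j)) (\<rho>(x := d)) (Suc d) s'"
proof -
  have \<rho>: "\<rho> z < d" "e z < n" "s (var (\<rho> z)) = replicate (e z) True" for z
    using assms(1) by (auto simp: represents_def)
  have "s' (var (\<rho> z)) = replicate (e z) True" for z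
    using \<rho>[of z] assms(4)[of "var (\<rho> z)"] by simp
  moreover have "s' (var z) = []" "s' (cnt z) = []" "s' (flg z) = []" if "Suc d \<le> z" for z
    using that assms(1) assms(4)[of "var z"] assms(4)[of "cnt z"] assms(4)[of "flg z"]
    by (auto simp: represents_def)
  ultimately show ?thesis
    using \<rho> assms by (auto simp: represents_def less_SucI)
qed

text \<open>Continuations take the place of a truth value, so negation swaps them and conjunction
  nests them. Copying \<open>q\<close> enlarges only the program, which is fixed with the formula; a
  run enters one copy, so the times add up. Inside the loop of a quantifier \<open>p\<close> could
  be run several times; therefore the loop only raises \<open>flg d\<close>, and the branching
  follows it.\<close>

lemma runs_branch_fm:
  assumes "represents n S e \<rho> d s"
    and "sat \<phi> n S e \<Longrightarrow> runs p s T s'" and "\<not> sat \<phi> n S e \<Longrightarrow> runs q s T s'"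
  shows "runs (branch_fm \<phi> \<rho> d p q) s (time_fm \<phi> n + T) s'"
  using assms
proof (induction \<phi> arbitrary: \<rho> d p q e s s' T)
  case (Rel r x y)
  let ?b = "bit_at (s (rel r)) (e x * n + e y)"
  have b: "S r (e x) (e y) \<longleftrightarrow> ?b" using Rel.prems(1) by (auto simp: represents_def)
  have 1: "runs (readp (rel r) (var (\<rho> x)) (var (\<rho> y))) s (16 * n * n + 18 * n + 12)
      (s(r_bit := (if ?b then [True] else [])))"
    by (rule runs_readp[where u = "e x" and v = "e y"])
      (use Rel.prems(1) in \<open>auto simp: represents_def reg_ge\<close>)
  have 2: "runs (testp r_bit p q) (s(r_bit := (if ?b then [True] else []))) (2 + T) s'"
    by (rule runs_testp[where b = ?b]) (use Rel.prems b in \<open>auto simp: represents_def fun_upd_idem\<close>)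
  from runs_Seq[OF 1 2] show ?case by (simp add: add.assoc)
next
  case (Less x y)
  let ?b = "e x < e y"
  have 1: "runs (lessp (var (\<rho> x)) (var (\<rho> y))) s (19 * n + 8)
      (s(r_bit := (if ?b then [True] else [])))"
    by (rule runs_lessp[where u = "e x" and v = "e y"])
      (use Less.prems(1) in \<open>auto simp: represents_def reg_ge\<close>)
  have 2: "runs (testp r_bit p q) (s(r_bit := (if ?b then [True] else []))) (2 + T) s'"
    by (rule runs_testp[where b = ?b]) (use Less.prems in \<open>auto simp: represents_def fun_upd_idem\<close>)
  from runs_Seq[OF 1 2] show ?case by (simp add: add.assoc)
next
  case (Neg \<phi>)
  then show ?case by simp
next
  case (Conj \<phi> \<psi>)
  have "runs (branch_fm \<phi> \<rho> d (branch_fm \<psi> \<rho> d p q) q) s (time_fm \<phi> n + (time_fm \<psi> n + T)) s'"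
  proof (rule Conj.IH(1)[OF Conj.prems(1)])
    assume "sat \<phi> n S e"
    then show "runs (branch_fm \<psi> \<rho> d p q) s (time_fm \<psi> n + T) s'"
      by (intro Conj.IH(2) Conj.prems) (use Conj.prems in auto)
  next
    assume "\<not> sat \<phi> n S e"
    then have "runs q s T s'" using Conj.prems by simp
    then show "runs q s (time_fm \<psi> n + T) s'" by (rule runs_mono) simp
  qed
  then show ?case by (simp add: add.assoc)
next
  case (Exi x \<phi>)
  \<comment> \<open>The flag is pushed only if it is empty, so it never exceeds the single bit that
    \<open>testp\<close> removes.\<close>
  let ?p = "Branch (flg d) (Push (flg d) True) Skip Skip"
  let ?f = "\<lambda>j. s(flg d := (if \<exists>v<j. sat \<phi> n S (e(x := v)) then [True] else []))"
  have 1: "runs (forvar d (branch_fm \<phi> (\<rho>(x := d)) (Suc d) ?p Skip)) s (n * (time_fm \<phi> n + 2 + 12) + 4) (?f n)"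
  proof (rule runs_forvar_fun[where f = ?f])
    fix j t assume j: "j < n" and t: "\<And>i. i \<noteq> var d \<Longrightarrow> i \<noteq> cnt d \<Longrightarrow> t i = ?f j i"
      and tv: "t (var d) = replicate j True"
    have g: "represents n S (e(x := j)) (\<rho>(x := d)) (Suc d) t"
      by (rule good_bind[where s = s and s' = t, OF Exi.prems(1) j tv]) (use t in auto)
    let ?t' = "if sat \<phi> n S (e(x := j)) then t(flg d := [True]) else t"
    have "runs (branch_fm \<phi> (\<rho>(x := d)) (Suc d) ?p Skip) t (time_fm \<phi> n + 2) ?t'"
    proof (rule Exi.IH[OF g])
      assume a: "sat \<phi> n S (e(x := j))"
      have "runs ?p t (1 + 1) ?t'"
      proof (rule runs_Branch)
        have "t (flg d) = [] \<or> t (flg d) = [True]" using t[of "flg d"] by auto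
        with a show "runs (case t (flg d) of [] \<Rightarrow> Push (flg d) True | b # _ \<Rightarrow> if b then Skip else Skip) t 1 ?t'"
          using runs_Skip[of t] runs_Push[of "flg d" True t] by (elim disjE) (simp_all add: fun_upd_idem)
      qed
      then show "runs ?p t 2 ?t'" by (simp only: one_add_one)
    next
      assume "\<not> sat \<phi> n S (e(x := j))"
      then show "runs Skip t 2 ?t'" using runs_mono[OF runs_Skip] by simp
    qed
    moreover have "?t' i = ?f (Suc j) i" if "i \<noteq> var d" "i \<noteq> cnt d" for i
      using t[OF that] by (auto simp: less_Suc_eq)
    ultimately show "\<exists>s'. runs (branch_fm \<phi> (\<rho>(x := d)) (Suc d) ?p Skip) t (time_fm \<phi> n + 2) s' \<and>
        (\<forall>i. i \<noteq> var d \<longrightarrow> i \<noteq> cnt d \<longrightarrow> s' i = ?f (Suc j) i) \<and>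
        s' (var d) = t (var d) \<and> s' (cnt d) = t (cnt d)"
      by (intro exI[of _ ?t']) auto
  qed (use Exi.prems(1) in \<open>auto simp: represents_def fun_upd_idem\<close>)
  have 2: "runs (testp (flg d) p q) (?f n) (2 + T) s'"
    by (rule runs_testp[where b = "sat (Exi x \<phi>) n S e"])
      (use Exi.prems in \<open>auto simp: represents_def fun_upd_idem\<close>)
  from runs_Seq[OF 1 2] show ?case by (simp add: add.assoc)
qed

definition emit_row :: "(nat \<Rightarrow> nat) \<Rightarrow> nat \<Rightarrow> nat \<Rightarrow> fm \<Rightarrow> prog" where
  "emit_row \<rho> d y \<psi> = forvar d (branch_fm \<psi> (\<rho>(y := d)) (Suc d) (Push r_buf True) (Push r_buf False))"

lemma runs_emit_row:
  assumes "represents n S e \<rho> d s"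
  shows "runs (emit_row \<rho> d y \<psi>) s (n * (time_fm \<psi> n + 1 + 12) + 4)
    (s(r_buf := rev (map (\<lambda>v. sat \<psi> n S (e(y := v))) [0..<n]) @ s r_buf))"
  unfolding emit_row_def
proof (rule runs_forvar_fun[where f = "\<lambda>j. s(r_buf := rev (map (\<lambda>v. sat \<psi> n S (e(y := v))) [0..<j]) @ s r_buf)"])
  let ?f = "\<lambda>j. s(r_buf := rev (map (\<lambda>v. sat \<psi> n S (e(y := v))) [0..<j]) @ s r_buf)"
  fix j t assume j: "j < n" and t: "\<And>i. i \<noteq> var d \<Longrightarrow> i \<noteq> cnt d \<Longrightarrow> t i = ?f j i"
    and tv: "t (var d) = replicate j True"
  have g: "represents n S (e(y := j)) (\<rho>(y := d)) (Suc d) t"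
    by (rule good_bind[where s = s and s' = t, OF assms j tv]) (use t in auto)
  let ?t' = "t(r_buf := sat \<psi> n S (e(y := j)) # t r_buf)"
  have "runs (branch_fm \<psi> (\<rho>(y := d)) (Suc d) (Push r_buf True) (Push r_buf False)) t (time_fm \<psi> n + 1) ?t'"
    by (rule runs_branch_fm[OF g]; rule runs_Push'; simp)
  moreover have "?t' i = ?f (Suc j) i" if "i \<noteq> var d" "i \<noteq> cnt d" for i
    using t[of i] t[of r_buf] that by auto
  ultimately show "\<exists>s'. runs (branch_fm \<psi> (\<rho>(y := d)) (Suc d) (Push r_buf True) (Push r_buf False)) t (time_fm \<psi> n + 1) s' \<and>
      (\<forall>i. i \<noteq> var d \<longrightarrow> i \<noteq> cnt d \<longrightarrow> s' i = ?f (Suc j) i) \<and> s' (var d) = t (var d) \<and> s' (cnt d) = t (cnt d)"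
    by (intro exI[of _ ?t']) auto
qed (use assms in \<open>auto simp: represents_def fun_upd_idem\<close>)

text \<open>Rows of points that fail \<open>\<phi>\<close> are left out altogether. This filter
  later lists each triangle once and reduces the output for a solution to a single vector.\<close>

definition emit_rows :: "(nat \<Rightarrow> nat) \<Rightarrow> nat \<Rightarrow> nat \<Rightarrow> nat \<Rightarrow> fm \<Rightarrow> fm \<Rightarrow> prog" where
  "emit_rows \<rho> d x y \<phi> \<psi> =
     forvar d (branch_fm \<phi> (\<rho>(x := d)) (Suc d) (emit_row (\<rho>(x := d)) (Suc d) y \<psi>) Skip)"

definition rows :: "nat \<Rightarrow> rels \<Rightarrow> (nat \<Rightarrow> nat) \<Rightarrow> nat \<Rightarrow> nat \<Rightarrow> fm \<Rightarrow> fm \<Rightarrow> nat \<Rightarrow> bool list" where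
  "rows n S e x y \<phi> \<psi> m =
     concat (map (\<lambda>u. if sat \<phi> n S (e(x := u)) then map (\<lambda>v. sat \<psi> n S (e(x := u, y := v))) [0..<n] else []) [0..<m])"

definition time_rows :: "fm \<Rightarrow> fm \<Rightarrow> nat \<Rightarrow> nat" where
  "time_rows \<phi> \<psi> n = n * (time_fm \<phi> n + (n * (time_fm \<psi> n + 1 + 12) + 4) + 12) + 4"

lemma runs_emit_rows:
  assumes "represents n S e \<rho> d s"
  shows "runs (emit_rows \<rho> d x y \<phi> \<psi>) s (time_rows \<phi> \<psi> n)
    (s(r_buf := rev (rows n S e x y \<phi> \<psi> n) @ s r_buf))"
  unfolding emit_rows_def time_rows_def
proof (rule runs_forvar_fun[where f = "\<lambda>j. s(r_buf := rev (rows n S e x y \<phi> \<psi> j) @ s r_buf)"])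
  let ?f = "\<lambda>j. s(r_buf := rev (rows n S e x y \<phi> \<psi> j) @ s r_buf)"
  let ?T = "n * (time_fm \<psi> n + 1 + 12) + 4"
  let ?p = "branch_fm \<phi> (\<rho>(x := d)) (Suc d) (emit_row (\<rho>(x := d)) (Suc d) y \<psi>) Skip"
  fix j t assume j: "j < n" and t: "\<And>i. i \<noteq> var d \<Longrightarrow> i \<noteq> cnt d \<Longrightarrow> t i = ?f j i"
    and tv: "t (var d) = replicate j True"
  have g: "represents n S (e(x := j)) (\<rho>(x := d)) (Suc d) t"
    by (rule good_bind[where s = s and s' = t, OF assms j tv]) (use t in auto)
  let ?t' = "if sat \<phi> n S (e(x := j)) then
    t(r_buf := rev (map (\<lambda>v. sat \<psi> n S (e(x := j, y := v))) [0..<n]) @ t r_buf) else t"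
  have "runs ?p t (time_fm \<phi> n + ?T) ?t'"
    by (rule runs_branch_fm[OF g]) (use runs_emit_row[OF g] runs_mono[OF runs_Skip] in auto)
  moreover have "?t' i = ?f (Suc j) i" if "i \<noteq> var d" "i \<noteq> cnt d" for i
    using t[of i] t[of r_buf] that by (auto simp: rows_def)
  ultimately show "\<exists>s'. runs ?p t (time_fm \<phi> n + ?T) s' \<and>
      (\<forall>i. i \<noteq> var d \<longrightarrow> i \<noteq> cnt d \<longrightarrow> s' i = ?f (Suc j) i) \<and> s' (var d) = t (var d) \<and> s' (cnt d) = t (cnt d)"
    by (intro exI[of _ ?t']) auto
qed (use assms in \<open>auto simp: represents_def fun_upd_idem rows_def\<close>)

section \<open>Relational programs\<close>

datatype cmd = Def nat nat nat fm | Sq cmd cmd | For nat cmd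

primrec csem :: "cmd \<Rightarrow> nat \<Rightarrow> (nat \<Rightarrow> nat) \<Rightarrow> rels \<Rightarrow> rels" where
  "csem (Def r x y \<phi>) n e S = S(r := \<lambda>u v. u < n \<and> v < n \<and> sat \<phi> n S (e(x := u, y := v)))"
| "csem (Sq c c') n e S = csem c' n e (csem c n e S)"
| "csem (For x c) n e S = fold (\<lambda>v. csem c n (e(x := v))) [0..<n] S"

text \<open>\<open>Neg (Less x x)\<close> is always true, so every row is written. The new matrix is
  assembled in \<open>r_buf\<close> before the old one is cleared; hence a formula may refer to the
  relation that it redefines.\<close>

primrec compile :: "cmd \<Rightarrow> (nat \<Rightarrow> nat) \<Rightarrow> nat \<Rightarrow> prog" where
  "compile (Def r x y \<phi>) \<rho> d =
     Seq (emit_rows \<rho> d x y (Neg (Less x x)) \<phi>) (Seq (clearp (rel r)) (movep r_buf (rel r)))"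
| "compile (Sq c c') \<rho> d = Seq (compile c \<rho> d) (compile c' \<rho> d)"
| "compile (For x c) \<rho> d = forvar d (compile c (\<rho>(x := d)) (Suc d))"

primrec time_cmd :: "cmd \<Rightarrow> nat \<Rightarrow> nat" where
  "time_cmd (Def r x y \<phi>) n = time_rows (Neg (Less x x)) \<phi> n + ((2 * (n * n) + 1) + (4 * (n * n) + 1))"
| "time_cmd (Sq c c') n = time_cmd c n + time_cmd c' n"
| "time_cmd (For x c) n = n * (time_cmd c n + 12) + 4"

lemma bit_at_concat:
  assumes "\<And>u. length (f u) = n" "u < m" "v < n"
  shows "bit_at (concat (map f [0..<m])) (u * n + v) \<longleftrightarrow> f u ! v"
  using assms(2)
proof (induction m)
  case (Suc m)
  have len: "length (concat (map f [0..<m])) = m * n"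
    using assms(1) by (induction m) auto
  show ?case
  proof (cases "u < m")
    case True
    then have "u * n + n \<le> m * n" by (metis Suc_leI add.commute mult_Suc mult_le_mono1)
    then show ?thesis using Suc.IH[OF True] len assms by (auto simp: bit_at_def nth_append)
  next
    case False
    then show ?thesis using Suc.prems len assms by (simp add: less_Suc_eq bit_at_def nth_append)
  qed
qed simp

lemma reg_notin [simp]: "var j \<notin> range rel" "cnt j \<notin> range rel" "flg j \<notin> range rel" "i < 10 \<Longrightarrow> i \<notin> range rel"
  by (auto dest: reg_neq_small(5))

text \<open>Used when a loop round ends: the relations come from the store inside the scope,
  everything else from the store before the loop.\<close>

lemma good_change_rels:
  assumes "represents n S e \<rho> d s" "represents n S' e' \<rho>' d' t"
    and "\<forall>i. i \<notin> range rel \<longrightarrow> s' i = s i" "\<And>r. s' (rel r) = t (rel r)"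
  shows "represents n S' e \<rho> d s'"
proof -
  have "s' i = s i" if "i < 10" for i using assms(3) that by simp
  moreover have "s' (var j) = s (var j)" "s' (cnt j) = s (cnt j)" "s' (flg j) = s (flg j)" for j
    using assms(3) by simp_all
  ultimately show ?thesis using assms(1,2,4) by (simp add: represents_def)
qed

lemma runs_compile:
  assumes "represents n S e \<rho> d s" "s r_buf = []"
  shows "\<exists>s'. runs (compile c \<rho> d) s (time_cmd c n) s' \<and> represents n (csem c n e S) e \<rho> d s' \<and>
    (\<forall>i. i \<notin> range rel \<longrightarrow> s' i = s i)"
  using assms
proof (induction c arbitrary: \<rho> d e s S)
  case (Def r x y \<phi>)
  let ?m = "concat (map (\<lambda>u. map (\<lambda>v. sat \<phi> n S (e(x := u, y := v))) [0..<n]) [0..<n])"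
  have m: "rows n S e x y (Neg (Less x x)) \<phi> n = ?m"
    by (simp add: rows_def)
  have len: "length ?m = n * n"
    by (simp add: length_concat sum_list_triv o_def)
  have 1: "runs (emit_rows \<rho> d x y (Neg (Less x x)) \<phi>) s (time_rows (Neg (Less x x)) \<phi> n) (s(r_buf := rev ?m))"
    using runs_emit_rows[OF Def.prems(1), of x y "Neg (Less x x)" \<phi>] Def.prems(2) m by simp
  have 2: "runs (clearp (rel r)) (s(r_buf := rev ?m)) (2 * (n * n) + 1) (s(r_buf := rev ?m, rel r := []))"
    by (rule runs_clearp) (use Def.prems in \<open>auto simp: represents_def\<close>)
  have 3: "runs (movep r_buf (rel r)) (s(r_buf := rev ?m, rel r := [])) (4 * (n * n) + 1) (s(rel r := ?m))"
    by (rule runs_movep) (use Def.prems len in \<open>auto simp: fun_eq_iff\<close>)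
  have "represents n (csem (Def r x y \<phi>) n e S) e \<rho> d (s(rel r := ?m))"
    using Def.prems(1) len unfolding represents_def by (auto simp: bit_at_concat)
  moreover have "runs (compile (Def r x y \<phi>) \<rho> d) s (time_cmd (Def r x y \<phi>) n) (s(rel r := ?m))"
    using runs_Seq[OF 1 runs_Seq[OF 2 3]] by (simp only: compile.simps time_cmd.simps)
  moreover have "\<forall>i. i \<notin> range rel \<longrightarrow> (s(rel r := ?m)) i = s i" by auto
  ultimately show ?case by blast
next
  case (Sq c c')
  obtain s1 where s1: "runs (compile c \<rho> d) s (time_cmd c n) s1" "represents n (csem c n e S) e \<rho> d s1"
    "\<forall>i. i \<notin> range rel \<longrightarrow> s1 i = s i" using Sq.IH(1)[OF Sq.prems] by blast
  have "s1 r_buf = []" using s1(3) Sq.prems(2) by simp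
  from Sq.IH(2)[OF s1(2) this] obtain s2 where s2: "runs (compile c' \<rho> d) s1 (time_cmd c' n) s2"
    "represents n (csem c' n e (csem c n e S)) e \<rho> d s2"
    "\<forall>i. i \<notin> range rel \<longrightarrow> s2 i = s1 i" by blast
  show ?case using runs_Seq[OF s1(1) s2(1)] s2 s1 by auto
next
  case (For x c)
  let ?S = "\<lambda>j. fold (\<lambda>v. csem c n (e(x := v))) [0..<j] S"
  \<comment> \<open>At depth \<open>d\<close>, \<open>represents\<close> wants \<open>var d\<close>
    and \<open>cnt d\<close> empty, although the running loop occupies them; so the invariant speaks
    of the store with both blanked.\<close>
  let ?h = "\<lambda>t::store. t(var d := [], cnt d := [])"
  let ?I = "\<lambda>j t. represents n (?S j) e \<rho> d (?h t) \<and> (\<forall>i. i \<notin> range rel \<longrightarrow> ?h t i = s i)"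
  have h: "?h s = s" using For.prems by (auto simp: represents_def fun_eq_iff)
  have "\<exists>s'. runs (forvar d (compile c (\<rho>(x := d)) (Suc d))) s (n * (time_cmd c n + 12) + 4) s' \<and> ?I n s' \<and>
      s' (var d) = [] \<and> s' (cnt d) = []"
  proof (rule runs_forvar[where I = ?I])
    show "?I 0 s" using For.prems h by simp
  next
    fix j t assume j: "j < n" and I: "?I j t" and tv: "t (var d) = replicate j True"
    have g: "represents n (?S j) (e(x := j)) (\<rho>(x := d)) (Suc d) t"
      by (rule good_bind[where s = "?h t" and s' = t, OF conjunct1[OF I] j tv]) auto
    have "r_buf \<notin> range rel" by simp
    with I have "?h t r_buf = s r_buf" by blast
    then have b: "t r_buf = []" using For.prems by simp
    obtain t' where t': "runs (compile c (\<rho>(x := d)) (Suc d)) t (time_cmd c n) t'"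
      "represents n (csem c n (e(x := j)) (?S j)) (e(x := j)) (\<rho>(x := d)) (Suc d) t'"
      "\<forall>i. i \<notin> range rel \<longrightarrow> t' i = t i"
      using For.IH[OF g b] by blast
    have f: "\<forall>i. i \<notin> range rel \<longrightarrow> ?h t' i = s i"
    proof (intro allI impI)
      fix i assume "i \<notin> range rel"
      then have "t' i = t i" "?h t i = s i" using t'(3) conjunct2[OF I] by blast+
      then show "?h t' i = s i" by (cases "i = var d \<or> i = cnt d") auto
    qed
    moreover have "represents n (csem c n (e(x := j)) (?S j)) e \<rho> d (?h t')"
      by (rule good_change_rels[OF For.prems(1) t'(2) f]) simp
    moreover have "?S (Suc j) = csem c n (e(x := j)) (?S j)" by simp
    ultimately have "?I (Suc j) t'" by simp
    then show "\<exists>s'. runs (compile c (\<rho>(x := d)) (Suc d)) t (time_cmd c n) s' \<and> ?I (Suc j) s' \<and>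
        s' (var d) = t (var d) \<and> s' (cnt d) = t (cnt d)"
      using t' by (intro exI[of _ t']) auto
  qed (use For.prems in \<open>auto simp: represents_def fun_upd_idem fun_upd_twist\<close>)
  then obtain s' where s': "runs (forvar d (compile c (\<rho>(x := d)) (Suc d))) s (n * (time_cmd c n + 12) + 4) s'"
    "?I n s'" "s' (var d) = []" "s' (cnt d) = []" by blast
  then have "?h s' = s'" by (auto simp: fun_eq_iff)
  with s' show ?case by (intro exI[of _ s']) auto
qed

section \<open>Polynomial bounds\<close>

definition poly_bounded :: "(nat \<Rightarrow> nat) \<Rightarrow> bool" where
  "poly_bounded f \<longleftrightarrow> (\<exists>q. \<forall>n. f n \<le> poly q n)"

lemma poly_bounded_id: "poly_bounded (\<lambda>n. n)"
  unfolding poly_bounded_def by (rule exI[of _ "[:0, 1:]"]) simp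

lemma poly_bounded_const: "poly_bounded (\<lambda>n. c)"
  unfolding poly_bounded_def by (rule exI[of _ "[:c:]"]) simp

lemma poly_bounded_add: "poly_bounded f \<Longrightarrow> poly_bounded g \<Longrightarrow> poly_bounded (\<lambda>n. f n + g n)"
  unfolding poly_bounded_def by (metis poly_add add_mono)

lemma poly_bounded_mult: "poly_bounded f \<Longrightarrow> poly_bounded g \<Longrightarrow> poly_bounded (\<lambda>n. f n * g n)"
  unfolding poly_bounded_def by (metis poly_mult mult_le_mono)

lemmas poly_bounded_intros = poly_bounded_add poly_bounded_mult poly_bounded_id poly_bounded_const

lemma poly_bounded_time_fm: "poly_bounded (time_fm \<phi>)"
proof (induction \<phi>)
  case (Neg \<phi>)
  then show ?case by (simp add: poly_bounded_def)
qed (simp_all only: time_fm.simps[abs_def], (intro poly_bounded_intros | assumption)+)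

lemma poly_bounded_time_rows: "poly_bounded (time_rows \<phi> \<psi>)"
  unfolding time_rows_def[abs_def] by (intro poly_bounded_intros poly_bounded_time_fm)

lemma poly_bounded_time_cmd: "poly_bounded (time_cmd c)"
  by (induction c) (simp_all only: time_cmd.simps[abs_def], (intro poly_bounded_intros poly_bounded_time_rows | assumption)+)

lemma poly_nat_mono: "a \<le> b \<Longrightarrow> poly (q :: nat poly) a \<le> poly q b"
  by (induction q) (auto intro: add_mono mult_le_mono)

section \<open>Running a relational program on encoded instances\<close>

text \<open>\<open>While\<close> tests only for emptiness, so \<open>r_bit\<close> is the flag that
  keeps the loop alive until the \<open>False\<close> that ends the unary number. Each digit adds
  three to \<open>r_n\<close>, which supplies \<open>n = 3 * k\<close>. The double moves keep the
  bits in order.\<close>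

definition parsep :: prog where
  "parsep =
     Seq (Push r_bit True)
     (Seq (While r_bit
            (Branch r_out (Pop r_bit) (Seq (Pop r_out) (Pop r_bit))
              (Seq (Pop r_out) (Seq (Push r_k True)
                (Seq (Push r_n True) (Seq (Push r_n True) (Push r_n True)))))))
     (Seq (movep r_out r_stk) (Seq (movep r_stk (rel 0))
     (Seq (movep r_in2 r_stk) (movep r_stk (rel 1))))))"

definition parsed_store :: "nat \<Rightarrow> bool list \<Rightarrow> bool list \<Rightarrow> store" where
  "parsed_store k xs ys = (\<lambda>_. [])(r_n := replicate (3 * k) True, r_k := replicate k True, rel 0 := xs, rel 1 := ys)"

lemma runs_parsep:
  assumes "length xs \<le> m" "length ys \<le> m"
  shows "runs parsep (input_store [unary k @ xs, ys]) (7 * k + 13 + 16 * m) (parsed_store k xs ys)"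
proof -
  let ?s = "(\<lambda>_. [])(r_out := unary k @ xs, r_in2 := ys)"
  let ?t = "(\<lambda>_. [])(r_n := replicate (3 * k) True, r_k := replicate k True, r_out := xs, r_in2 := ys)"
  \<comment> \<open>The first \<open>k\<close> rounds consume the digits and one more the separator,
    hence \<open>Suc k\<close> rounds.\<close>
  let ?f = "\<lambda>j. if j \<le> k then (\<lambda>_. [])(r_n := replicate (3 * j) True, r_k := replicate j True,
    r_out := replicate (k - j) True @ False # xs, r_in2 := ys, r_bit := [True]) else ?t"
  have s: "input_store [unary k @ xs, ys] = ?s"
    by (auto simp: input_store_def fun_eq_iff less_Suc_eq)
  have rep3: "replicate (3 + m) True = True # True # True # replicate m True" for m
    by (simp add: numeral_3_eq_3)
  have 1: "runs (Push r_bit True) ?s 1 (?f 0)"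
    by (rule runs_Push') (auto simp: fun_eq_iff unary_def)
  have 2: "runs (While r_bit
            (Branch r_out (Pop r_bit) (Seq (Pop r_out) (Pop r_bit))
              (Seq (Pop r_out) (Seq (Push r_k True)
                (Seq (Push r_n True) (Seq (Push r_n True) (Push r_n True))))))) (?f 0) (7 * k + 8) ?t"
  proof (rule runs_While[where m = "Suc k" and f = ?f and T = "1 + 5"], rule conjI)
    fix j assume "j < Suc k"
    then consider "j < k" | "j = k" by linarith
    then show "runs (Branch r_out (Pop r_bit) (Seq (Pop r_out) (Pop r_bit))
              (Seq (Pop r_out) (Seq (Push r_k True)
                (Seq (Push r_n True) (Seq (Push r_n True) (Push r_n True)))))) (?f j) (1 + 5) (?f (Suc j))"
    proof cases
      case 1
      have "runs (Seq (Pop r_out) (Seq (Push r_k True)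
                (Seq (Push r_n True) (Seq (Push r_n True) (Push r_n True))))) (?f j) (1 + (1 + (1 + (1 + 1)))) (?f (Suc j))"
        by (intro runs_Seq[OF runs_Pop runs_Seq[OF runs_Push runs_Seq[OF runs_Push runs_Seq[OF runs_Push runs_Push']]]])
          (use 1 rep3 in \<open>auto simp: fun_eq_iff replicate_True_step\<close>)
      then have "runs (Seq (Pop r_out) (Seq (Push r_k True)
                (Seq (Push r_n True) (Seq (Push r_n True) (Push r_n True))))) (?f j) 5 (?f (Suc j))"
        by (rule runs_mono) simp
      with 1 show ?thesis by (intro runs_Branch) (simp add: replicate_True_step)
    next
      case 2
      have "runs (Seq (Pop r_out) (Pop r_bit)) (?f j) (1 + 1) (?f (Suc j))"
        by (intro runs_Seq[OF runs_Pop runs_Pop']) (use 2 in \<open>auto simp: fun_eq_iff\<close>)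
      then have "runs (Seq (Pop r_out) (Pop r_bit)) (?f j) 5 (?f (Suc j))"
        by (rule runs_mono) simp
      with 2 show ?thesis by (intro runs_Branch) simp
    qed
  qed auto
  have 3: "runs (movep r_out r_stk) ?t (4 * m + 1) (?t(r_out := [], r_stk := rev xs))"
    by (rule runs_movep) (use assms in auto)
  have 4: "runs (movep r_stk (rel 0)) (?t(r_out := [], r_stk := rev xs)) (4 * m + 1) (?t(r_out := [], rel 0 := xs))"
    by (rule runs_movep) (use assms in \<open>auto simp: fun_eq_iff\<close>)
  have 5: "runs (movep r_in2 r_stk) (?t(r_out := [], rel 0 := xs)) (4 * m + 1)
      (?t(r_out := [], r_in2 := [], r_stk := rev ys, rel 0 := xs))"
    by (rule runs_movep) (use assms in \<open>auto simp: fun_eq_iff\<close>)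
  have 6: "runs (movep r_stk (rel 1)) (?t(r_out := [], r_in2 := [], r_stk := rev ys, rel 0 := xs)) (4 * m + 1)
      (parsed_store k xs ys)"
    by (rule runs_movep) (use assms in \<open>auto simp: fun_eq_iff parsed_store_def\<close>)
  show ?thesis
    unfolding parsep_def s
    by (rule runs_mono[OF runs_Seq[OF 1 runs_Seq[OF 2 runs_Seq[OF 3 runs_Seq[OF 4 runs_Seq[OF 5 6]]]]]]) simp
qed

definition finishp :: "bool \<Rightarrow> fm \<Rightarrow> fm \<Rightarrow> prog" where
  "finishp h \<phi> \<psi> =
     Seq (if h then Seq (copyp r_n r_buf) (Seq (Push r_buf False) (Seq (copyp r_k r_buf) (Seq (Push r_buf False)
            (Seq (copyp r_k r_buf) (Push r_buf False))))) else Skip)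
     (Seq (emit_rows (\<lambda>_. 0) 1 0 1 \<phi> \<psi>) (movep r_buf r_out))"

text \<open>The numbers \<open>n\<close>, \<open>k\<close> and the number of sets, which for a
  partition of \<open>3 * k\<close> points into triples is again \<open>k\<close>.\<close>

definition header :: "bool \<Rightarrow> nat \<Rightarrow> bool list" where
  "header h k = (if h then unary (3 * k) @ unary k @ unary k else [])"

lemma length_rows: "length (rows n S e x y \<phi> \<psi> m) \<le> m * n"
  by (induction m) (auto simp: rows_def)

lemma runs_finishp:
  assumes "represents n S (\<lambda>_. 0) (\<lambda>_. 0) 1 s" "s r_buf = []" "s r_out = []" "s r_k = replicate k True" "n = 3 * k"
  shows "\<exists>s'. runs (finishp h \<phi> \<psi>) s (time_rows \<phi> \<psi> n + 4 * n * n + 33 * n + 22) s' \<and>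
    s' r_out = header h k @ rows n S (\<lambda>_. 0) 0 1 \<phi> \<psi> n"
proof -
  have s: "s r_n = replicate n True" "s r_tmp = []" using assms by (auto simp: represents_def)
  let ?s1 = "s(r_buf := rev (header h k))"
  have 1: "runs (if h then Seq (copyp r_n r_buf) (Seq (Push r_buf False) (Seq (copyp r_k r_buf) (Seq (Push r_buf False)
            (Seq (copyp r_k r_buf) (Push r_buf False))))) else Skip) s (21 * n + 9) ?s1"
  proof (cases h)
    case True
    have a: "runs (copyp r_n r_buf) s (7 * n + 2) (s(r_buf := replicate n True))"
      by (rule runs_copyp[where m = n]) (use s assms in auto)
    have b: "runs (copyp r_k r_buf) (s(r_buf := xs)) (7 * n + 2) (s(r_buf := replicate k True @ xs))" for xs
      by (rule runs_copyp[where m = k]) (use s assms in auto)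
    have c: "runs (Push r_buf False) (s(r_buf := xs)) 1 (s(r_buf := False # xs))" for xs
      by (rule runs_Push') auto
    have "runs (Seq (copyp r_n r_buf) (Seq (Push r_buf False) (Seq (copyp r_k r_buf) (Seq (Push r_buf False)
            (Seq (copyp r_k r_buf) (Push r_buf False)))))) s 
       ((7 * n + 2) + (1 + ((7 * n + 2) + (1 + ((7 * n + 2) + 1)))))
       (s(r_buf := False # replicate k True @ False # replicate k True @ False # replicate n True))"
      by (intro runs_Seq[OF a] runs_Seq[OF c] runs_Seq[OF b] c)
    then show ?thesis using True assms(5) by (auto simp: header_def unary_def elim!: runs_mono)
  next
    case False
    then show ?thesis using runs_mono[OF runs_Skip] assms(2) by (simp add: header_def fun_upd_idem)
  qed
  have g: "represents n S (\<lambda>_. 0) (\<lambda>_. 0) 1 ?s1" using assms(1) by (auto simp: represents_def)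
  let ?s2 = "s(r_buf := rev (header h k @ rows n S (\<lambda>_. 0) 0 1 \<phi> \<psi> n))"
  have 2: "runs (emit_rows (\<lambda>_. 0) 1 0 1 \<phi> \<psi>) ?s1 (time_rows \<phi> \<psi> n) ?s2"
    using runs_emit_rows[OF g, of 0 1 \<phi> \<psi>] by simp
  have "length (header h k) \<le> 3 * n + 3" using assms(5) by (simp add: header_def unary_def)
  then have len: "length (header h k @ rows n S (\<lambda>_. 0) 0 1 \<phi> \<psi> n) \<le> n * n + 3 * n + 3"
    using length_rows[of n S "\<lambda>_. 0" 0 1 \<phi> \<psi> n] by simp
  have 3: "runs (movep r_buf r_out) ?s2 (4 * (n * n + 3 * n + 3) + 1)
      (s(r_out := header h k @ rows n S (\<lambda>_. 0) 0 1 \<phi> \<psi> n))"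
    by (rule runs_movep) (use len assms in \<open>auto simp: fun_eq_iff\<close>)
  have "runs (finishp h \<phi> \<psi>) s (time_rows \<phi> \<psi> n + 4 * n * n + 33 * n + 22)
      (s(r_out := header h k @ rows n S (\<lambda>_. 0) 0 1 \<phi> \<psi> n))"
    unfolding finishp_def by (rule runs_mono[OF runs_Seq[OF 1 runs_Seq[OF 2 3]]]) (simp add: algebra_simps)
  then show ?thesis by (intro exI[of _ "s(r_out := header h k @ rows n S (\<lambda>_. 0) 0 1 \<phi> \<psi> n)"]) auto
qed

definition input_rels :: "nat \<Rightarrow> bool list \<Rightarrow> bool list \<Rightarrow> rels" where
  "input_rels n xs ys r u v \<longleftrightarrow> u < n \<and> v < n \<and> bit_at (if r = 0 then xs else if r = 1 then ys else []) (u * n + v)"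

text \<open>At the start every variable denotes the point 0, which exists because
  \<open>0 < k\<close>.\<close>

lemma good_parsed_store:
  assumes "n = 3 * k" "0 < k" "length xs \<le> n * n" "length ys \<le> n * n"
  shows "represents n (input_rels n xs ys) (\<lambda>_. 0) (\<lambda>_. 0) 1 (parsed_store k xs ys)"
  using assms by (auto simp: represents_def parsed_store_def input_rels_def bit_at_def)

definition result :: "bool \<Rightarrow> fm \<Rightarrow> fm \<Rightarrow> cmd \<Rightarrow> nat \<Rightarrow> bool list \<Rightarrow> bool list \<Rightarrow> bool list" where
  "result h \<phi> \<psi> c k xs ys = header h k @
     rows (3 * k) (csem c (3 * k) (\<lambda>_. 0) (input_rels (3 * k) xs ys)) (\<lambda>_. 0) 0 1 \<phi> \<psi> (3 * k)"

text \<open>Serves both maps of the reduction: a missing second input and an empty one give the same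
  initial store.\<close>

lemma poly_time_on_result:
  assumes "\<And>a. a \<in> A \<Longrightarrow> inp a = [unary (k a) @ xs a, ys a] \<or> inp a = [unary (k a) @ xs a] \<and> ys a = []"
    and "\<And>a. a \<in> A \<Longrightarrow> 0 < k a"
    and "\<And>a. a \<in> A \<Longrightarrow> length (xs a) \<le> (3 * k a) * (3 * k a)"
    and "\<And>a. a \<in> A \<Longrightarrow> length (ys a) \<le> (3 * k a) * (3 * k a)"
    and "\<And>a. a \<in> A \<Longrightarrow> out a = result h \<phi> \<psi> c (k a) (xs a) (ys a)"
  shows "poly_time_on A inp out"
proof -
  let ?T = "\<lambda>n. (7 * n + 13 + 16 * (n * n)) + (time_cmd c n + (time_rows \<phi> \<psi> n + 4 * n * n + 33 * n + 22))"
  have "poly_bounded ?T"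
    by (intro poly_bounded_intros poly_bounded_time_cmd poly_bounded_time_rows)
  then obtain q where q: "\<And>n. ?T n \<le> poly q n" by (auto simp: poly_bounded_def)
  let ?p = "Seq parsep (Seq (compile c (\<lambda>_. 0) 1) (finishp h \<phi> \<psi>))"
  show ?thesis
    unfolding poly_time_on_def
  \<comment> \<open>\<open>q\<close> bounds the time in terms of \<open>n = 3 * k\<close>, and
    \<open>k\<close> is at most the input length because it is written in unary; composing with
    \<open>[:0, 3:]\<close> converts one bound into the other.\<close>
  proof (intro exI[of _ ?p] exI[of _ "q \<circ>\<^sub>p [:0, 3:]"] ballI)
    fix a assume a: "a \<in> A"
    let ?n = "3 * k a"
    let ?S = "input_rels ?n (xs a) (ys a)"
    have inp: "input_store (inp a) = input_store [unary (k a) @ xs a, ys a]"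
      using assms(1)[OF a] by (auto simp: input_store_def fun_eq_iff less_Suc_eq)
    have 1: "runs parsep (input_store (inp a)) (7 * ?n + 13 + 16 * (?n * ?n)) (parsed_store (k a) (xs a) (ys a))"
      unfolding inp by (rule runs_mono[OF runs_parsep[where m = "?n * ?n"]]) (use assms a in auto)
    have g: "represents ?n ?S (\<lambda>_. 0) (\<lambda>_. 0) 1 (parsed_store (k a) (xs a) (ys a))"
      by (rule good_parsed_store) (use assms a in auto)
    have "parsed_store (k a) (xs a) (ys a) r_buf = []" by (simp add: parsed_store_def)
    from runs_compile[OF g this] obtain s1 where
      2: "runs (compile c (\<lambda>_. 0) 1) (parsed_store (k a) (xs a) (ys a)) (time_cmd c ?n) s1"
      and g1: "represents ?n (csem c ?n (\<lambda>_. 0) ?S) (\<lambda>_. 0) (\<lambda>_. 0) 1 s1"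
      and s1: "\<forall>i. i \<notin> range rel \<longrightarrow> s1 i = parsed_store (k a) (xs a) (ys a) i" by blast
    have s1': "s1 r_buf = []" "s1 r_out = []" "s1 r_k = replicate (k a) True"
      using s1 by (simp_all add: parsed_store_def)
    obtain s2 where
      3: "runs (finishp h \<phi> \<psi>) s1 (time_rows \<phi> \<psi> ?n + 4 * ?n * ?n + 33 * ?n + 22) s2"
      and s2: "s2 r_out = header h (k a) @ rows ?n (csem c ?n (\<lambda>_. 0) ?S) (\<lambda>_. 0) 0 1 \<phi> \<psi> ?n"
      using runs_finishp[OF g1 s1' refl] by blast
    have "runs ?p (input_store (inp a)) (?T ?n) s2"
      using runs_Seq[OF 1 runs_Seq[OF 2 3]] .
    then obtain t where t: "exec ?p (input_store (inp a)) t s2" "t \<le> ?T ?n"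
      unfolding runs_def by blast
    have "k a \<le> (\<Sum>x\<leftarrow>inp a. length x)" using assms(1)[OF a] by (auto simp: unary_def)
    then have "poly q ?n \<le> poly q (3 * (\<Sum>x\<leftarrow>inp a. length x))" by (intro poly_nat_mono) simp
    with t(2) q[of ?n] have "t \<le> poly (q \<circ>\<^sub>p [:0, 3:]) (\<Sum>x\<leftarrow>inp a. length x)"
      by (simp add: poly_pcompose mult.commute)
    with t(1) s2 assms(5)[OF a]
    show "\<exists>t s. exec ?p (input_store (inp a)) t s \<and> t \<le> poly (q \<circ>\<^sub>p [:0, 3:]) (\<Sum>x\<leftarrow>inp a. length x) \<and> s 0 = out a"
      by (auto simp: result_def)
  qed
qed

section \<open>Cyclic orders\<close>

definition adj :: "nat \<Rightarrow> nat \<Rightarrow> nat \<Rightarrow> bool" where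
  "adj n i j \<longleftrightarrow> j = Suc i mod n \<or> i = Suc j mod n"

definition ham :: "nat \<Rightarrow> (nat \<Rightarrow> nat) \<Rightarrow> (nat \<Rightarrow> nat \<Rightarrow> bool) \<Rightarrow> bool" where
  "ham n h C \<longleftrightarrow> bij_betw h {..<n} {..<n} \<and> (\<forall>i<n. \<forall>j<n. C (h i) (h j) \<longleftrightarrow> adj n i j)"

lemma Suc_mod: "i < n \<Longrightarrow> Suc i mod n = (if Suc i = n then 0 else Suc i)"
  by (simp add: mod_Suc)

lemma adj_cases:
  "i < n \<Longrightarrow> j < n \<Longrightarrow> adj n i j \<Longrightarrow> j = i + 1 \<or> i = j + 1 \<or> i = 0 \<and> j + 1 = n \<or> j = 0 \<and> i + 1 = n"
  by (auto simp: adj_def Suc_mod split: if_splits)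

lemma ham_surj:
  assumes "ham n h C" "x < n"
  obtains i where "i < n" "x = h i"
  using assms unfolding ham_def bij_betw_def by (metis imageE lessThan_iff)

lemma ham_eq_iff: "ham n h C \<Longrightarrow> i < n \<Longrightarrow> j < n \<Longrightarrow> h i = h j \<longleftrightarrow> i = j"
  unfolding ham_def bij_betw_def by (meson inj_on_eq_iff lessThan_iff)

lemma ham_less: "ham n h C \<Longrightarrow> i < n \<Longrightarrow> h i < n"
  unfolding ham_def bij_betw_def by blast

lemma ham_adj: "ham n h C \<Longrightarrow> i < n \<Longrightarrow> j < n \<Longrightarrow> C (h i) (h j) \<longleftrightarrow> adj n i j"
  unfolding ham_def by blast

lemma ham_neighbours:
  assumes "ham n h C" "3 \<le> n" "x < n"
  obtains a b where "a \<noteq> b" "a < n" "b < n" "\<And>y. y < n \<Longrightarrow> C x y \<longleftrightarrow> y = a \<or> y = b"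
proof -
  obtain i where i: "i < n" "x = h i" using ham_surj[OF assms(1,3)] .
  let ?p = "Suc i mod n" and ?q = "if i = 0 then n - 1 else i - 1"
  have lt: "?p < n" "?q < n" using i by auto
  have ne: "?p \<noteq> ?q" using i assms(2) by (auto simp: Suc_mod)
  show ?thesis
  proof
    show "h ?p \<noteq> h ?q" using ne lt ham_eq_iff[OF assms(1)] by blast
    show "h ?p < n" "h ?q < n" using lt ham_less[OF assms(1)] by blast+
    fix y assume "y < n"
    then obtain j where j: "j < n" "y = h j" using ham_surj[OF assms(1)] by blast
    have "adj n i j \<longleftrightarrow> j = ?p \<or> j = ?q" using i j by (auto simp: adj_def Suc_mod)
    then show "C x y \<longleftrightarrow> y = h ?p \<or> y = h ?q"
      using i j lt ham_adj[OF assms(1)] ham_eq_iff[OF assms(1)] by simp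
  qed
qed

text \<open>Steps along the cycle are plus or minus 1 modulo \<open>n\<close>, and three of them sum
  to 0 only if \<open>n\<close> divides 1 or 3.\<close>

lemma ham_no_triangle:
  assumes "ham n h C" "4 \<le> n" "x < n" "y < n" "z < n" "C x y" "C y z" "C x z"
  shows False
proof -
  obtain i where i: "i < n" "x = h i" using ham_surj[OF assms(1,3)] .
  obtain j where j: "j < n" "y = h j" using ham_surj[OF assms(1,4)] .
  obtain l where l: "l < n" "z = h l" using ham_surj[OF assms(1,5)] .
  note * = i j l
  have "adj n i j" "adj n j l" "adj n i l"
    using assms(6-8) * ham_adj[OF assms(1)] by simp_all
  note adj_cases[OF *(1,3) this(1)] adj_cases[OF *(3,5) this(2)] adj_cases[OF *(1,5) this(3)]
  then show False using assms(2) *(1,3,5)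
    by (elim disjE conjE) linarith+
qed

lemma adj_pair_cases:
  assumes "i < n" "p < q" "q < n" "adj n i p" "adj n i q"
  shows "p + 1 = i \<and> q = i + 1 \<or> i = 0 \<and> p = 1 \<and> q + 1 = n \<or> i + 1 = n \<and> p = 0 \<and> q + 2 = n"
proof -
  have "p < n" using assms by simp
  from adj_cases[OF assms(1) this assms(4)] adj_cases[OF assms(1,3,5)] show ?thesis
    using assms(1-3) by linarith
qed

text \<open>The gap \<open>q - p\<close> is 2 around an inner position and \<open>n - 2\<close>
  around either end of the numbering. These coincide for \<open>n = 4\<close>, where opposite
  positions do share both neighbours.\<close>

lemma adj_pair_unique:
  assumes "5 \<le> n" "i < n" "j < n" "p < q" "q < n" "adj n i p" "adj n i q" "adj n j p" "adj n j q"
  shows "i = j"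
  using adj_pair_cases[OF assms(2,4,5,6,7)] adj_pair_cases[OF assms(3,4,5,8,9)] assms(1-5)
  by (elim disjE conjE) linarith+

lemma ham_no_square:
  assumes "ham n h C" "5 \<le> n" "x < n" "y < n" "a < n" "b < n" "a \<noteq> b"
    and "C x a" "C x b" "C y a" "C y b"
  shows "x = y"
proof -
  obtain i where i: "i < n" "x = h i" using ham_surj[OF assms(1,3)] .
  obtain j where j: "j < n" "y = h j" using ham_surj[OF assms(1,4)] .
  obtain p where p: "p < n" "a = h p" using ham_surj[OF assms(1,5)] .
  obtain q where q: "q < n" "b = h q" using ham_surj[OF assms(1,6)] .
  note * = i j p q
  have a: "adj n i p" "adj n i q" "adj n j p" "adj n j q"
    using assms(8-11) * ham_adj[OF assms(1)] by simp_all
  have "p \<noteq> q" using assms(7) * by auto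
  then consider "p < q" | "q < p" by linarith
  then have "i = j"
    using adj_pair_unique[of n i j p q] adj_pair_unique[of n i j q p] a *(1,3,5,7) assms(2)
    by cases simp_all
  with * show ?thesis by simp
qed

lemma ham_compose:
  assumes "ham n h C" "\<And>i. i < n \<Longrightarrow> g i < n" "inj_on g {..<n}"
    and "\<And>i j. i < n \<Longrightarrow> j < n \<Longrightarrow> adj n (g i) (g j) \<longleftrightarrow> adj n i j"
  shows "ham n (h \<circ> g) C"
proof -
  have "g ` {..<n} = {..<n}" by (rule endo_inj_surj) (use assms in auto)
  then have "bij_betw g {..<n} {..<n}" using assms(3) by (simp add: bij_betw_def)
  then have "bij_betw (h \<circ> g) {..<n} {..<n}"
    using assms(1) by (auto simp: ham_def intro: bij_betw_trans)
  with assms show ?thesis by (simp add: ham_def)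
qed

lemma ham_rotate:
  assumes "ham n h C"
  shows "ham n (h \<circ> (\<lambda>i. Suc i mod n)) C"
proof (rule ham_compose[OF assms])
  show "inj_on (\<lambda>i. Suc i mod n) {..<n}"
    by (rule inj_onI) (auto simp: Suc_mod split: if_splits)
  show "adj n (Suc i mod n) (Suc j mod n) \<longleftrightarrow> adj n i j" if "i < n" "j < n" for i j
    using that unfolding adj_def by (cases "Suc i = n"; cases "Suc j = n") (auto simp: Suc_mod split: if_splits)
qed auto

lemma ham_start:
  assumes "ham n h C" "s < n" "h s = x"
  shows "\<exists>h. ham n h C \<and> h 0 = x"
  using assms
proof (induction s arbitrary: h)
  case (Suc s)
  show ?case
    by (rule Suc.IH[OF ham_rotate[OF Suc.prems(1)]]) (use Suc.prems in auto)
qed auto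

lemma ham_reflect:
  assumes "ham n h C"
  shows "ham n (h \<circ> (\<lambda>i. if i = 0 then 0 else n - i)) C"
proof (rule ham_compose[OF assms])
  show "inj_on (\<lambda>i. if i = 0 then 0 else n - i) {..<n}"
    by (rule inj_onI) (auto split: if_splits)
  show "adj n (if i = 0 then 0 else n - i) (if j = 0 then 0 else n - j) \<longleftrightarrow> adj n i j" if "i < n" "j < n" for i j
    using that unfolding adj_def by (cases "i = 0"; cases "j = 0") (auto simp: Suc_mod split: if_splits)
qed auto

text \<open>Rotation and reflection bring any listing of the cycle to the form that
  \<open>walk\<close> produces: it starts at 0 and leaves towards the smaller neighbour.\<close>

lemma ham_normalize:
  assumes "ham n h C" "3 \<le> n"
  shows "\<exists>h. ham n h C \<and> h 0 = 0 \<and> h 1 < h (n - 1)"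
proof -
  obtain s where "s < n" "0 = h s" using ham_surj[OF assms(1), of 0] assms(2) by auto
  then obtain h1 where h1: "ham n h1 C" "h1 0 = 0" using ham_start[OF assms(1)] by metis
  have "h1 1 \<noteq> h1 (n - 1)" using ham_eq_iff[OF h1(1), of 1 "n - 1"] assms(2) by auto
  then consider "h1 1 < h1 (n - 1)" | "h1 (n - 1) < h1 1" by linarith
  then show ?thesis
  proof cases
    case 2
    then show ?thesis using ham_reflect[OF h1(1)] h1(2) assms(2)
      by (intro exI[of _ "h1 \<circ> (\<lambda>i. if i = 0 then 0 else n - i)"]) auto
  qed (use h1 in auto)
qed

text \<open>Taking the least unvisited neighbour makes the walk deterministic; only round 0 offers a
  real choice. In the last round \<open>Suc i = n\<close>, which \<open>j < n\<close> excludes, so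
  nothing is added.\<close>

definition walk :: "nat \<Rightarrow> (nat \<Rightarrow> nat \<Rightarrow> bool) \<Rightarrow> nat \<Rightarrow> (nat \<Rightarrow> nat \<Rightarrow> bool) \<Rightarrow> nat \<Rightarrow> nat \<Rightarrow> bool" where
  "walk n C i R j v \<longleftrightarrow> j < n \<and> v < n \<and> (R j v \<or> (j = Suc i \<and> (\<exists>u<n. R i u \<and> C u v \<and> \<not> (\<exists>l<n. R l v) \<and>
     \<not> (\<exists>v'<n. v' < v \<and> C u v' \<and> \<not> (\<exists>l<n. R l v')))))"

text \<open>Read \<open>p \<le> i\<close> as "visited": beyond the successor there is a new
  neighbour only at the start, namely the last position. So only the first move of the walk depends
  on \<open>h 1 < h (n - 1)\<close>.\<close>

lemma adj_above:
  assumes "p < n" "Suc i < n"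
  shows "adj n i p \<and> \<not> p \<le> i \<longleftrightarrow> p = Suc i \<or> i = 0 \<and> p = n - 1"
proof (cases "Suc p = n")
  case True
  then show ?thesis using assms by (simp add: adj_def Suc_mod) linarith
next
  case False
  have "adj n i p \<longleftrightarrow> p = Suc i \<or> i = Suc p" using assms False by (simp add: adj_def Suc_mod)
  moreover have "p \<noteq> n - 1" using assms False by linarith
  ultimately show ?thesis by linarith
qed

lemma walk_ham:
  assumes "ham n h C" "h 0 = 0" "h 1 < h (n - 1)" "3 \<le> n" "m \<le> n"
  shows "fold (walk n C) [0..<m] (\<lambda>j v. j < n \<and> v < n \<and> j = 0 \<and> v = 0) = (\<lambda>j v. j \<le> m \<and> j < n \<and> v = h j)"
  using assms(5)
proof (induction m)
  case 0
  then show ?case using assms by (auto simp: fun_eq_iff)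
next
  case (Suc i)
  let ?R = "\<lambda>j v. j \<le> i \<and> j < n \<and> v = h j"
  have "walk n C i ?R j v \<longleftrightarrow> j \<le> Suc i \<and> j < n \<and> v = h j" for j v
  proof (cases "j = Suc i \<and> j < n")
    case True
    then have lt: "i < n" "Suc i < n" by auto
    have unv: "(\<exists>l<n. ?R l (h p)) \<longleftrightarrow> p \<le> i" if "p < n" for p
      using that lt ham_eq_iff[OF assms(1) that] by auto
    have nxt: "C (h i) (h p) \<and> \<not> (\<exists>l<n. ?R l (h p)) \<longleftrightarrow> p = Suc i \<or> i = 0 \<and> p = n - 1" if "p < n" for p
      unfolding unv[OF that] ham_adj[OF assms(1) lt(1) that]
      by (rule adj_above[OF that lt(2)])
    have less: "h (Suc i) \<le> h p" if "p < n" "C (h i) (h p)" "\<not> (\<exists>l<n. ?R l (h p))" for p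
    proof -
      have "p = Suc i \<or> i = 0 \<and> p = n - 1" using nxt[OF that(1)] that(2,3) by blast
      then show ?thesis using assms(3) by (elim disjE conjE) simp_all
    qed
    have suc: "C (h i) (h (Suc i))" "\<not> (\<exists>l<n. ?R l (h (Suc i)))"
      using iffD2[OF nxt[OF lt(2)]] by simp_all
    show ?thesis
    proof
      assume "walk n C i ?R j v"
      then have v: "v < n" and *: "?R j v \<or> (\<exists>u<n. ?R i u \<and> C u v \<and> \<not> (\<exists>l<n. ?R l v) \<and>
         \<not> (\<exists>v'<n. v' < v \<and> C u v' \<and> \<not> (\<exists>l<n. ?R l v')))" by (auto simp: walk_def)
      have a: "C (h i) v" "\<not> (\<exists>l<n. ?R l v)"
        and b: "\<not> (\<exists>v'<n. v' < v \<and> C (h i) v' \<and> \<not> (\<exists>l<n. ?R l v'))"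
        using * True by auto
      obtain p where p: "p < n" "v = h p" using ham_surj[OF assms(1) v] .
      have "h (Suc i) \<le> h p" by (rule less) (use p a in auto)
      moreover have "\<not> h (Suc i) < h p"
        using b suc ham_less[OF assms(1) lt(2)] p by auto
      ultimately show "j \<le> Suc i \<and> j < n \<and> v = h j" using True p by simp
    next
      assume v: "j \<le> Suc i \<and> j < n \<and> v = h j"
      then have vh: "v = h (Suc i)" using True by simp
      have "\<not> (\<exists>v'<n. v' < v \<and> C (h i) v' \<and> \<not> (\<exists>l<n. ?R l v'))"
      proof
        assume "\<exists>v'<n. v' < v \<and> C (h i) v' \<and> \<not> (\<exists>l<n. ?R l v')"
        then obtain v' where v': "v' < n" "v' < v" "C (h i) v'" "\<not> (\<exists>l<n. ?R l v')" by blast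
        obtain p where p: "p < n" "v' = h p" using ham_surj[OF assms(1) v'(1)] .
        have "h (Suc i) \<le> h p" by (rule less) (use p v' in auto)
        then show False using v'(2) vh p by simp
      qed
      with suc have "\<exists>u<n. ?R i u \<and> C u v \<and> \<not> (\<exists>l<n. ?R l v) \<and>
         \<not> (\<exists>v'<n. v' < v \<and> C u v' \<and> \<not> (\<exists>l<n. ?R l v'))"
        unfolding vh using ham_less[OF assms(1) lt(1)] lt(1) by (intro exI[of _ "h i"]) simp
      then show "walk n C i ?R j v"
        unfolding walk_def using True vh ham_less[OF assms(1) lt(2)] by simp
    qed
  next
    case False
    then have "walk n C i ?R j v \<longleftrightarrow> v < n \<and> ?R j v" unfolding walk_def by blast
    moreover have "v < n" if "?R j v" using that ham_less[OF assms(1)] by simp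
    moreover have "j \<le> Suc i \<and> j < n \<longleftrightarrow> j \<le> i \<and> j < n" using False by linarith
    ultimately show ?thesis by blast
  qed
  then have "walk n C i ?R = (\<lambda>j v. j \<le> Suc i \<and> j < n \<and> v = h j)" by (intro ext)
  moreover have "fold (walk n C) [0..<i] (\<lambda>j v. j < n \<and> v < n \<and> j = 0 \<and> v = 0) = ?R"
    using Suc.IH Suc.prems by simp
  ultimately show ?case by (simp only: upt_Suc_append[OF zero_le] fold_append comp_apply fold_simps)
qed

lemma walk_correct:
  assumes "ham n h C" "3 \<le> n"
  shows "\<exists>h. ham n h C \<and> fold (walk n C) [0..<n] (\<lambda>j v. j < n \<and> v < n \<and> j = 0 \<and> v = 0) = (\<lambda>j v. j < n \<and> v = h j)"
proof -
  obtain h where h: "ham n h C" "h 0 = 0" "h 1 < h (n - 1)" using ham_normalize[OF assms] by blast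
  then show ?thesis using walk_ham[OF h assms(2) order_refl] by (auto simp: fun_eq_iff)
qed

section \<open>Triangle factors\<close>

text \<open>Adjacency in a disjoint union of triangles. Uncovered points are allowed, so that the
  notion also applies to partial selections.\<close>

definition tris :: "(nat \<Rightarrow> nat \<Rightarrow> bool) \<Rightarrow> bool" where
  "tris M \<longleftrightarrow> (\<forall>x y. M x y \<longrightarrow> M y x \<and> x \<noteq> y) \<and>
     (\<forall>x y z. M x y \<longrightarrow> M y z \<longrightarrow> x \<noteq> z \<longrightarrow> M x z) \<and>
     (\<forall>x y. M x y \<longrightarrow> (\<exists>z. z \<noteq> y \<and> (\<forall>w. M x w \<longleftrightarrow> w = y \<or> w = z)))"

definition decomp :: "nat \<Rightarrow> (nat \<Rightarrow> nat \<Rightarrow> bool) \<Rightarrow> (nat \<Rightarrow> nat \<Rightarrow> bool) \<Rightarrow> bool" where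
  "decomp n E M \<longleftrightarrow> tris M \<and> (\<forall>x y. M x y \<longrightarrow> E x y) \<and> (\<forall>x<n. \<exists>y. M x y) \<and>
     (\<exists>h. ham n h (\<lambda>x y. E x y \<and> \<not> M x y))"

definition is_covered :: "nat \<Rightarrow> (nat \<Rightarrow> nat \<Rightarrow> bool) \<Rightarrow> nat \<Rightarrow> bool" where
  "is_covered n Q x \<longleftrightarrow> (\<exists>y<n. Q x y)"

definition available :: "nat \<Rightarrow> (nat \<Rightarrow> nat \<Rightarrow> bool) \<Rightarrow> (nat \<Rightarrow> nat \<Rightarrow> bool) \<Rightarrow> nat \<Rightarrow> nat \<Rightarrow> nat \<Rightarrow> bool" where
  "available n E Q x y z \<longleftrightarrow> E x y \<and> E y z \<and> E x z \<and> \<not> is_covered n Q x \<and> \<not> is_covered n Q y \<and> \<not> is_covered n Q z"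

text \<open>Since \<^term>\<open>available n E Q v c d\<close> is symmetric in \<open>c\<close> and \<open>d\<close>, restricting \<open>c\<close> restricts the pair.\<close>

definition only :: "nat \<Rightarrow> (nat \<Rightarrow> nat \<Rightarrow> bool) \<Rightarrow> (nat \<Rightarrow> nat \<Rightarrow> bool) \<Rightarrow> nat \<Rightarrow> nat \<Rightarrow> nat \<Rightarrow> bool" where
  "only n E Q v a b \<longleftrightarrow> (\<forall>c<n. \<forall>d<n. available n E Q v c d \<longrightarrow> c = a \<or> c = b)"

text \<open>The analogue of a unit clause: one of the three corners has no other candidate
  left.\<close>

definition forced :: "nat \<Rightarrow> (nat \<Rightarrow> nat \<Rightarrow> bool) \<Rightarrow> (nat \<Rightarrow> nat \<Rightarrow> bool) \<Rightarrow> nat \<Rightarrow> nat \<Rightarrow> nat \<Rightarrow> bool" where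
  "forced n E Q x y z \<longleftrightarrow> available n E Q x y z \<and> (only n E Q x y z \<or> only n E Q y x z \<or> only n E Q z x y)"

definition step :: "nat \<Rightarrow> (nat \<Rightarrow> nat \<Rightarrow> bool) \<Rightarrow> (nat \<Rightarrow> nat \<Rightarrow> bool) \<Rightarrow> nat \<Rightarrow> nat \<Rightarrow> bool" where
  "step n E Q x y \<longleftrightarrow> x < n \<and> y < n \<and> (Q x y \<or> (\<exists>z<n. forced n E Q x y z))"

text \<open>Triangles forced in the same round may overlap, since each was available on its own; the
  second disjunct detects this as a vertex with three mates.\<close>

definition conflict :: "nat \<Rightarrow> (nat \<Rightarrow> nat \<Rightarrow> bool) \<Rightarrow> (nat \<Rightarrow> nat \<Rightarrow> bool) \<Rightarrow> bool" where
  "conflict n E Q \<longleftrightarrow> (\<exists>u<n. \<not> is_covered n Q u \<and> \<not> (\<exists>y<n. \<exists>z<n. available n E Q u y z)) \<or>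
     (\<exists>u<n. \<exists>a<n. \<exists>b<n. \<exists>c<n. Q u a \<and> Q u b \<and> Q u c \<and> a \<noteq> b \<and> a \<noteq> c \<and> b \<noteq> c)"

definition add :: "nat \<Rightarrow> (nat \<Rightarrow> nat \<Rightarrow> bool) \<Rightarrow> nat \<Rightarrow> nat \<Rightarrow> nat \<Rightarrow> nat \<Rightarrow> nat \<Rightarrow> bool" where
  "add n P a b c x y \<longleftrightarrow> x < n \<and> y < n \<and>
     (P x y \<or> x \<noteq> y \<and> (x = a \<or> x = b \<or> x = c) \<and> (y = a \<or> y = b \<or> y = c))"

text \<open>There are \<open>n * n\<close> pairs, and every round before the fixed point adds at
  least one, so \<open>n * n\<close> rounds suffice (\<open>step_fixpoint\<close>).\<close>

definition closure :: "nat \<Rightarrow> (nat \<Rightarrow> nat \<Rightarrow> bool) \<Rightarrow> (nat \<Rightarrow> nat \<Rightarrow> bool) \<Rightarrow> nat \<Rightarrow> nat \<Rightarrow> nat \<Rightarrow> nat \<Rightarrow> nat \<Rightarrow> bool" where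
  "closure n E P a b c = (step n E ^^ (n * n)) (add n P a b c)"

text \<open>The disjunction lets a single formula describe both outcomes: after a rejection only
  \<open>P\<close> remains, and after an acceptance the closure absorbs \<open>P\<close>.\<close>

definition accept :: "nat \<Rightarrow> (nat \<Rightarrow> nat \<Rightarrow> bool) \<Rightarrow> nat \<Rightarrow> nat \<Rightarrow> nat \<Rightarrow> (nat \<Rightarrow> nat \<Rightarrow> bool) \<Rightarrow> nat \<Rightarrow> nat \<Rightarrow> bool" where
  "accept n E a b c P x y \<longleftrightarrow> x < n \<and> y < n \<and>
     (P x y \<or> available n E P a b c \<and> \<not> conflict n E (closure n E P a b c) \<and> closure n E P a b c x y)"

text \<open>The second condition makes \<open>Q\<close> a union of whole triangles of
  \<open>M\<close>.\<close>

definition subfactor :: "(nat \<Rightarrow> nat \<Rightarrow> bool) \<Rightarrow> (nat \<Rightarrow> nat \<Rightarrow> bool) \<Rightarrow> bool" where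
  "subfactor M Q \<longleftrightarrow> (\<forall>x y. Q x y \<longrightarrow> M x y) \<and> (\<forall>x y z. Q x y \<longrightarrow> M y z \<longrightarrow> Q y z)"

lemma tris_sym: "tris M \<Longrightarrow> M x y \<Longrightarrow> M y x"
  and tris_irrefl: "tris M \<Longrightarrow> M x y \<Longrightarrow> x \<noteq> y"
  and tris_trans: "tris M \<Longrightarrow> M x y \<Longrightarrow> M y z \<Longrightarrow> x \<noteq> z \<Longrightarrow> M x z"
  unfolding tris_def by blast+

lemma tris_mates: "tris M \<Longrightarrow> M x y \<Longrightarrow> M x z \<Longrightarrow> y \<noteq> z \<Longrightarrow> M x w \<longleftrightarrow> w = y \<or> w = z"
  unfolding tris_def by metis

lemma tris_third: "tris M \<Longrightarrow> M x y \<Longrightarrow> \<exists>z. z \<noteq> x \<and> z \<noteq> y \<and> M x z \<and> M y z"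
  unfolding tris_def by metis

lemma tris_ex_mates: "tris M \<Longrightarrow> M x y \<Longrightarrow> \<exists>z. z \<noteq> y \<and> (\<forall>w. M x w \<longleftrightarrow> w = y \<or> w = z)"
  unfolding tris_def by blast

text \<open>By symmetry both systems respect the complement of \<open>S\<close> as well, so
  exchanging one for the other on \<open>S\<close> cuts no triangle.\<close>

lemma tris_glue:
  assumes "tris M" "tris Q" and M: "\<And>x y. M x y \<Longrightarrow> x \<in> S \<Longrightarrow> y \<in> S" and Q: "\<And>x y. Q x y \<Longrightarrow> x \<in> S \<Longrightarrow> y \<in> S"
  shows "tris (\<lambda>x y. if x \<in> S then Q x y else M x y)" (is "tris ?M")
proof -
  have M': "y \<notin> S" if "M x y" "x \<notin> S" for x y
    using M[OF tris_sym[OF assms(1) that(1)]] that(2) by blast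
  have sym: "?M y x \<and> x \<noteq> y" if h: "?M x y" for x y
  proof (cases "x \<in> S")
    case True
    then have "Q x y" "y \<in> S" using h Q by simp_all
    then show ?thesis using tris_sym[OF assms(2)] tris_irrefl[OF assms(2)] by simp
  next
    case False
    then have "M x y" "y \<notin> S" using h M' by simp_all
    then show ?thesis using tris_sym[OF assms(1)] tris_irrefl[OF assms(1)] by simp
  qed
  have trans: "?M x z" if h: "?M x y" "?M y z" "x \<noteq> z" for x y z
  proof (cases "x \<in> S")
    case True
    then have "Q x y" "y \<in> S" using h(1) Q by simp_all
    then show ?thesis using True h(2,3) tris_trans[OF assms(2)] by simp
  next
    case False
    then have "M x y" "y \<notin> S" using h(1) M' by simp_all
    then show ?thesis using False h(2,3) tris_trans[OF assms(1)] by simp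
  qed
  have mates: "\<exists>z. z \<noteq> y \<and> (\<forall>w. ?M x w \<longleftrightarrow> w = y \<or> w = z)" if h: "?M x y" for x y
  proof (cases "x \<in> S")
    case True
    then have "Q x y" using h by simp
    from tris_ex_mates[OF assms(2) this] show ?thesis using True by simp
  next
    case False
    then have "M x y" using h by simp
    from tris_ex_mates[OF assms(1) this] show ?thesis using False by simp
  qed
  show ?thesis
    unfolding tris_def
  proof (intro conjI allI impI)
    fix x y assume h: "?M x y"
    show "?M y x" by (rule conjunct1[OF sym[OF h]])
    show "x \<noteq> y" by (rule conjunct2[OF sym[OF h]])
    show "\<exists>z. z \<noteq> y \<and> (\<forall>w. ?M x w \<longleftrightarrow> w = y \<or> w = z)" by (rule mates[OF h])
  next
    fix x y z assume "?M x y" "?M y z" "x \<noteq> z"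
    then show "?M x z" by (rule trans)
  qed
qed

section \<open>Propagation compared with the triangles of a fixed factor\<close>

locale graph =
  fixes n :: nat and E :: "nat \<Rightarrow> nat \<Rightarrow> bool"
  assumes E_less: "E x y \<Longrightarrow> x < n \<and> y < n"
    and E_sym: "E x y \<Longrightarrow> E y x"
    and E_irrefl: "\<not> E x x"
    and five_le: "5 \<le> n"
begin

text \<open>Overlapping triangles are still permitted; disjointness comes only from the absence of a
  conflict (\<open>partial_tris\<close>).\<close>

definition triangle_union :: "(nat \<Rightarrow> nat \<Rightarrow> bool) \<Rightarrow> bool" where
  "triangle_union Q \<longleftrightarrow> (\<forall>x y. Q x y \<longrightarrow> Q y x \<and> (\<exists>z. E x y \<and> E y z \<and> E x z \<and> Q x z \<and> Q y z))"

lemma partial_E: "triangle_union Q \<Longrightarrow> Q x y \<Longrightarrow> E x y"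
  and partial_sym: "triangle_union Q \<Longrightarrow> Q x y \<Longrightarrow> Q y x"
  unfolding triangle_union_def by blast+

lemma partial_third:
  assumes "triangle_union Q" "Q x y"
  obtains z where "E x y" "E y z" "E x z" "Q x z" "Q y z" "x \<noteq> y" "y \<noteq> z" "x \<noteq> z"
  using assms E_irrefl unfolding triangle_union_def by metis

lemma av_swap: "available n E Q x y z \<Longrightarrow> available n E Q y x z" "available n E Q x y z \<Longrightarrow> available n E Q x z y"
  unfolding available_def using E_sym by blast+

lemma only_swap: "only n E Q v a b \<longleftrightarrow> only n E Q v b a"
  unfolding only_def by blast

lemma forced_swap: "forced n E Q x y z \<Longrightarrow> forced n E Q y x z" "forced n E Q x y z \<Longrightarrow> forced n E Q x z y"
  unfolding forced_def using av_swap only_swap by blast+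

lemma forced_less: "forced n E Q x y z \<Longrightarrow> x < n \<and> y < n \<and> z < n"
  unfolding forced_def available_def using E_less by blast

lemma step_forced:
  assumes "forced n E Q x y z"
  shows "step n E Q x y" "step n E Q y x" "step n E Q x z" "step n E Q y z"
  unfolding step_def using assms forced_swap forced_less by blast+

lemma partial_step:
  assumes "triangle_union Q"
  shows "triangle_union (step n E Q)"
  unfolding triangle_union_def
proof (intro allI impI)
  fix x y assume "step n E Q x y"
  then consider "Q x y" | z where "forced n E Q x y z" unfolding step_def by blast
  then show "step n E Q y x \<and> (\<exists>z. E x y \<and> E y z \<and> E x z \<and> step n E Q x z \<and> step n E Q y z)"
  proof cases
    case 1
    obtain z where z: "E x y" "E y z" "E x z" "Q x z" "Q y z" using partial_third[OF assms 1] .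
    then have "step n E Q y x" "step n E Q x z" "step n E Q y z"
      using partial_sym[OF assms 1] E_less unfolding step_def by blast+
    with z show ?thesis by blast
  next
    case (2 z)
    then show ?thesis using step_forced[OF 2] unfolding forced_def available_def by blast
  qed
qed

lemma partial_add:
  assumes "triangle_union P" "available n E P a b c"
  shows "triangle_union (add n P a b c)"
proof -
  have t: "E a b" "E b a" "E b c" "E c b" "E a c" "E c a" using assms(2) E_sym unfolding available_def by blast+
  then have lt: "a < n" "b < n" "c < n" using E_less by blast+
  have ne: "a \<noteq> b" "b \<noteq> c" "a \<noteq> c" using t E_irrefl by blast+
  show ?thesis
    unfolding triangle_union_def
  proof (intro allI impI)
    fix x y assume a: "add n P a b c x y"
    then consider "P x y" | "x \<noteq> y" "x = a \<or> x = b \<or> x = c" "y = a \<or> y = b \<or> y = c" unfolding add_def by blast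
    then show "add n P a b c y x \<and> (\<exists>z. E x y \<and> E y z \<and> E x z \<and> add n P a b c x z \<and> add n P a b c y z)"
    proof cases
      case 1
      obtain z where z: "E x y" "E y z" "E x z" "P x z" "P y z" using partial_third[OF assms(1) 1] .
      then have "add n P a b c y x" "add n P a b c x z" "add n P a b c y z"
        using partial_sym[OF assms(1) 1] E_less unfolding add_def by blast+
      with z show ?thesis by blast
    next
      case 2
      then have "\<exists>z. z \<noteq> x \<and> z \<noteq> y \<and> (z = a \<or> z = b \<or> z = c)" using ne by metis
      then obtain z where z: "z \<noteq> x" "z \<noteq> y" "z = a \<or> z = b \<or> z = c" by blast
      have "E x y" "E y z" "E x z" using 2 z t by blast+
      with 2 z lt show ?thesis unfolding add_def by blast
    qed
  qed
qed

lemma step_mono: "Q x y \<Longrightarrow> x < n \<Longrightarrow> y < n \<Longrightarrow> step n E Q x y"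
  unfolding step_def by blast

lemma funpow_step_less:
  assumes "\<And>x y. Q x y \<Longrightarrow> x < n \<and> y < n"
  shows "(step n E ^^ j) Q x y \<Longrightarrow> x < n \<and> y < n"
  using assms by (cases j) (auto simp: step_def)

lemma funpow_step_mono:
  assumes "\<And>x y. Q x y \<Longrightarrow> x < n \<and> y < n" "Q x y"
  shows "(step n E ^^ j) Q x y"
  by (induction j) (use assms in \<open>auto intro: step_mono\<close>)

lemma step_fixpoint:
  assumes less: "\<And>x y. Q x y \<Longrightarrow> x < n \<and> y < n"
  shows "step n E ((step n E ^^ (n * n)) Q) = (step n E ^^ (n * n)) Q"
proof -
  let ?Q = "\<lambda>j. (step n E ^^ j) Q"
  let ?A = "\<lambda>j. {(x, y). ?Q j x y}"
  have subfactor: "?A j \<subseteq> {..<n} \<times> {..<n}" for j using funpow_step_less[OF less] by auto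
  have fin: "finite (?A j)" for j using subfactor finite_subset by blast
  have "\<exists>j\<le>n * n. step n E (?Q j) = ?Q j"
  proof (rule ccontr)
    assume neg: "\<not> ?thesis"
    have "j \<le> card (?A j)" if "j \<le> Suc (n * n)" for j
      using that
    proof (induction j)
      case (Suc j)
      have "?A j \<subseteq> ?A (Suc j)" using step_mono funpow_step_less[OF less] by auto
      moreover have "?A j \<noteq> ?A (Suc j)"
      proof
        assume "?A j = ?A (Suc j)"
        then have "?Q j x y = step n E (?Q j) x y" for x y by (auto simp: set_eq_iff)
        then have "step n E (?Q j) = ?Q j" by (intro ext) simp
        with neg Suc.prems show False by simp
      qed
      ultimately have "card (?A j) < card (?A (Suc j))" using psubset_card_mono[OF fin[of "Suc j"], of "?A j"] by blast
      with Suc show ?case by simp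
    qed simp
    from this[of "Suc (n * n)"] have "Suc (n * n) \<le> card (?A (Suc (n * n)))" by simp
    also have "\<dots> \<le> card ({..<n} \<times> {..<n})" by (rule card_mono[OF _ subfactor]) simp
    finally show False by simp
  qed
  then obtain j where j: "j \<le> n * n" "step n E (?Q j) = ?Q j" by blast
  have "?Q (j + i) = ?Q j" for i by (induction i) (use j in auto)
  from this[of "n * n - j"] j show ?thesis by simp
qed

context
  fixes M :: "nat \<Rightarrow> nat \<Rightarrow> bool"
  assumes dec: "decomp n E M"
begin

lemma M_tris: "tris M" and M_E: "M x y \<Longrightarrow> E x y" and M_cov: "x < n \<Longrightarrow> \<exists>y. M x y"
  using dec unfolding decomp_def by blast+

lemmas M_sym = tris_sym[OF M_tris] and M_irrefl = tris_irrefl[OF M_tris]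
  and M_trans = tris_trans[OF M_tris] and M_mates = tris_mates[OF M_tris]

lemma M_less: "M x y \<Longrightarrow> x < n \<and> y < n"
  using M_E E_less by blast

lemma sub_partial:
  assumes "subfactor M P"
  shows "triangle_union P"
  unfolding triangle_union_def
proof (intro allI impI)
  fix x y assume p: "P x y"
  then have m: "M x y" "M y x" using assms M_sym unfolding subfactor_def by blast+
  obtain z where z: "z \<noteq> x" "z \<noteq> y" "M x z" "M y z" using tris_third[OF M_tris m(1)] by blast
  have "P y x" using p m assms unfolding subfactor_def by blast
  then have "P x z" "P y z" using p z assms unfolding subfactor_def by blast+
  with \<open>P y x\<close> z m show "P y x \<and> (\<exists>z. E x y \<and> E y z \<and> E x z \<and> P x z \<and> P y z)" using M_E by blast
qed

text \<open>A vertex has only two mates in \<open>M\<close>, so a triangle of \<open>P'\<close>,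
  lying inside \<open>P\<close> and hence inside \<open>M\<close>, is a whole triangle of
  \<open>M\<close>.\<close>

lemma sub_mono:
  assumes "subfactor M P" "triangle_union P'" "\<And>x y. P' x y \<Longrightarrow> P x y"
  shows "subfactor M P'"
proof -
  have P'M: "M x y" if "P' x y" for x y using that assms unfolding subfactor_def by blast
  moreover have "P' y z" if h: "P' x y" "M y z" for x y z
  proof -
    have yx: "P' y x" using h partial_sym[OF assms(2)] by blast
    obtain w where "P' x w" "P' y w" "x \<noteq> w" by (rule partial_third[OF assms(2) h(1)])
    then have "z = x \<or> z = w" using M_mates[of y x w z] P'M yx h by blast
    with yx \<open>P' y w\<close> show ?thesis by blast
  qed
  ultimately show ?thesis unfolding subfactor_def by blast
qed

lemma sub_cov: "subfactor M P \<Longrightarrow> is_covered n P x \<Longrightarrow> M x y \<Longrightarrow> P x y"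
  using partial_sym[OF sub_partial] unfolding subfactor_def is_covered_def by blast

lemma sub_uncov:
  assumes "subfactor M P" "\<not> is_covered n P x" "M x y"
  shows "\<not> is_covered n P y"
proof
  assume "is_covered n P y"
  then have "P y x" using sub_cov[OF assms(1)] M_sym[OF assms(3)] by blast
  then have "P x y" using partial_sym[OF sub_partial[OF assms(1)]] by blast
  then show False using assms(2,3) M_less unfolding is_covered_def by blast
qed

lemma sub_av:
  assumes "subfactor M P" "\<not> is_covered n P x" "M x y" "M x z" "y \<noteq> z"
  shows "available n E P x y z"
proof -
  have "M y z" using M_trans[OF M_sym[OF assms(3)] assms(4,5)] .
  with assms M_E sub_uncov[OF assms(1,2)] show ?thesis unfolding available_def by blast
qed

text \<open>The factor triangle of an uncovered vertex stays available (\<open>sub_av\<close>). If a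
  vertex has a single candidate, that candidate must be its factor triangle.\<close>

lemma forced_M:
  assumes "subfactor M P" "forced n E P x y z"
  shows "M x y \<and> M y z \<and> M x z"
proof -
  have *: "M v a \<and> M v b \<and> M a b" if o: "only n E P v a b" and h: "available n E P v a b" for v a b
  proof -
    have v: "v < n" "\<not> is_covered n P v" using h E_less unfolding available_def by blast+
    obtain c where c: "M v c" using M_cov v by blast
    obtain d where d: "d \<noteq> c" "M v d" "M c d" using tris_third[OF M_tris c] by blast
    have "available n E P v c d" "available n E P v d c" using sub_av[OF assms(1) v(2)] c d by blast+
    then have "c = a \<or> c = b" "d = a \<or> d = b" using o M_less c d unfolding only_def by blast+
    then show ?thesis using c d M_sym by blast
  qed
  have "available n E P x y z" using assms unfolding forced_def by blast
  then have "available n E P x y z" "available n E P y x z" "available n E P z x y" using av_swap by blast+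
  then show ?thesis using assms(2) * M_sym unfolding forced_def by blast
qed

lemma sub_step:
  assumes "subfactor M P"
  shows "subfactor M (step n E P)"
proof -
  have "M x y" if "step n E P x y" for x y
    using that forced_M[OF assms] assms unfolding step_def subfactor_def by blast
  moreover have "step n E P y w" if "step n E P x y" "M y w" for x y w
  proof -
    consider "P x y" | z where "forced n E P x y z" using \<open>step n E P x y\<close> unfolding step_def by blast
    then show ?thesis
    proof cases
      case 1
      then have "P y w" using assms that unfolding subfactor_def by blast
      then show ?thesis using M_less that step_mono by blast
    next
      case (2 z)
      then have "M y x" "M y z" "M x z" using forced_M[OF assms 2] M_sym by blast+
      then have "w = x \<or> w = z" using M_mates[of y x z w] that M_irrefl by blast
      then show ?thesis using step_forced[OF 2] by blast
    qed
  qed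
  ultimately show ?thesis unfolding subfactor_def by blast
qed

text \<open>An uncovered vertex still has its factor triangle as a candidate, and no vertex has
  three mates in \<open>M\<close>. So propagation inside a factor never fails, and a triangle that
  leads to a conflict may be discarded.\<close>

lemma sub_not_conf:
  assumes "subfactor M P"
  shows "\<not> conflict n E P"
proof -
  have "\<exists>y<n. \<exists>z<n. available n E P u y z" if u: "u < n" "\<not> is_covered n P u" for u
  proof -
    obtain y where y: "M u y" using M_cov u by blast
    obtain z where z: "z \<noteq> y" "M u z" using tris_third[OF M_tris y] by blast
    then show ?thesis using sub_av[OF assms u(2) y] y M_less by blast
  qed
  moreover have "a = b \<or> a = c \<or> b = c" if "P u a" "P u b" "P u c" for u a b c
  proof -
    have "M u a" "M u b" "M u c" using that assms unfolding subfactor_def by blast+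
    then show ?thesis using M_mates[of u a b c] by blast
  qed
  ultimately show ?thesis unfolding conflict_def by blast
qed

lemma sub_add:
  assumes "subfactor M P" "M a b" "M b c" "M a c"
  shows "subfactor M (add n P a b c)"
proof -
  have m: "M a b" "M b a" "M b c" "M c b" "M a c" "M c a" using assms M_sym by blast+
  have ne: "a \<noteq> b" "b \<noteq> c" "a \<noteq> c" using m M_irrefl by blast+
  have lt: "a < n" "b < n" "c < n" using m M_less by blast+
  have "M x y" if "add n P a b c x y" for x y
    using that m assms(1) unfolding add_def subfactor_def by blast
  moreover have "add n P a b c y w" if h: "add n P a b c x y" "M y w" for x y w
  proof -
    have w: "y < n" "w < n" "y \<noteq> w" using M_less M_irrefl h(2) by blast+
    consider "P x y" | "y = a \<or> y = b \<or> y = c" using h(1) unfolding add_def by blast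
    then show ?thesis
    proof cases
      case 1
      then show ?thesis using assms(1) h(2) w unfolding add_def subfactor_def by blast
    next
      case 2
      have "w = a \<or> w = b \<or> w = c"
        using 2 h(2) M_mates[OF m(1) m(5) ne(2), of w] M_mates[OF m(2) m(3) ne(3), of w]
          M_mates[OF m(6) m(4) ne(1), of w] by blast
      with 2 w show ?thesis unfolding add_def by blast
    qed
  qed
  ultimately show ?thesis unfolding subfactor_def by blast
qed

lemma sub_funpow: "subfactor M P \<Longrightarrow> subfactor M ((step n E ^^ j) P)"
  by (induction j) (auto intro: sub_step)

end

end

section \<open>Exchange: a closed selection without conflict lies in some factor\<close>

context graph begin

lemma degree_le:
  assumes "\<not> conflict n E Q" "triangle_union Q" "Q u a" "Q u b" "Q u c"
  shows "a = b \<or> a = c \<or> b = c"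
proof -
  have "u < n" "a < n" "b < n" "c < n" using partial_E[OF assms(2)] assms(3-5) E_less by blast+
  then have "conflict n E Q" if "a \<noteq> b" "a \<noteq> c" "b \<noteq> c"
    unfolding conflict_def using assms(3-5) that by (intro disjI2) blast
  then show ?thesis using assms(1) by blast
qed

text \<open>If no vertex has three mates, two selected triangles with a common vertex
  coincide.\<close>

lemma partial_tris:
  assumes "\<not> conflict n E Q" "triangle_union Q"
  shows "tris Q"
  unfolding tris_def
proof (intro conjI allI impI)
  fix x y assume h: "Q x y"
  obtain t where t: "Q x t" "Q y t" "x \<noteq> y" "y \<noteq> t" "x \<noteq> t" by (rule partial_third[OF assms(2) h])
  show "Q y x" using partial_sym[OF assms(2) h] .
  show "x \<noteq> y" using t by blast
  show "\<exists>z. z \<noteq> y \<and> (\<forall>w. Q x w \<longleftrightarrow> w = y \<or> w = z)"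
  proof (intro exI[of _ t] conjI allI)
    show "t \<noteq> y" using t by simp
    show "Q x w \<longleftrightarrow> w = y \<or> w = t" for w using degree_le[OF assms h t(1), of w] t(1,4) h by metis
  qed
next
  fix x y z assume h: "Q x y" "Q y z" "x \<noteq> z"
  obtain t where t: "Q x t" "Q y t" "x \<noteq> y" "y \<noteq> t" "x \<noteq> t" by (rule partial_third[OF assms(2) h(1)])
  have "Q y x" using partial_sym[OF assms(2) h(1)] .
  from degree_le[OF assms this t(2) h(2)] have "z = t" using t(5) h(3) by simp
  with t show "Q x z" by blast
qed

context
  fixes M Q :: "nat \<Rightarrow> nat \<Rightarrow> bool"
  assumes dec: "decomp n E M" and pQ: "triangle_union Q" and closed: "step n E Q = Q" and nc: "\<not> conflict n E Q"
begin

abbreviation C :: "nat \<Rightarrow> nat \<Rightarrow> bool" where "C x y \<equiv> E x y \<and> \<not> M x y"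

text \<open>By \<open>triangle_detour\<close>, these are all the triangles of the graph that do not
  belong to \<open>M\<close>; \<open>m\<close> is the middle.\<close>

definition detour :: "nat \<Rightarrow> nat \<Rightarrow> nat \<Rightarrow> bool" where
  "detour m a b \<longleftrightarrow> C m a \<and> C m b \<and> a \<noteq> b \<and> M a b"

definition switched :: "nat \<Rightarrow> nat \<Rightarrow> nat \<Rightarrow> bool" where
  "switched m a b \<longleftrightarrow> detour m a b \<and> Q m a \<and> Q m b \<and> Q a b"

lemma tris_Q: "tris Q" using partial_tris[OF nc pQ] .

lemmas Qsym = tris_sym[OF tris_Q] and Qmates = tris_mates[OF tris_Q]
  and Msym = M_sym[OF dec] and Mmates = M_mates[OF dec] and Mtrans = M_trans[OF dec]

lemma Q_less: "Q x y \<Longrightarrow> x < n \<and> y < n"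
  using partial_E[OF pQ] E_less by blast

lemma C_sym: "C x y \<Longrightarrow> C y x"
  using E_sym[of x y] Msym[of y x] by blast

lemma ham_C: "\<exists>h. ham n h C"
  using dec unfolding decomp_def by (elim conjE)

lemma C_neighbours:
  assumes "C x a" "C x b" "a \<noteq> b" "C x y"
  shows "y = a \<or> y = b"
proof -
  obtain h where h: "ham n h C" using ham_C by blast
  have lt: "x < n" "a < n" "b < n" "y < n" using assms E_less by blast+
  have "3 \<le> n" using five_le by simp
  obtain p q where "\<And>y. y < n \<Longrightarrow> C x y \<longleftrightarrow> y = p \<or> y = q"
    by (rule ham_neighbours[OF h \<open>3 \<le> n\<close> lt(1)]) blast
  then show ?thesis using lt assms by metis
qed

lemma C_no_triangle: "C x y \<Longrightarrow> C y z \<Longrightarrow> C x z \<Longrightarrow> False"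
proof -
  assume a: "C x y" "C y z" "C x z"
  obtain h where h: "ham n h C" using ham_C by blast
  have "x < n" "y < n" "z < n" "4 \<le> n" using a E_less five_le by auto
  then show False using ham_no_triangle[OF h] a by blast
qed

lemma C_no_square: "C x a \<Longrightarrow> C x b \<Longrightarrow> C y a \<Longrightarrow> C y b \<Longrightarrow> a \<noteq> b \<Longrightarrow> x = y"
proof -
  assume a: "C x a" "C x b" "C y a" "C y b" "a \<noteq> b"
  obtain h where h: "ham n h C" using ham_C by blast
  have "x < n" "y < n" "a < n" "b < n" using a E_less by blast+
  then show "x = y" using ham_no_square[OF h five_le] a by blast
qed

lemma C_triangle_detour:
  assumes "E w y" "E y z" "E w z" "\<not> M w y" "\<not> M w z"
  shows "detour w y z"
  using assms C_no_triangle[of w y z] E_irrefl[of y] unfolding detour_def by blast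

text \<open>Two edges in \<open>M\<close> would force the third by transitivity, and three cycle
  edges cannot form a triangle. So exactly one edge is in \<open>M\<close>, and the corner opposite
  to it is the middle.\<close>

lemma triangle_detour:
  assumes "E x y" "E y z" "E x z" "\<not> M x y"
  shows "detour x y z \<or> detour y x z"
proof (cases "M x z")
  case True
  have "x \<noteq> y" using assms E_irrefl by blast
  then have "\<not> M y z" using True assms(4) Mtrans[OF True Msym] by blast
  moreover have "\<not> M y x" using assms(4) Msym by blast
  ultimately show ?thesis
    using C_triangle_detour[of y x z] E_sym assms by blast
next
  case False
  then show ?thesis using C_triangle_detour[of x y z] assms by blast
qed

lemma switched_facts:
  assumes "switched m a b"
  shows "Q m a" "Q m b" "Q a b" "Q a m" "Q b m" "Q b a" "M a b" "M b a" "C m a" "C m b" "C a m" "C b m"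
    "a \<noteq> b" "m \<noteq> a" "m \<noteq> b"
proof -
  have s: "Q m a" "Q m b" "Q a b" "M a b" "C m a" "C m b" "a \<noteq> b"
    using assms unfolding switched_def detour_def by blast+
  show "Q m a" "Q m b" "Q a b" "M a b" "C m a" "C m b" "a \<noteq> b" by fact+
  show "Q a m" "Q b m" "Q b a" by (rule Qsym, fact)+
  show "M b a" by (rule Msym, fact)
  show "C a m" "C b m" by (rule C_sym, fact)+
  show "m \<noteq> a" "m \<noteq> b" using s(5,6) E_irrefl by metis+
qed

lemma switched_swap:
  assumes "switched m a b"
  shows "switched m b a"
  unfolding switched_def detour_def using switched_facts[OF assms] by simp

lemma Q_mid:
  assumes "switched m a b"
  shows "Q m y \<longleftrightarrow> y = a \<or> y = b"
  by (rule Qmates) (use switched_facts[OF assms] in auto)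

lemma Q_end:
  assumes "switched m a b"
  shows "Q a y \<longleftrightarrow> y = m \<or> y = b"
  by (rule Qmates) (use switched_facts[OF assms] in auto)

text \<open>The selected triangle at \<open>a\<close> consists of \<open>m\<close>, \<open>a\<close>
  and \<open>b\<close>. If \<open>a\<close> were its middle, the edge from \<open>a\<close> to
  \<open>b\<close> would be a cycle edge, but it is a factor edge.\<close>

lemma end_not_mid:
  assumes "switched m a b"
  shows "\<not> switched a c d"
proof
  assume s: "switched a c d"
  have "b = c \<or> b = d" using Q_mid[OF s] switched_facts(3)[OF assms] by blast
  then have "\<not> M a b" using switched_facts(9,10)[OF s] by blast
  then show False using switched_facts(7)[OF assms] by blast
qed

text \<open>If a detour triangle is selected, then the third vertex of the factor triangle it cuts is left
  with a single triangle, which is again a detour triangle.\<close>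

lemma switched_next:
  assumes s: "switched m a b" and w: "M a w" "w \<noteq> b"
  shows "\<exists>y z. switched w y z"
proof -
  note f = switched_facts[OF s]
  have wm: "w \<noteq> m" using w f by blast
  have aw: "a \<noteq> w" using w(1) M_irrefl[OF dec] by blast
  have w_mates: "M w y \<longleftrightarrow> y = a \<or> y = b" for y
  proof -
    have "M w a" "M b w" using Msym[OF w(1)] Mtrans[OF f(8) w(1)] w(2) by blast+
    then show ?thesis using Mmates[of w a b y] f(13) Msym by blast
  qed
  have wn: "w < n" using M_less[OF dec w(1)] by blast
  have detour: "detour w y z" if "E w y" "E y z" "E w z" "y \<noteq> a" "y \<noteq> b" "z \<noteq> a" "z \<noteq> b" for y z
    by (rule C_triangle_detour[OF that(1-3)]) (use w_mates that in blast)+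
  have not_Q: "\<not> Q w a" "\<not> Q w b"
    using Q_end[OF s, of w] Q_end[OF switched_swap[OF s], of w] wm w(2) aw Qsym by blast+
  show ?thesis
  \<comment> \<open>In both cases a selected or available triangle at \<open>w\<close> avoids
    \<open>a\<close> and \<open>b\<close>, which are covered by another triangle and are the only
    mates of \<open>w\<close> in \<open>M\<close>. Hence it is a detour with middle
    \<open>w\<close>.\<close>
  proof (cases "is_covered n Q w")
    case True
    then obtain y where y: "Q w y" unfolding is_covered_def by blast
    obtain z where z: "E w y" "E y z" "E w z" "Q w z" "Q y z" by (rule partial_third[OF pQ y])
    have "y \<noteq> a" "y \<noteq> b" "z \<noteq> a" "z \<noteq> b" using not_Q y z(4) by blast+
    then show ?thesis using detour[OF z(1-3)] y z unfolding switched_def by blast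
  next
    case False
    then obtain y z where yz: "y < n" "z < n" "available n E Q w y z" using nc wn unfolding conflict_def by blast
    have is_covered: "is_covered n Q a" "is_covered n Q b" using f(3,6) Q_less unfolding is_covered_def by blast+
    have av_det: "detour w c d" if "available n E Q w c d" for c d
      by (rule detour) (use that is_covered in \<open>unfold available_def, blast+\<close>)
    \<comment> \<open>The ends of a detour with middle \<open>w\<close> are cycle neighbours of
      \<open>w\<close>. There are only two of these, so \<open>w\<close> has a single candidate,
      which the closed selection \<open>Q\<close> must already contain.\<close>
    have "only n E Q w y z"
      unfolding only_def
    proof (intro allI impI)
      fix c d assume "available n E Q w c d"
      then show "c = y \<or> c = z"
        using av_det[of c d] av_det[OF yz(3)] C_neighbours[of w y z c] unfolding detour_def by blast
    qed
    then have "forced n E Q w y z" using yz(3) unfolding forced_def by blast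
    then have "step n E Q w y" by (rule step_forced(1))
    then have "Q w y" using closed by simp
    then show ?thesis using False yz(1) unfolding is_covered_def by blast
  qed
qed

text \<open>Makes the map \<open>W\<close> in \<open>exchange\<close> injective: both middles are
  common cycle neighbours of the two mates of \<open>w\<close>.\<close>

lemma mid_unique:
  assumes "switched m a b" "M a w" "w \<noteq> b" "switched m' a' b'" "M a' w" "w \<noteq> b'"
  shows "m = m'"
proof -
  note f = switched_facts[OF assms(1)] and f' = switched_facts[OF assms(4)]
  have "M w a" "M w b" "M w a'" "M w b'"
    using Msym[OF assms(2)] Msym[OF Mtrans[OF f(8) assms(2)]] Msym[OF assms(5)] Msym[OF Mtrans[OF f'(8) assms(5)]]
      assms(3,6) by blast+
  then have "a = a' \<and> b = b' \<or> a = b' \<and> b = a'"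
    using Mmates[of w a b a'] Mmates[of w a b b'] f(13) f'(13) by metis
  then show ?thesis
    using C_no_square[OF f(9,10) _ _ f(13), of m'] f'(9,10) by (elim disjE conjE) simp_all
qed

text \<open>The vertices \<open>S\<close> of all selected detours are closed under \<open>M\<close>
  as well as under \<open>Q\<close>. So replacing \<open>M\<close> by \<open>Q\<close> on
  \<open>S\<close> gives a factor, and it contains \<open>Q\<close>; renaming the middles by
  \<open>\<pi>\<close> carries the old cycle to the new complement.\<close>

lemma exchange: "\<exists>M'. decomp n E M' \<and> subfactor M' Q"
proof -
  define X where "X = {m. \<exists>a b. switched m a b}"
  \<comment> \<open>\<open>switched\<close> is symmetric in its ends, so one order is fixed for each
    middle. The triple holds the ends \<open>A m\<close> and \<open>B m\<close> and the next middle
    \<open>W m\<close>.\<close>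
  have "\<forall>m\<in>X. \<exists>t. switched m (fst t) (fst (snd t)) \<and> M (fst t) (snd (snd t)) \<and> snd (snd t) \<noteq> fst (snd t)"
  proof
    fix m assume m: "m \<in> X"
    obtain a b where s: "switched m a b" using m X_def by blast
    obtain w where "w \<noteq> b" "M a w" using tris_third[OF M_tris[OF dec] switched_facts(7)[OF s]] by blast
    with s show "\<exists>t. switched m (fst t) (fst (snd t)) \<and> M (fst t) (snd (snd t)) \<and> snd (snd t) \<noteq> fst (snd t)"
      by (intro exI[of _ "(a, b, w)"]) simp
  qed
  from bchoice[OF this] obtain g where g: "\<And>m. m \<in> X \<Longrightarrow> switched m (fst (g m)) (fst (snd (g m))) \<and>
      M (fst (g m)) (snd (snd (g m))) \<and> snd (snd (g m)) \<noteq> fst (snd (g m))"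
    by blast
  define A B W where "A m = fst (g m)" and "B m = fst (snd (g m))" and "W m = snd (snd (g m))" for m
  have sw: "switched m (A m) (B m)" and AW: "M (A m) (W m)" and WB: "W m \<noteq> B m" if "m \<in> X" for m
    using g[OF that] unfolding A_def B_def W_def by blast+
  have BW: "M (B m) (W m)" if "m \<in> X" for m
    using Mtrans[OF switched_facts(8)[OF sw[OF that]] AW[OF that]] WB[OF that] by metis
  have W_mates: "M (W m) y \<longleftrightarrow> y = A m \<or> y = B m" if m: "m \<in> X" for m y
    using Mmates[OF Msym[OF AW[OF m]] Msym[OF BW[OF m]]] switched_facts(13)[OF sw[OF m]] by blast
  have A_mates: "M (A m) y \<longleftrightarrow> y = B m \<or> y = W m" if m: "m \<in> X" for m y
    using Mmates[OF switched_facts(7)[OF sw[OF m]] AW[OF m]] WB[OF m] by metis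
  have B_mates: "M (B m) y \<longleftrightarrow> y = A m \<or> y = W m" if m: "m \<in> X" for m y
    using Mmates[OF switched_facts(8)[OF sw[OF m]] BW[OF m]] AW[OF m] M_irrefl[OF dec] by metis
  have WX: "W m \<in> X" if "m \<in> X" for m
    using switched_next[OF sw[OF that] AW[OF that] WB[OF that]] X_def by blast
  have AX: "A m \<notin> X" if "m \<in> X" for m
    using end_not_mid[OF sw[OF that]] X_def by blast
  have BX: "B m \<notin> X" if "m \<in> X" for m
    using end_not_mid[OF switched_swap[OF sw[OF that]]] X_def by blast
  have inj: "inj_on W X"
    by (rule inj_onI) (metis mid_unique sw AW WB)
  have XS: "X \<subseteq> {..<n}" using switched_facts(1) Q_less unfolding X_def by blast
  then have "finite X" using finite_subset by blast
  then have surj: "W ` X = X" using endo_inj_surj[of X W] WX inj by blast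
  define S where "S = {x. \<exists>m\<in>X. x = m \<or> x = A m \<or> x = B m}"
  have SI: "m \<in> S" "A m \<in> S" "B m \<in> S" if "m \<in> X" for m using that S_def by blast+
  have Q_S: "y \<in> S" if h: "Q x y" "x \<in> S" for x y
  proof -
    obtain m where m: "m \<in> X" "x = m \<or> x = A m \<or> x = B m" using h(2) S_def by blast
    have "y = m \<or> y = A m \<or> y = B m"
      using h(1) m Q_mid[OF sw[OF m(1)]] Q_end[OF sw[OF m(1)]] Q_end[OF switched_swap[OF sw[OF m(1)]]] by blast
    then show ?thesis using m S_def by blast
  qed
  \<comment> \<open>The factor mates of a middle lie in the preceding triangle of the orbit: by
    surjectivity it is \<open>W m'\<close> for some \<open>m'\<close>, and its mates are
    \<open>A m'\<close> and \<open>B m'\<close>.\<close>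
  have M_S: "y \<in> S" if h: "M x y" "x \<in> S" for x y
  proof -
    obtain m where m: "m \<in> X" "x = m \<or> x = A m \<or> x = B m" using h(2) S_def by blast
    consider "x = m" | "x = A m" | "x = B m" using m by blast
    then show ?thesis
    proof cases
      case 1
      then obtain m' where m': "m' \<in> X" "x = W m'" using m(1) surj by blast
      then have "y = A m' \<or> y = B m'" using W_mates[OF m'(1)] h(1) by simp
      then show ?thesis using SI[OF m'(1)] by metis
    next
      case 2
      then have "y = B m \<or> y = W m" using A_mates[OF m(1)] h(1) by simp
      then show ?thesis using SI[OF m(1)] SI[OF WX[OF m(1)]] by metis
    next
      case 3
      then have "y = A m \<or> y = W m" using B_mates[OF m(1)] h(1) by simp
      then show ?thesis using SI[OF m(1)] SI[OF WX[OF m(1)]] by metis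
    qed
  qed
  define M' where "M' = (\<lambda>x y. if x \<in> S then Q x y else M x y)"
  have M'_in: "M' x y \<longleftrightarrow> Q x y" if "x \<in> S" for x y using that by (simp add: M'_def)
  have M'_out: "M' x y \<longleftrightarrow> M x y" if "x \<notin> S" for x y using that by (simp add: M'_def)
  have tM': "tris M'"
    unfolding M'_def by (rule tris_glue[OF M_tris[OF dec] tris_Q M_S Q_S])
  have M'_E: "E x y" if "M' x y" for x y
    using that M'_in M'_out M_E[OF dec] partial_E[OF pQ] by (cases "x \<in> S") blast+
  have M'_cov: "\<exists>y. M' x y" if "x < n" for x
  proof (cases "x \<in> S")
    case True
    then have "\<exists>y. Q x y" using S_def switched_facts(1,3,6) sw by blast
    then show ?thesis using M'_in[OF True] by blast
  next
    case False
    then show ?thesis using M_cov[OF dec that] M'_out[OF False] by blast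
  qed
  define \<pi> where "\<pi> x = (if x \<in> X then W x else x)" for x
  have \<pi>_less: "\<pi> x < n" if "x < n" for x using that WX XS unfolding \<pi>_def by auto
  have \<pi>_X: "\<pi> x \<in> X \<longleftrightarrow> x \<in> X" for x using WX unfolding \<pi>_def by simp
  have \<pi>_inj: "inj_on \<pi> {..<n}"
  proof (rule inj_onI)
    fix x y assume "\<pi> x = \<pi> y"
    then show "x = y" using \<pi>_X[of x] \<pi>_X[of y] inj unfolding \<pi>_def inj_on_def by (metis (full_types))
  qed
  have \<pi>_bij: "bij_betw \<pi> {..<n} {..<n}"
    using endo_inj_surj[OF finite_lessThan _ \<pi>_inj] \<pi>_less \<pi>_inj by (auto simp: bij_betw_def)
  let ?C' = "\<lambda>x y. E x y \<and> \<not> M' x y"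
  have C'_sym: "?C' x y \<longleftrightarrow> ?C' y x" for x y using E_sym tris_sym[OF tM'] by blast
  have C_mid: "C x y \<longleftrightarrow> y = A x \<or> y = B x" if x: "x \<in> X" for x y
    using C_neighbours[of x "A x" "B x" y] switched_facts(9,10,13)[OF sw[OF x]] by blast
  \<comment> \<open>The neighbours of \<open>W x\<close> are its old mates \<open>A x\<close>,
    \<open>B x\<close> and its old cycle neighbours \<open>A (W x)\<close>, \<open>B (W x)\<close>.
    The new factor takes the latter and leaves the former, which are the cycle neighbours of
    \<open>x\<close>; so \<open>W x\<close> moves into the place of \<open>x\<close>.\<close>
  have C'_W: "?C' (W x) v \<longleftrightarrow> v = A x \<or> v = B x" if x: "x \<in> X" for x v
  proof -
    have *: "M' (W x) v \<longleftrightarrow> v = A (W x) \<or> v = B (W x)"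
      using M'_in[OF SI(1)[OF WX[OF x]]] Q_mid[OF sw[OF WX[OF x]]] by blast
    have "E (W x) v \<longleftrightarrow> M (W x) v \<or> C (W x) v" using M_E[OF dec] by blast
    then have "E (W x) v \<longleftrightarrow> (v = A x \<or> v = B x) \<or> (v = A (W x) \<or> v = B (W x))"
      using C_mid[OF WX[OF x]] W_mates[OF x] by blast
    moreover have "\<not> (v = A (W x) \<or> v = B (W x))" if "v = A x \<or> v = B x"
      using that W_mates[OF x] C_mid[OF WX[OF x]] by blast
    ultimately show ?thesis using * by blast
  qed
  \<comment> \<open>The ends \<open>A x\<close> and \<open>B x\<close> are not middles, so
    \<open>\<pi>\<close> fixes them and maps no other vertex to them.\<close>
  have C'_mid: "?C' (\<pi> x) (\<pi> y) \<longleftrightarrow> C x y" if x: "x \<in> X" for x y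
  proof -
    have "\<pi> y = v \<longleftrightarrow> y = v" if "v \<notin> X" for v
      using \<pi>_X[of y] that unfolding \<pi>_def by (cases "y \<in> X") auto
    then have "\<pi> y = A x \<or> \<pi> y = B x \<longleftrightarrow> y = A x \<or> y = B x" using AX[OF x] BX[OF x] by blast
    then show ?thesis using C'_W[OF x, of "\<pi> y"] C_mid[OF x, of y] x unfolding \<pi>_def by simp
  qed
  have C'_iff: "?C' (\<pi> x) (\<pi> y) \<longleftrightarrow> C x y" for x y
  proof (cases "x \<in> X \<or> y \<in> X")
    case True
    moreover have "C x y \<longleftrightarrow> C y x" using C_sym by blast
    ultimately show ?thesis using C'_mid[of x y] C'_mid[of y x] C'_sym[of "\<pi> x" "\<pi> y"] by blast
  next
    case False
    \<comment> \<open>Between vertices that are not middles nothing changes: \<open>A m\<close> and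
      \<open>B m\<close> are mates in both factors.\<close>
    have "M' x y \<longleftrightarrow> M x y"
    proof (cases "x \<in> S")
      case True
      then obtain m where m: "m \<in> X" "x = A m \<or> x = B m" using False S_def by blast
      have "y \<noteq> m" "y \<noteq> W m" using False m WX by blast+
      then show ?thesis
        using m M'_in[OF True] Q_end[OF sw[OF m(1)]] Q_end[OF switched_swap[OF sw[OF m(1)]]]
          A_mates[OF m(1)] B_mates[OF m(1)] by blast
    qed (rule M'_out)
    with False show ?thesis by (simp add: \<pi>_def)
  qed
  obtain h where h: "ham n h C" using ham_C by blast
  have "ham n (\<pi> \<circ> h) ?C'"
    unfolding ham_def
  proof (intro conjI allI impI)
    show "bij_betw (\<pi> \<circ> h) {..<n} {..<n}"
      using h \<pi>_bij unfolding ham_def by (blast intro: bij_betw_trans)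
    show "?C' ((\<pi> \<circ> h) i) ((\<pi> \<circ> h) j) \<longleftrightarrow> adj n i j" if "i < n" "j < n" for i j
      using C'_iff[of "h i" "h j"] ham_adj[OF h that] by simp
  qed
  then have dec': "decomp n E M'"
    unfolding decomp_def using tM' M'_E M'_cov by blast
  \<comment> \<open>A selected triangle outside \<open>M\<close> is a selected detour, and its
    middle pulls the whole triangle into \<open>S\<close>.\<close>
  have Q_out: "M x y" if Qxy: "Q x y" and x: "x \<notin> S" for x y
  proof (rule ccontr)
    assume n: "\<not> M x y"
    obtain z where z: "E x y" "E y z" "E x z" "Q x z" "Q y z" by (rule partial_third[OF pQ Qxy])
    from triangle_detour[OF z(1-3) n] have "switched x y z \<or> switched y x z"
      using z Qxy Qsym unfolding switched_def by blast
    then have "x \<in> X \<or> y \<in> X" unfolding X_def by blast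
    then have "x \<in> S \<or> y \<in> S" using SI by blast
    then show False using x Q_S Qsym Qxy by blast
  qed
  have Q_M': "M' x y" if "Q x y" for x y
    using that M'_in M'_out Q_out by (cases "x \<in> S") blast+
  have "Q y z" if h: "Q x y" "M' y z" for x y z
  proof (cases "y \<in> S")
    case True
    then show ?thesis using h M'_in by blast
  next
    case False
    have yx: "Q y x" using Qsym h by blast
    obtain w where w: "w \<noteq> x" "Q y w" using tris_third[OF tris_Q yx] by blast
    have "M y x" "M y w" "M y z" using Q_out[OF yx False] Q_out[OF w(2) False] M'_out[OF False] h by blast+
    then have "z = x \<or> z = w" using Mmates[of y x w z] w by blast
    then show ?thesis using yx w by blast
  qed
  then have "subfactor M' Q" unfolding subfactor_def using Q_M' by blast
  with dec' show ?thesis by blast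
qed

end

end

section \<open>Correctness of the greedy search\<close>

context graph begin

lemma add_less: "add n P a b c x y \<Longrightarrow> x < n \<and> y < n"
  unfolding add_def by blast

lemma closure_less: "closure n E P a b c x y \<Longrightarrow> x < n \<and> y < n"
  unfolding closure_def by (rule funpow_step_less) (rule add_less)

lemma add_closure: "add n P a b c x y \<Longrightarrow> closure n E P a b c x y"
  unfolding closure_def by (rule funpow_step_mono) (auto dest: add_less)

lemma partial_closure:
  assumes "triangle_union P" "available n E P a b c"
  shows "triangle_union (closure n E P a b c)"
proof -
  have "triangle_union ((step n E ^^ j) (add n P a b c))" for j
    by (induction j) (simp_all add: partial_add[OF assms] partial_step)
  then show ?thesis unfolding closure_def .
qed

lemma sub_less: "decomp n E M \<Longrightarrow> subfactor M P \<Longrightarrow> P x y \<Longrightarrow> x < n \<and> y < n"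
  using M_less unfolding subfactor_def by blast

lemma accept_mono: "P x y \<Longrightarrow> x < n \<Longrightarrow> y < n \<Longrightarrow> accept n E a b c P x y"
  unfolding accept_def by blast

text \<open>The invariant keeps some decomposition rather than a fixed one: after an acceptance the
  witness \<open>M'\<close> comes from \<open>exchange\<close> and may differ from
  \<open>M\<close>.\<close>

lemma accept_sub:
  assumes dec: "decomp n E M" and subfactor: "subfactor M P"
  shows "\<exists>M'. decomp n E M' \<and> subfactor M' (accept n E a b c P)"
proof (cases "available n E P a b c \<and> \<not> conflict n E (closure n E P a b c)")
  case True
  let ?Q = "closure n E P a b c"
  have "accept n E a b c P x y \<longleftrightarrow> ?Q x y" for x y
  proof -
    have "?Q x y" if "P x y" "x < n" "y < n"
      by (rule add_closure) (use that in \<open>simp add: add_def\<close>)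
    then show ?thesis using True closure_less[of P a b c x y] unfolding accept_def by blast
  qed
  then have eq: "accept n E a b c P = ?Q" by (intro ext) blast
  have p: "triangle_union ?Q" using partial_closure[OF sub_partial[OF dec subfactor]] True by blast
  have s: "step n E ?Q = ?Q"
    unfolding closure_def by (rule step_fixpoint) (rule add_less)
  show ?thesis unfolding eq using exchange[OF dec p s] True by blast
next
  case False
  have "accept n E a b c P x y \<longleftrightarrow> P x y" for x y
    using False sub_less[OF dec subfactor, of x y] unfolding accept_def by blast
  then have eq: "accept n E a b c P = P" by (intro ext) blast
  show ?thesis unfolding eq using dec subfactor by blast
qed

definition greedy :: "(nat \<times> nat \<times> nat) list \<Rightarrow> (nat \<Rightarrow> nat \<Rightarrow> bool) \<Rightarrow> nat \<Rightarrow> nat \<Rightarrow> bool" where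
  "greedy = fold (\<lambda>(a, b, c). accept n E a b c)"

lemma greedy_Cons: "greedy ((a, b, c) # ts) P = greedy ts (accept n E a b c P)"
  by (simp add: greedy_def)

lemma greedy_append: "greedy (ts @ us) P = greedy us (greedy ts P)"
  by (simp add: greedy_def)

lemma greedy_sub:
  assumes "\<exists>M. decomp n E M \<and> subfactor M P"
  shows "(\<exists>M. decomp n E M \<and> subfactor M (greedy ts P)) \<and> (\<forall>x y. P x y \<longrightarrow> greedy ts P x y)"
  using assms
proof (induction ts arbitrary: P)
  case Nil
  then show ?case by (simp add: greedy_def)
next
  case (Cons t ts)
  obtain a b c where t: "t = (a, b, c)" by (cases t) auto
  obtain M where M: "decomp n E M" "subfactor M P" using Cons.prems by blast
  have "\<forall>x y. P x y \<longrightarrow> accept n E a b c P x y"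
    using sub_less[OF M] accept_mono by blast
  with Cons.IH[OF accept_sub[OF M]] show ?case unfolding t greedy_Cons by blast
qed

text \<open>Fix a decomposition \<open>M\<close> that contains the final selection. If
  \<open>a\<close> stayed uncovered, the trial of its triangle in \<open>M\<close> would have
  succeeded: the selection \<open>?R\<close> at that time also lies inside \<open>M\<close>, where
  propagation meets no conflict.\<close>

lemma greedy_decomp:
  assumes "\<exists>M. decomp n E M" and ts: "\<And>a b c. a < n \<Longrightarrow> b < n \<Longrightarrow> c < n \<Longrightarrow> (a, b, c) \<in> set ts"
  shows "decomp n E (greedy ts (\<lambda>_ _. False))"
proof -
  let ?F = "\<lambda>_ _. False"
  let ?P = "greedy ts ?F"
  have F: "\<exists>M. decomp n E M \<and> subfactor M ?F" using assms(1) unfolding subfactor_def by blast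
  obtain M where M: "decomp n E M" "subfactor M ?P" using greedy_sub[OF F] by blast
  have is_covered: "is_covered n ?P a" if an: "a < n" for a
  proof (rule ccontr)
    assume uncov: "\<not> is_covered n ?P a"
    obtain b where b: "M a b" using M_cov[OF M(1) an] by blast
    obtain c where c: "c \<noteq> a" "c \<noteq> b" "M a c" "M b c" using tris_third[OF M_tris[OF M(1)] b] by blast
    have lt: "b < n" "c < n" using b c M_less[OF M(1)] by blast+
    obtain us vs where "ts = us @ (a, b, c) # vs" using split_list[OF ts[OF an lt]] by blast
    then have eq: "?P = greedy vs (accept n E a b c (greedy us ?F))"
      by (simp add: greedy_append greedy_Cons)
    let ?R = "greedy us ?F"
    obtain M0 where M0: "decomp n E M0" "subfactor M0 ?R" using greedy_sub[OF F] by blast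
    have P1: "accept n E a b c ?R x y \<Longrightarrow> ?P x y" for x y
      using greedy_sub[OF accept_sub[OF M0], of vs] unfolding eq by blast
    then have P0: "?R x y \<Longrightarrow> ?P x y" for x y
      using accept_mono sub_less[OF M0] by blast
    \<comment> \<open>\<open>?R\<close> is a union of triangles by its own decomposition
      \<open>M0\<close> and is contained in the final selection; this makes it a subfactor of
      \<open>M\<close> too.\<close>
    have s0: "subfactor M ?R" by (rule sub_mono[OF M sub_partial[OF M0] P0])
    have unc0: "\<not> is_covered n ?R a" using uncov P0 unfolding is_covered_def by blast
    have "available n E ?R a b c" using sub_av[OF M(1) s0 unc0 b c(3)] c(2) by blast
    moreover have "\<not> conflict n E (closure n E ?R a b c)"
      unfolding closure_def
      by (intro sub_not_conf[OF M(1)] sub_funpow[OF M(1)] sub_add[OF M(1)] s0 b c)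
    moreover have "closure n E ?R a b c a b"
      by (rule add_closure) (use an lt M_irrefl[OF M(1) b] in \<open>simp add: add_def\<close>)
    ultimately have "accept n E a b c ?R a b" unfolding accept_def using an lt by blast
    then show False using P1 uncov lt unfolding is_covered_def by blast
  qed
  have "?P x y \<longleftrightarrow> M x y" for x y
  proof
    assume "?P x y"
    then show "M x y" using M(2) unfolding subfactor_def by blast
  next
    assume m: "M x y"
    show "?P x y" by (rule sub_cov[OF M is_covered m]) (use m M_less[OF M(1)] in blast)
  qed
  then have "?P = M" by (intro ext)
  with M(1) show ?thesis by simp
qed

end

section \<open>The relational program\<close>

definition Disj :: "fm \<Rightarrow> fm \<Rightarrow> fm" where "Disj \<phi> \<psi> = Neg (Conj (Neg \<phi>) (Neg \<psi>))"
definition Equal :: "nat \<Rightarrow> nat \<Rightarrow> fm" where "Equal x y = Conj (Neg (Less x y)) (Neg (Less y x))"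

lemma sat_Disj [simp]: "sat (Disj \<phi> \<psi>) n S e \<longleftrightarrow> sat \<phi> n S e \<or> sat \<psi> n S e"
  by (simp add: Disj_def)

lemma sat_Equal [simp]: "sat (Equal x y) n S e \<longleftrightarrow> e x = e y"
  by (auto simp: Equal_def)

text \<open>Register 0 holds the graph, 1 the second input, 2 the selected triangles, 3 the tentative selection,
  4 the cyclic order and 5 the relation of lying in a common triangle, on positions.\<close>

definition covF :: "nat \<Rightarrow> nat \<Rightarrow> nat \<Rightarrow> fm" where
  "covF r x t = Exi t (Rel r x t)"

definition avF :: "nat \<Rightarrow> nat \<Rightarrow> nat \<Rightarrow> nat \<Rightarrow> nat \<Rightarrow> fm" where
  "avF r x y z t = Conj (Rel 0 x y) (Conj (Rel 0 y z) (Conj (Rel 0 x z)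
     (Conj (Neg (covF r x t)) (Conj (Neg (covF r y t)) (Neg (covF r z t))))))"

definition onlyF :: "nat \<Rightarrow> nat \<Rightarrow> nat \<Rightarrow> nat \<Rightarrow> nat \<Rightarrow> nat \<Rightarrow> nat \<Rightarrow> fm" where
  "onlyF r v a b c d t = Neg (Exi c (Exi d (Conj (avF r v c d t) (Neg (Disj (Equal c a) (Equal c b))))))"

definition forcedF :: "nat \<Rightarrow> nat \<Rightarrow> nat \<Rightarrow> nat \<Rightarrow> nat \<Rightarrow> nat \<Rightarrow> nat \<Rightarrow> fm" where
  "forcedF r x y z c d t = Conj (avF r x y z t)
     (Disj (onlyF r x y z c d t) (Disj (onlyF r y x z c d t) (onlyF r z x y c d t)))"

text \<open>In the search, variables 0 and 1 are the pair being defined, 2, 3 and 4 the triple on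
  trial, 5 and 6 the rounds of propagation; 7 to 10 are bound inside formulas.\<close>

definition stepF :: fm where
  "stepF = Disj (Rel 3 0 1) (Exi 7 (forcedF 3 0 1 7 8 9 10))"

definition confF :: fm where
  "confF = Disj (Exi 7 (Conj (Neg (covF 3 7 10)) (Neg (Exi 8 (Exi 9 (avF 3 7 8 9 10))))))
     (Exi 7 (Exi 8 (Exi 9 (Exi 10 (Conj (Rel 3 7 8) (Conj (Rel 3 7 9) (Conj (Rel 3 7 10)
       (Conj (Neg (Equal 8 9)) (Conj (Neg (Equal 8 10)) (Neg (Equal 9 10))))))))))) "

definition addF :: fm where
  "addF = Disj (Rel 2 0 1) (Conj (Neg (Equal 0 1))
     (Conj (Disj (Equal 0 2) (Disj (Equal 0 3) (Equal 0 4))) (Disj (Equal 1 2) (Disj (Equal 1 3) (Equal 1 4)))))"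

definition acceptF :: fm where
  "acceptF = Disj (Rel 2 0 1) (Conj (avF 2 2 3 4 10) (Conj (Neg confF) (Rel 3 0 1)))"

lemma sat_covF: "t \<noteq> x \<Longrightarrow> sat (covF r x t) n S e \<longleftrightarrow> is_covered n (S r) (e x)"
  by (simp add: covF_def is_covered_def)

lemma sat_avF: "t \<noteq> x \<Longrightarrow> t \<noteq> y \<Longrightarrow> t \<noteq> z \<Longrightarrow> sat (avF r x y z t) n S e \<longleftrightarrow> available n (S 0) (S r) (e x) (e y) (e z)"
  by (simp add: avF_def available_def sat_covF)

lemma sat_onlyF:
  assumes "distinct [v, c, d, t]" "a \<notin> {c, d}" "b \<notin> {c, d}"
  shows "sat (onlyF r v a b c d t) n S e \<longleftrightarrow> only n (S 0) (S r) (e v) (e a) (e b)"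
proof -
  have "v \<noteq> c" "v \<noteq> d" "c \<noteq> d" "t \<noteq> v" "t \<noteq> c" "t \<noteq> d" "a \<noteq> c" "a \<noteq> d" "b \<noteq> c" "b \<noteq> d"
    using assms by auto
  then show ?thesis unfolding onlyF_def only_def by (simp add: sat_avF) blast
qed

lemma sat_forcedF:
  assumes "distinct [c, d, t]" "{x, y, z} \<inter> {c, d, t} = {}"
  shows "sat (forcedF r x y z c d t) n S e \<longleftrightarrow> forced n (S 0) (S r) (e x) (e y) (e z)"
proof -
  have "t \<noteq> x" "t \<noteq> y" "t \<noteq> z" using assms by auto
  moreover have "sat (onlyF r x y z c d t) n S e \<longleftrightarrow> only n (S 0) (S r) (e x) (e y) (e z)"
    "sat (onlyF r y x z c d t) n S e \<longleftrightarrow> only n (S 0) (S r) (e y) (e x) (e z)"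
    "sat (onlyF r z x y c d t) n S e \<longleftrightarrow> only n (S 0) (S r) (e z) (e x) (e y)"
    by (rule sat_onlyF; use assms in auto)+
  ultimately show ?thesis unfolding forcedF_def forced_def by (simp add: sat_avF)
qed

lemma sat_stepF:
  "u < n \<and> v < n \<and> sat stepF n S (e(0 := u, Suc 0 := v)) \<longleftrightarrow> step n (S 0) (S 3) u v"
  unfolding stepF_def step_def by (simp add: sat_forcedF)

lemma sat_confF: "sat confF n S e \<longleftrightarrow> conflict n (S 0) (S 3)"
  unfolding confF_def conflict_def by (simp add: sat_covF sat_avF)

lemma sat_addF:
  "u < n \<and> v < n \<and> sat addF n S (e(0 := u, Suc 0 := v)) \<longleftrightarrow> add n (S 2) (e 2) (e 3) (e 4) u v"
  unfolding addF_def add_def by simp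

definition acceptC :: cmd where
  "acceptC = Sq (Def 3 0 1 addF) (Sq (For 5 (For 6 (Def 3 0 1 stepF))) (Def 2 0 1 acceptF))"

lemma fold_const: "fold (\<lambda>_. F) [0..<m] = F ^^ m"
  by (induction m) (simp_all add: fun_eq_iff)

lemma csem_step: "csem (Def 3 0 1 stepF) n e = (\<lambda>S. S(3 := step n (S 0) (S 3)))"
  by (rule ext) (simp add: sat_stepF)

text \<open>Two nested loops over the \<open>n\<close> points supply the \<open>n * n\<close> rounds
  of \<open>closure\<close>.\<close>

lemma csem_steps:
  "csem (For 5 (For 6 (Def 3 0 1 stepF))) n e S = S(3 := (step n (S 0) ^^ (n * n)) (S 3))"
proof -
  let ?F = "\<lambda>S::rels. S(3 := step n (S 0) (S 3))"
  have inner: "csem (For 6 (Def 3 0 1 stepF)) n e = ?F ^^ n" for e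
    by (rule ext) (simp only: csem.simps(3) csem_step fold_const)
  have "csem (For 5 (For 6 (Def 3 0 1 stepF))) n e S = ((?F ^^ n) ^^ n) S"
    unfolding csem.simps(3)[of 5] inner fold_const ..
  also have "\<dots> = (?F ^^ (n * n)) S" by (simp add: funpow_mult)
  also have "(?F ^^ m) S = S(3 := (step n (S 0) ^^ m) (S 3))" for m
    by (induction m) auto
  finally show ?thesis .
qed

lemma csem_acceptC:
  assumes "csem acceptC n e S = R"
  shows "R 2 = accept n (S 0) (e 2) (e 3) (e 4) (S 2)" "R 0 = S 0" "R 1 = S 1"
proof -
  have add: "csem (Def 3 0 1 addF) n e S = S(3 := add n (S 2) (e 2) (e 3) (e 4))"
    by (simp add: sat_addF)
  have R: "R = csem (Def 2 0 1 acceptF) n e (S(3 := closure n (S 0) (S 2) (e 2) (e 3) (e 4)))"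
    using assms unfolding acceptC_def csem.simps(2) add csem_steps by (simp add: closure_def)
  show "R 2 = accept n (S 0) (e 2) (e 3) (e 4) (S 2)"
    unfolding R by (simp add: fun_eq_iff acceptF_def accept_def sat_avF sat_confF)
  show "R 0 = S 0" "R 1 = S 1" unfolding R by simp_all
qed

definition searchC :: cmd where
  "searchC = For 2 (For 3 (For 4 acceptC))"

lemma fold_simulation:
  assumes "\<And>x S P. sim S P \<Longrightarrow> sim (F x S) (G x P)" "sim S P"
  shows "sim (fold F xs S) (fold G xs P)"
  using assms(2) by (induction xs arbitrary: S P) (simp_all add: assms(1))

definition triples :: "nat \<Rightarrow> (nat \<times> nat \<times> nat) list" where
  "triples n = concat (map (\<lambda>a. concat (map (\<lambda>b. map (\<lambda>c. (a, b, c)) [0..<n]) [0..<n])) [0..<n])"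

text \<open>The greedy search outside the locale, so that the meaning of the program can be stated
  for every input relation.\<close>

definition matching :: "nat \<Rightarrow> (nat \<Rightarrow> nat \<Rightarrow> bool) \<Rightarrow> nat \<Rightarrow> nat \<Rightarrow> bool" where
  "matching n E = fold (\<lambda>(a, b, c). accept n E a b c) (triples n) (\<lambda>_ _. False)"

lemma fold_concat_map: "fold f (concat (map g xs)) s = fold (\<lambda>x. fold f (g x)) xs s"
  by (induction xs arbitrary: s) simp_all

lemma csem_searchC:
  assumes "csem searchC n e S = R" "S 2 = (\<lambda>_ _. False)"
  shows "R 2 = matching n (S 0)" "R 0 = S 0" "R 1 = S 1"
proof -
  let ?sim = "\<lambda>(T :: rels) P. T 0 = S 0 \<and> T 1 = S 1 \<and> T 2 = P"
  have 1: "?sim (csem acceptC n (e(2 := a, 3 := b, 4 := c)) T) (accept n (S 0) a b c P)"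
    if "?sim T P" for a b c T P
    using csem_acceptC[OF refl, of n "e(2 := a, 3 := b, 4 := c)" T] that by simp
  have 2: "?sim (csem (For 4 acceptC) n (e(2 := a, 3 := b)) T) (fold (\<lambda>c. accept n (S 0) a b c) [0..<n] P)"
    if "?sim T P" for a b T P
    unfolding csem.simps(3) by (rule fold_simulation[where sim = ?sim, OF 1 that])
  have 3: "?sim (csem (For 3 (For 4 acceptC)) n (e(2 := a)) T)
      (fold (\<lambda>b. fold (\<lambda>c. accept n (S 0) a b c) [0..<n]) [0..<n] P)" if "?sim T P" for a T P
    unfolding csem.simps(3)[of 3] by (rule fold_simulation[where sim = ?sim, OF 2 that])
  have "?sim (csem searchC n e S)
    (fold (\<lambda>a. fold (\<lambda>b. fold (\<lambda>c. accept n (S 0) a b c) [0..<n]) [0..<n]) [0..<n] (S 2))"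
    unfolding searchC_def csem.simps(3)[of 2]
    by (rule fold_simulation[where sim = ?sim, OF 3]) (assumption, simp only: simp_thms)
  moreover have "fold (\<lambda>a. fold (\<lambda>b. fold (\<lambda>c. accept n (S 0) a b c) [0..<n]) [0..<n]) [0..<n] P =
    fold (\<lambda>(a, b, c). accept n (S 0) a b c) (triples n) P" for P
    unfolding triples_def fold_concat_map fold_map comp_def by simp
  ultimately show "R 2 = matching n (S 0)" "R 0 = S 0" "R 1 = S 1"
    using assms by (simp_all add: matching_def)
qed

definition zeroF :: "nat \<Rightarrow> nat \<Rightarrow> fm" where
  "zeroF x t = Neg (Exi t (Less t x))"

lemma sat_zeroF: "t \<noteq> x \<Longrightarrow> e x < n \<Longrightarrow> sat (zeroF x t) n S e \<longleftrightarrow> e x = 0"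
  by (auto simp: zeroF_def)

definition succF :: "nat \<Rightarrow> nat \<Rightarrow> nat \<Rightarrow> fm" where
  "succF x y t = Conj (Less x y) (Neg (Exi t (Conj (Less x t) (Less t y))))"

lemma sat_succF:
  assumes "t \<noteq> x" "t \<noteq> y" "e y < n"
  shows "sat (succF x y t) n S e \<longleftrightarrow> e y = Suc (e x)"
proof
  assume "sat (succF x y t) n S e"
  then have "e x < e y" "\<not> (Suc (e x) < n \<and> e x < Suc (e x) \<and> Suc (e x) < e y)"
    using assms unfolding succF_def by auto
  then show "e y = Suc (e x)" using assms by linarith
qed (use assms in \<open>auto simp: succF_def\<close>)

definition restF :: "nat \<Rightarrow> nat \<Rightarrow> fm" where
  "restF x y = Conj (Rel 0 x y) (Neg (Rel 2 x y))"

definition walkF :: fm where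
  "walkF = Disj (Rel 4 0 1) (Conj (succF 2 0 7) (Exi 8 (Conj (Rel 4 2 8) (Conj (restF 8 1)
     (Conj (Neg (Exi 7 (Rel 4 7 1))) (Neg (Exi 9 (Conj (Less 9 1) (Conj (restF 8 9) (Neg (Exi 7 (Rel 4 7 9)))))))))))) "

definition walkC :: cmd where
  "walkC = Sq (Def 4 0 1 (Conj (zeroF 0 2) (zeroF 1 2))) (For 2 (Def 4 0 1 walkF))"

definition rest :: "(nat \<Rightarrow> nat \<Rightarrow> bool) \<Rightarrow> (nat \<Rightarrow> nat \<Rightarrow> bool) \<Rightarrow> nat \<Rightarrow> nat \<Rightarrow> bool" where
  "rest E M x y \<longleftrightarrow> E x y \<and> \<not> M x y"

definition positions :: "nat \<Rightarrow> (nat \<Rightarrow> nat \<Rightarrow> bool) \<Rightarrow> nat \<Rightarrow> nat \<Rightarrow> bool" where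
  "positions n C = fold (walk n C) [0..<n] (\<lambda>j v. j < n \<and> v < n \<and> j = 0 \<and> v = 0)"

lemma csem_walkF:
  "csem (Def 4 0 1 walkF) n (e(2 := i)) S = S(4 := walk n (rest (S 0) (S 2)) i (S 4))"
proof -
  have "u < n \<and> v < n \<and> sat walkF n S (e(2 := i, 0 := u, 1 := v)) \<longleftrightarrow>
      walk n (rest (S 0) (S 2)) i (S 4) u v" for u v
    unfolding walkF_def walk_def by (auto simp: sat_succF restF_def rest_def)
  then show ?thesis by (simp add: fun_eq_iff)
qed

lemma csem_walkC:
  "csem walkC n e S = S(4 := positions n (rest (S 0) (S 2)))"
proof -
  let ?C = "rest (S 0) (S 2)"
  have init: "csem (Def 4 0 1 (Conj (zeroF 0 2) (zeroF 1 2))) n e S = S(4 := (\<lambda>j v. j < n \<and> v < n \<and> j = 0 \<and> v = 0))"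
    by (auto simp: sat_zeroF fun_eq_iff)
  have "fold (\<lambda>i. csem (Def 4 0 1 walkF) n (e(2 := i))) xs (S(4 := R)) = S(4 := fold (walk n ?C) xs R)" for xs R
    by (induction xs arbitrary: R) (simp_all add: csem_walkF del: csem.simps One_nat_def)
  then show ?thesis
    unfolding walkC_def csem.simps(2) init csem.simps(3) positions_def by blast
qed

definition sameC :: cmd where
  "sameC = Def 5 0 1 (Exi 7 (Exi 8 (Conj (Rel 4 0 7) (Conj (Rel 4 1 8) (Disj (Equal 7 8) (Rel 2 7 8))))))"

text \<open>\<open>M\<close> is irreflexive; equality is added to obtain equivalence
  classes.\<close>

definition same :: "nat \<Rightarrow> (nat \<Rightarrow> nat \<Rightarrow> bool) \<Rightarrow> (nat \<Rightarrow> nat \<Rightarrow> bool) \<Rightarrow> nat \<Rightarrow> nat \<Rightarrow> bool" where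
  "same n R M p q \<longleftrightarrow> p < n \<and> q < n \<and> (\<exists>u<n. \<exists>v<n. R p u \<and> R q v \<and> (u = v \<or> M u v))"

definition reduceC :: cmd where
  "reduceC = Sq searchC (Sq walkC sameC)"

lemma csem_reduceC:
  fixes n :: nat and S :: rels
  assumes "S 2 = (\<lambda>_ _. False)"
  defines "M \<equiv> matching n (S 0)"
  defines "R \<equiv> positions n (rest (S 0) M)"
  shows "csem reduceC n e S 1 = S 1" "csem reduceC n e S 4 = R" "csem reduceC n e S 5 = same n R M"
proof -
  note * = csem_searchC[of n e S, OF refl assms(1)]
  show "csem reduceC n e S 1 = S 1" "csem reduceC n e S 4 = R" "csem reduceC n e S 5 = same n R M"
    unfolding reduceC_def csem.simps(2) csem_walkC sameC_def R_def M_def *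
    by (simp_all add: * *(3)[unfolded One_nat_def] same_def[abs_def])
qed

section \<open>Cycle plus triangles graphs\<close>

text \<open>The program counts points from 0, the graph counts vertices from 1.\<close>

definition graph_rel :: "nat \<Rightarrow> nat set set \<Rightarrow> nat \<Rightarrow> nat \<Rightarrow> bool" where
  "graph_rel n F u v \<longleftrightarrow> u < n \<and> v < n \<and> {Suc u, Suc v} \<in> F"

text \<open>Disjoint triples, \<open>k\<close> in number, exhaust \<open>3 * k\<close> points, so
  the triangles form a factor. Their edges avoid the cycle, so removing them leaves exactly the
  cycle.\<close>

lemma cycle_plus_triangles_decomp:
  assumes "cycle_plus_triangles_graph k F"
  shows "2 \<le> k" "\<exists>M. decomp (3 * k) (graph_rel (3 * k) F) M"
proof -
  let ?n = "3 * k"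
  obtain vs \<T> where ham: "hamilton_cycle_on {1..?n} vs" and card: "card \<T> = k"
    and T: "\<And>T. T \<in> \<T> \<Longrightarrow> T \<subseteq> {1..?n} \<and> card T = 3" and disj: "disjoint \<T>"
    and int: "cycle_edges vs \<inter> (\<Union>T\<in>\<T>. triangle_edges T) = {}"
    and F: "F = cycle_edges vs \<union> (\<Union>T\<in>\<T>. triangle_edges T)"
    using assms unfolding cycle_plus_triangles_graph_def by blast
  have vs: "distinct vs" "set vs = {1..?n}" "length vs \<ge> 3"
    using ham unfolding hamilton_cycle_on_def by auto
  have len: "length vs = ?n" using distinct_card[OF vs(1)] vs(2) by simp
  have fin: "finite T" if "T \<in> \<T>" for T using T[OF that] finite_subset by blast
  have "card (\<Union>\<T>) = sum card \<T>" using disj fin by (intro card_Union_disjoint) (auto simp: disjoint_def pairwise_def disjnt_def)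
  also have "\<dots> = ?n" using T card by simp
  finally have "card (\<Union>\<T>) = card {1..?n}" by simp
  then have cover: "\<Union>\<T> = {1..?n}" using T by (intro card_subset_eq) auto
  have tri_edge: "{x, y} \<in> (\<Union>T\<in>\<T>. triangle_edges T) \<longleftrightarrow> x \<noteq> y \<and> (\<exists>T\<in>\<T>. x \<in> T \<and> y \<in> T)" for x y
    by (auto simp: triangle_edges_def card_insert_if)
  have nth_vs: "vs ! i \<in> {1..?n}" if "i < ?n" for i using that len vs(2) nth_mem by metis
  have cyc_edge: "{vs ! i, vs ! j} \<in> cycle_edges vs \<longleftrightarrow> adj ?n i j" if "i < ?n" "j < ?n" for i j
  proof -
    have eq: "vs ! i = vs ! j \<longleftrightarrow> i = j" if "i < ?n" "j < ?n" for i j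
      using nth_eq_iff_index_eq[OF vs(1)] that len by simp
    have lt: "Suc l mod ?n < ?n" if "l < ?n" for l using that by simp
    have "{vs ! i, vs ! j} \<in> cycle_edges vs \<longleftrightarrow>
        (\<exists>l<?n. vs ! i = vs ! l \<and> vs ! j = vs ! (Suc l mod ?n) \<or> vs ! i = vs ! (Suc l mod ?n) \<and> vs ! j = vs ! l)"
      unfolding cycle_edges_def len mem_Collect_eq doubleton_eq_iff by blast
    also have "\<dots> \<longleftrightarrow> (\<exists>l<?n. i = l \<and> j = Suc l mod ?n \<or> i = Suc l mod ?n \<and> j = l)"
      using eq that lt by (intro ex_cong1) auto
    also have "\<dots> \<longleftrightarrow> adj ?n i j" unfolding adj_def using that by blast
    finally show ?thesis .
  qed
  show k: "2 \<le> k"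
  proof (rule ccontr)
    assume "\<not> 2 \<le> k"
    then have "k = 1" using vs(3) len by auto
    then obtain T where T': "\<T> = {T}" using card card_1_singletonE by blast
    then have T0: "T = {1..?n}" using cover by simp
    have lt: "0 < ?n" "1 < ?n" using \<open>k = 1\<close> by auto
    have "vs ! 0 \<noteq> vs ! 1" using nth_eq_iff_index_eq[OF vs(1), of 0 1] len lt by simp
    moreover have "vs ! 0 \<in> T" "vs ! 1 \<in> T" unfolding T0 by (rule nth_vs, fact)+
    ultimately have "{vs ! 0, vs ! 1} \<in> (\<Union>T\<in>\<T>. triangle_edges T)"
      unfolding tri_edge using T' by blast
    moreover have "{vs ! 0, vs ! 1} \<in> cycle_edges vs"
      using cyc_edge[OF lt] lt by (simp add: adj_def)
    ultimately show False using int by blast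
  qed
  define M where "M u v \<longleftrightarrow> u \<noteq> v \<and> (\<exists>T\<in>\<T>. Suc u \<in> T \<and> Suc v \<in> T)" for u v
  have unique: "T = T'" if "T \<in> \<T>" "T' \<in> \<T>" "x \<in> T" "x \<in> T'" for T T' x
    using disj that unfolding disjoint_def by blast
  have T_pos: "0 < x" if "T \<in> \<T>" "x \<in> T" for T x using T[OF that(1)] that(2) by auto
  have "tris M"
    unfolding tris_def
  proof (intro conjI allI impI)
    show "M y x" "x \<noteq> y" if "M x y" for x y using that unfolding M_def by blast+
    show "M x z" if "M x y" "M y z" "x \<noteq> z" for x y z using that unique unfolding M_def by metis
    show "\<exists>z. z \<noteq> y \<and> (\<forall>w. M x w \<longleftrightarrow> w = y \<or> w = z)" if m: "M x y" for x y
    proof -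
      obtain U where U: "U \<in> \<T>" "Suc x \<in> U" "Suc y \<in> U" "x \<noteq> y" using m M_def by blast
      have "card (U - {Suc x, Suc y}) = 1" using U T[OF U(1)] fin[OF U(1)] by (simp add: card_Diff_subset)
      then obtain z' where z': "U - {Suc x, Suc y} = {z'}" using card_1_singletonE by blast
      then obtain z where z: "z' = Suc z" using T_pos[OF U(1), of z'] gr0_implies_Suc by blast
      have "U = {Suc x, Suc y, Suc z}" "z \<noteq> x" "z \<noteq> y" using z' z U by auto
      moreover have "M x w \<longleftrightarrow> x \<noteq> w \<and> Suc w \<in> U" for w using U unique unfolding M_def by blast
      ultimately show ?thesis using U(4) by auto
    qed
  qed
  moreover have ME: "M x y \<longleftrightarrow> x < ?n \<and> y < ?n \<and> {Suc x, Suc y} \<in> (\<Union>T\<in>\<T>. triangle_edges T)" for x y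
    unfolding tri_edge M_def using T by fastforce
  moreover have "\<exists>y. M x y" if x: "x < ?n" for x
  proof -
    have "Suc x \<in> \<Union>\<T>" unfolding cover using x by simp
    then obtain U where U: "U \<in> \<T>" "Suc x \<in> U" by blast
    have "card (U - {Suc x}) = 2" using U T[OF U(1)] fin[OF U(1)] by (simp add: card_Diff_subset)
    then have "U - {Suc x} \<noteq> {}" by (metis card.empty zero_neq_numeral)
    then obtain z' where z': "z' \<in> U" "z' \<noteq> Suc x" by blast
    obtain z where "z' = Suc z" using T_pos[OF U(1) z'(1)] gr0_implies_Suc by blast
    then have "x \<noteq> z" "Suc z \<in> U" using z' by simp_all
    with U show ?thesis unfolding M_def by blast
  qed
  moreover have "ham ?n (\<lambda>i. vs ! i - 1) (\<lambda>x y. graph_rel ?n F x y \<and> \<not> M x y)"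
    unfolding ham_def
  proof (intro conjI allI impI)
    have "bij_betw ((!) vs) {..<?n} {1..?n}" using bij_betw_nth[OF vs(1)] len vs(2) by simp
    moreover have "bij_betw (\<lambda>x. x - 1) {1..?n} {..<?n}"
      by (rule bij_betw_byWitness[where f' = Suc]) auto
    ultimately have "bij_betw ((\<lambda>x. x - 1) \<circ> (!) vs) {..<?n} {..<?n}" by (rule bij_betw_trans)
    then show "bij_betw (\<lambda>i. vs ! i - 1) {..<?n} {..<?n}" by (simp add: comp_def)
    fix i j assume ij: "i < ?n" "j < ?n"
    have "Suc (vs ! i - 1) = vs ! i" "Suc (vs ! j - 1) = vs ! j" "vs ! i - 1 < ?n" "vs ! j - 1 < ?n"
      using nth_vs[OF ij(1)] nth_vs[OF ij(2)] by auto
    then show "graph_rel ?n F (vs ! i - 1) (vs ! j - 1) \<and> \<not> M (vs ! i - 1) (vs ! j - 1) \<longleftrightarrow> adj ?n i j"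
      unfolding graph_rel_def ME F using cyc_edge[OF ij] int by auto
  qed
  ultimately have "decomp ?n (graph_rel ?n F) M"
    unfolding decomp_def graph_rel_def F by blast
  then show "\<exists>M. decomp ?n (graph_rel ?n F) M" by blast
qed

lemma graph_graph_rel:
  assumes "cycle_plus_triangles_graph k F"
  shows "graph (3 * k) (graph_rel (3 * k) F)"
proof
  show "graph_rel (3 * k) F x y \<Longrightarrow> graph_rel (3 * k) F y x" for x y
    unfolding graph_rel_def by (simp add: insert_commute)
  show "5 \<le> 3 * k" using cycle_plus_triangles_decomp(1)[OF assms] by simp
  obtain M where M: "decomp (3 * k) (graph_rel (3 * k) F) M" using cycle_plus_triangles_decomp(2)[OF assms] by blast
  then obtain h where h: "ham (3 * k) h (\<lambda>x y. graph_rel (3 * k) F x y \<and> \<not> M x y)" unfolding decomp_def by blast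
  show "\<not> graph_rel (3 * k) F x x" for x
  proof
    assume a: "graph_rel (3 * k) F x x"
    then have x: "x < 3 * k" unfolding graph_rel_def by blast
    obtain i where i: "i < 3 * k" "x = h i" by (rule ham_surj[OF h x])
    have "\<not> M x x" using M tris_irrefl unfolding decomp_def by blast
    then have "adj (3 * k) i i" using ham_adj[OF h i(1) i(1)] a i by simp
    then show False using i(1) \<open>5 \<le> 3 * k\<close> by (auto simp: adj_def Suc_mod split: if_splits)
  qed
qed (auto simp: graph_rel_def)

definition pos :: "nat \<Rightarrow> nat set set \<Rightarrow> nat \<Rightarrow> nat \<Rightarrow> bool" where
  "pos n F = positions n (rest (graph_rel n F) (matching n (graph_rel n F)))"

definition mates :: "nat \<Rightarrow> nat set set \<Rightarrow> nat \<Rightarrow> nat \<Rightarrow> bool" where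
  "mates n F = same n (pos n F) (matching n (graph_rel n F))"

lemma triples_complete: "a < n \<Longrightarrow> b < n \<Longrightarrow> c < n \<Longrightarrow> (a, b, c) \<in> set (triples n)"
  by (fastforce simp: triples_def)

text \<open>Hides the search: from here on only the factor \<open>M\<close> and the numbering
  \<open>h\<close> found by the program matter.\<close>

lemma reduction_structure:
  assumes "cycle_plus_triangles_graph k F" and n: "n = 3 * k"
  obtains h M where "ham n h (\<lambda>x y. graph_rel n F x y \<and> \<not> M x y)" "tris M" "\<And>x y. M x y \<Longrightarrow> x < n \<and> y < n"
    "\<And>x. x < n \<Longrightarrow> \<exists>y. M x y"
    "\<And>j v. pos n F j v \<longleftrightarrow> j < n \<and> v = h j"
    "\<And>p q. mates n F p q \<longleftrightarrow> p < n \<and> q < n \<and> (p = q \<or> M (h p) (h q))"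
proof -
  interpret graph n "graph_rel n F" unfolding n by (rule graph_graph_rel[OF assms(1)])
  let ?E = "graph_rel n F"
  let ?M = "matching n ?E"
  have ex: "\<exists>M. decomp n ?E M" using cycle_plus_triangles_decomp(2)[OF assms(1)] n by simp
  have "decomp n ?E (greedy (triples n) (\<lambda>_ _. False))" by (rule greedy_decomp[OF ex triples_complete])
  then have dec: "decomp n ?E ?M" unfolding greedy_def matching_def .
  then obtain h0 where h0: "ham n h0 (rest ?E ?M)" unfolding decomp_def rest_def[abs_def] by blast
  have "3 \<le> n" using five_le by simp
  obtain h where h: "ham n h (rest ?E ?M)" and pos: "pos n F = (\<lambda>j v. j < n \<and> v = h j)"
    using walk_correct[OF h0 \<open>3 \<le> n\<close>] unfolding pos_def positions_def by blast
  show ?thesis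
  proof
    show "ham n h (\<lambda>x y. ?E x y \<and> \<not> ?M x y)" using h unfolding rest_def[abs_def] .
    show "tris ?M" using M_tris[OF dec] .
    show "?M x y \<Longrightarrow> x < n \<and> y < n" for x y by (rule M_less[OF dec])
    show "x < n \<Longrightarrow> \<exists>y. ?M x y" for x by (rule M_cov[OF dec])
    show "pos n F j v \<longleftrightarrow> j < n \<and> v = h j" for j v unfolding pos by blast
    show "mates n F p q \<longleftrightarrow> p < n \<and> q < n \<and> (p = q \<or> ?M (h p) (h q))" for p q
      unfolding mates_def same_def pos
      using ham_less[OF h] ham_eq_iff[OF h] by auto
  qed
qed

section \<open>Output of the reduction\<close>

text \<open>Each class is represented by its least position, and the classes follow in that order.
  This is the order in which \<open>emit_rows\<close> with the filter \<open>firstF\<close> writes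
  its rows.\<close>

definition parts :: "nat \<Rightarrow> (nat \<Rightarrow> nat \<Rightarrow> bool) \<Rightarrow> nat set list" where
  "parts n R = map (\<lambda>p. {Suc q | q. R p q}) (filter (\<lambda>p. \<not> (\<exists>q<n. q < p \<and> R q p)) [0..<n])"

definition triple_equiv :: "nat \<Rightarrow> (nat \<Rightarrow> nat \<Rightarrow> bool) \<Rightarrow> bool" where
  "triple_equiv n R \<longleftrightarrow> (\<forall>p q. R p q \<longrightarrow> p < n \<and> q < n) \<and> (\<forall>p<n. R p p) \<and> (\<forall>p q. R p q \<longrightarrow> R q p) \<and>
     (\<forall>p q r. R p q \<longrightarrow> R q r \<longrightarrow> R p r) \<and> (\<forall>p<n. card {q. R p q} = 3)"

lemma parts_correct:
  assumes "triple_equiv n R"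
  shows "\<forall>V\<in>set (parts n R). card V = 3" "distinct (parts n R)" "partition_on {1..n} (set (parts n R))"
    "3 * length (parts n R) = n" "\<And>p q. R p q \<Longrightarrow> \<exists>V\<in>set (parts n R). Suc p \<in> V \<and> Suc q \<in> V"
proof -
  have less: "p < n \<and> q < n" if "R p q" for p q using assms that unfolding triple_equiv_def by blast
  have rfl: "R p p" if "p < n" for p using assms that unfolding triple_equiv_def by blast
  have sym: "R q p" if "R p q" for p q using assms that unfolding triple_equiv_def by blast
  have trans: "R p r" if "R p q" "R q r" for p q r using assms that unfolding triple_equiv_def by blast
  have card3: "card {q. R p q} = 3" if "p < n" for p using assms that unfolding triple_equiv_def by blast
  let ?V = "\<lambda>p. {Suc q | q. R p q}"
  have V: "?V p = Suc ` {q. R p q}" for p by blast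
  have set: "set (parts n R) = {?V p | p. p < n \<and> \<not> (\<exists>q<n. q < p \<and> R q p)}"
    unfolding parts_def by auto
  have eqV: "?V p = ?V q" if "R p q" for p q
  proof -
    have "R p x \<longleftrightarrow> R q x" for x using trans[OF sym[OF that]] trans[OF that] by blast
    then show ?thesis by simp
  qed
  have inV: "Suc p \<in> ?V p" if "p < n" for p using rfl[OF that] by blast
  show c: "\<forall>V\<in>set (parts n R). card V = 3"
  proof
    fix V assume "V \<in> set (parts n R)"
    then obtain p where p: "p < n" "V = ?V p" unfolding set by blast
    show "card V = 3" unfolding p(2) V using card3[OF p(1)] by (simp add: card_image)
  qed
  show mem: "\<exists>V\<in>set (parts n R). Suc p \<in> V \<and> Suc q \<in> V" if pq: "R p q" for p q
  proof -
    define m where "m = (LEAST m. R m p)"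
    have m: "R m p" unfolding m_def by (rule LeastI[of _ p]) (use less[OF pq] rfl in blast)
    have min: "\<not> R l m" if "l < m" for l
    proof
      assume "R l m"
      then have "R l p" using trans[OF _ m] by simp
      then show False using not_less_Least[OF that[unfolded m_def]] by simp
    qed
    have "m < n" "\<not> (\<exists>q<n. q < m \<and> R q m)" using less[OF m] min by simp_all
    then have "?V m \<in> set (parts n R)" unfolding set by (intro CollectI exI[of _ m] conjI HOL.refl)
    moreover have "Suc p \<in> ?V m" "Suc q \<in> ?V m" using m trans[OF m pq] by simp_all
    ultimately show ?thesis by (intro bexI[of _ "?V m"] conjI)
  qed
  have "inj_on ?V {p. p < n \<and> \<not> (\<exists>q<n. q < p \<and> R q p)}"
  proof (rule inj_onI)
    fix p q assume p: "p \<in> {p. p < n \<and> \<not> (\<exists>q<n. q < p \<and> R q p)}"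
      and q: "q \<in> {p. p < n \<and> \<not> (\<exists>q<n. q < p \<and> R q p)}" and eq: "?V p = ?V q"
    have "Suc p \<in> ?V p" using p inV by simp
    then have "R q p" unfolding eq by simp
    moreover have "R p q" using sym[OF \<open>R q p\<close>] .
    ultimately have "\<not> p < q" "\<not> q < p" using p q by auto
    then show "p = q" by simp
  qed
  then show d: "distinct (parts n R)"
    unfolding parts_def distinct_map by (simp add: Collect_conj_eq)
  show part: "partition_on {1..n} (set (parts n R))"
  proof (rule partition_onI)
    show "\<Union> (set (parts n R)) = {1..n}"
    proof
      show "\<Union> (set (parts n R)) \<subseteq> {1..n}" unfolding set using less by fastforce
      show "{1..n} \<subseteq> \<Union> (set (parts n R))"
      proof
        fix x assume "x \<in> {1..n}"
        then have "0 < x" "x \<le> n" by simp_all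
        then obtain p where p: "x = Suc p" "p < n" using gr0_implies_Suc by fastforce
        show "x \<in> \<Union> (set (parts n R))" using mem[OF rfl[OF p(2)]] p(1) by blast
      qed
    qed
    show "disjnt P Q" if PQ: "P \<in> set (parts n R)" "Q \<in> set (parts n R)" "P \<noteq> Q" for P Q
    proof (rule ccontr)
      assume nd: "\<not> disjnt P Q"
      obtain p q where p: "P = ?V p" and q: "Q = ?V q" using PQ unfolding set by blast
      obtain x where "Suc x \<in> P" "Suc x \<in> Q" using nd p unfolding disjnt_def by blast
      then have "R p x" "R q x" unfolding p q by blast+
      then have "R p q" using sym trans by blast
      then show False using eqV[OF \<open>R p q\<close>] PQ(3) p q by blast
    qed
    show "{} \<notin> set (parts n R)" using c by force
  qed
  have "card (\<Union> (set (parts n R))) = sum card (set (parts n R))"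
  proof (rule card_Union_disjoint)
    show "pairwise disjnt (set (parts n R))"
      using partition_onD2[OF part] unfolding disjoint_def pairwise_def disjnt_def by blast
    show "finite V" if "V \<in> set (parts n R)" for V
      using c that card.infinite by fastforce
  qed
  then have "card {1..n} = sum card (set (parts n R))" using partition_onD1[OF part] by simp
  also have "\<dots> = 3 * length (parts n R)" using c distinct_card[OF d] by simp
  finally show "3 * length (parts n R) = n" by simp
qed

lemma mates_correct:
  assumes "cycle_plus_triangles_graph k F" and n: "n = 3 * k"
  shows "triple_equiv n (mates n F)"
proof -
  obtain h M where h: "ham n h (\<lambda>x y. graph_rel n F x y \<and> \<not> M x y)" and M: "tris M" "\<And>x y. M x y \<Longrightarrow> x < n \<and> y < n"
    "\<And>x. x < n \<Longrightarrow> \<exists>y. M x y" and R0: "\<And>p q. mates n F p q \<longleftrightarrow> p < n \<and> q < n \<and> (p = q \<or> M (h p) (h q))"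
    by (rule reduction_structure[OF assms(1,2)]) blast
  define R where "R = mates n F"
  have R: "R p q \<longleftrightarrow> p < n \<and> q < n \<and> (p = q \<or> M (h p) (h q))" for p q unfolding R_def by (rule R0)
  have "R p q \<longrightarrow> p < n \<and> q < n" "p < n \<longrightarrow> R p p" for p q
    unfolding R by blast+
  moreover have "R p q \<longrightarrow> R q p" for p q
    unfolding R using tris_sym[OF M(1), of "h p" "h q"] by blast
  moreover have "R p q \<longrightarrow> R q r \<longrightarrow> R p r" for p q r
    using tris_trans[OF M(1), of "h p" "h q" "h r"] ham_eq_iff[OF h, of p r] unfolding R by blast
  moreover have "card {q. R p q} = 3" if p: "p < n" for p
  proof -
    obtain a where a: "M (h p) a" using M(3) ham_less[OF h p] by blast
    obtain b where b: "b \<noteq> h p" "b \<noteq> a" "M (h p) b" using tris_third[OF M(1) a] by blast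
    obtain i where i: "i < n" "a = h i" by (rule ham_surj[OF h]) (use M(2)[OF a] in blast)
    obtain j where j: "j < n" "b = h j" by (rule ham_surj[OF h]) (use M(2)[OF b(3)] in blast)
    have ne: "p \<noteq> i" "p \<noteq> j" "i \<noteq> j" using tris_irrefl[OF M(1) a] b i j by blast+
    have "R p q \<longleftrightarrow> q = p \<or> q = i \<or> q = j" for q
    proof (cases "q < n")
      case True
      have "M (h p) (h q) \<longleftrightarrow> h q = a \<or> h q = b" using tris_mates[OF M(1) a b(3)] b(2) by metis
      then show ?thesis unfolding R using p True i j ham_eq_iff[OF h True i(1)] ham_eq_iff[OF h True j(1)] by metis
    next
      case False
      then show ?thesis unfolding R using p i j by blast
    qed
    then have "{q. R p q} = {p, i, j}" by blast
    then show ?thesis using ne by simp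
  qed
  ultimately show ?thesis unfolding triple_equiv_def R_def by blast
qed

definition reduce :: "nat \<times> nat set set \<Rightarrow> nat \<times> nat \<times> nat set list" where
  "reduce = (\<lambda>(k, F). (3 * k, k, parts (3 * k) (mates (3 * k) F)))"

definition pull_back :: "nat \<times> nat set set \<Rightarrow> nat set \<Rightarrow> nat set" where
  "pull_back = (\<lambda>(k, F) S. {Suc v | p v. v < 3 * k \<and> p < 3 * k \<and> pos (3 * k) F p v \<and> Suc p \<in> S})"

lemma reduce_instance:
  assumes "cycle_plus_triangles_graph k F"
  shows "reduce (k, F) \<in> instances (restrict_problem unfair_independent_set_in_cycle triple_partition_instances)"
    "length (parts (3 * k) (mates (3 * k) F)) = k"
proof -
  note p = parts_correct[OF mates_correct[OF assms refl]]
  show len: "length (parts (3 * k) (mates (3 * k) F)) = k" using p(4) by simp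
  have "V \<subseteq> {1..3 * k}" if "V \<in> set (parts (3 * k) (mates (3 * k) F))" for V
    using partition_onD1[OF p(3)] that by blast
  \<comment> \<open>The \<open>k\<close> sets stay within the admissible number
    \<open>n - 2 * k + 1\<close>, which is \<open>k + 1\<close> here.\<close>
  moreover have "3 * k - 2 * k + 1 = k + 1" by simp
  ultimately show "reduce (k, F) \<in> instances (restrict_problem unfair_independent_set_in_cycle triple_partition_instances)"
    using p(1-3) len
    by (auto simp: reduce_def restrict_problem_def unfair_independent_set_in_cycle_def triple_partition_instances_def)
qed

text \<open>An edge inside the set would be a factor edge, so that two of the three elements of a
  part are chosen, more than half; or a cycle edge, so that two cyclically consecutive positions are
  chosen, against stability.\<close>

lemma pull_back_solution:
  assumes G: "cycle_plus_triangles_graph k F"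
    and S: "S \<in> solutions unfair_independent_set_in_cycle (reduce (k, F))"
  shows "pull_back (k, F) S \<in> solutions cycle_plus_triangles (k, F)"
proof -
  let ?n = "3 * k"
  note p = parts_correct[OF mates_correct[OF G refl]]
  obtain h M where h: "ham ?n h (\<lambda>x y. graph_rel ?n F x y \<and> \<not> M x y)" and M: "tris M"
    and pos: "\<And>j v. pos ?n F j v \<longleftrightarrow> j < ?n \<and> v = h j"
    and R: "\<And>p q. mates ?n F p q \<longleftrightarrow> p < ?n \<and> q < ?n \<and> (p = q \<or> M (h p) (h q))"
    by (rule reduction_structure[OF G refl]) blast
  have stable: "stable ?n S" and card: "card S = k"
    and half: "\<And>V. V \<in> set (parts ?n (mates ?n F)) \<Longrightarrow> real (card (S \<inter> V)) \<le> real (card V) / 2"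
    using S by (auto simp: reduce_def unfair_independent_set_in_cycle_def)
  have S_sub: "S \<subseteq> {1..?n}" using stable by (simp add: stable_def)
  let ?I = "{i. Suc i \<in> S}"
  have I_less: "i < ?n" if "i \<in> ?I" for i using that S_sub by auto
  have pb: "pull_back (k, F) S = (\<lambda>i. Suc (h i)) ` ?I"
  proof (rule set_eqI)
    fix x
    have "x \<in> pull_back (k, F) S \<longleftrightarrow> (\<exists>p v. x = Suc v \<and> v < ?n \<and> p < ?n \<and> v = h p \<and> Suc p \<in> S)"
      by (auto simp: pull_back_def pos)
    then show "x \<in> pull_back (k, F) S \<longleftrightarrow> x \<in> (\<lambda>i. Suc (h i)) ` ?I"
      using ham_less[OF h] I_less by blast
  qed
  have "S = Suc ` ?I"
  proof
    show "S \<subseteq> Suc ` ?I"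
    proof
      fix x assume x: "x \<in> S"
      then have "0 < x" using S_sub by auto
      then obtain i where "x = Suc i" using gr0_implies_Suc by blast
      with x show "x \<in> Suc ` ?I" by blast
    qed
  qed blast
  then have "card ?I = k" using card card_image[of Suc ?I] by simp
  moreover have "inj_on (\<lambda>i. Suc (h i)) ?I"
    by (rule inj_onI) (use ham_eq_iff[OF h] I_less in blast)
  ultimately have "card (pull_back (k, F) S) = k" unfolding pb by (simp add: card_image)
  moreover have "pull_back (k, F) S \<subseteq> {1..?n}" unfolding pb using I_less ham_less[OF h] by fastforce
  moreover have "independent_set F (pull_back (k, F) S)"
    unfolding independent_set_def
  proof (intro ballI notI)
    fix u v assume u: "u \<in> pull_back (k, F) S" and v: "v \<in> pull_back (k, F) S" and e: "{u, v} \<in> F"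
    obtain i where i: "Suc i \<in> S" "u = Suc (h i)" using u unfolding pb by blast
    obtain j where j: "Suc j \<in> S" "v = Suc (h j)" using v unfolding pb by blast
    have lt: "i < ?n" "j < ?n" using i j I_less by blast+
    have E: "graph_rel ?n F (h i) (h j)"
      unfolding graph_rel_def using e i j ham_less[OF h] lt by simp
    show False
    proof (cases "M (h i) (h j)")
      case True
      then have "mates ?n F i j" unfolding R using lt by blast
      then obtain V where V: "V \<in> set (parts ?n (mates ?n F))" "Suc i \<in> V" "Suc j \<in> V" using p(5) by blast
      have "i \<noteq> j" using tris_irrefl[OF M True] by blast
      have cV: "card V = 3" using p(1) V(1) by blast
      then have "finite V" using card.infinite by fastforce
      then have "card {Suc i, Suc j} \<le> card (S \<inter> V)" using V i j by (intro card_mono) auto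
      then have "2 \<le> card (S \<inter> V)" using \<open>i \<noteq> j\<close> by simp
      then show False using half[OF V(1)] cV by simp
    next
      case False
      then have "adj ?n i j" using ham_adj[OF h lt] E by blast
      from adj_cases[OF lt this] show False
        using stable i(1) j(1) unfolding stable_def by auto
    qed
  qed
  ultimately show ?thesis by (simp add: cycle_plus_triangles_def)
qed

lemma length_adj_matrix: "length (adj_matrix n F) = n * n"
  by (simp add: adj_matrix_def length_concat comp_def sum_list_triv)

lemma input_rels_graph:
  "input_rels n (adj_matrix n F) ys 0 = graph_rel n F"
proof (intro ext)
  fix u v
  have "bit_at (adj_matrix n F) (u * n + v) \<longleftrightarrow> {Suc u, Suc v} \<in> F" if "u < n" "v < n"
  proof -
    have "[1..<n + 1] = map Suc [0..<n]" by (simp add: map_Suc_upt)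
    then have "adj_matrix n F = concat (map (\<lambda>u. map (\<lambda>v. {Suc u, Suc v} \<in> F) [0..<n]) [0..<n])"
      by (simp add: adj_matrix_def comp_def)
    then show ?thesis using bit_at_concat[of "\<lambda>u. map (\<lambda>v. {Suc u, Suc v} \<in> F) [0..<n]" n u n v] that by simp
  qed
  then show "input_rels n (adj_matrix n F) ys 0 u v = graph_rel n F u v"
    unfolding input_rels_def graph_rel_def by auto
qed

text \<open>A characteristic vector has only \<open>n\<close> bits; read as an incomplete matrix, it
  is row 0 of relation 1.\<close>

lemma input_rels_solution:
  assumes "p < n"
  shows "input_rels n xs (char_vec n S) 1 0 p \<longleftrightarrow> Suc p \<in> S"
  using assms by (simp add: input_rels_def bit_at_def char_vec_def del: upt_Suc)

lemma csem_reduceC_input: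
  fixes n F ys e
  defines "T \<equiv> csem reduceC n e (input_rels n (adj_matrix n F) ys)"
  shows "T 1 = input_rels n (adj_matrix n F) ys 1" "T 4 = pos n F" "T 5 = mates n F"
proof -
  have "input_rels n (adj_matrix n F) ys 2 = (\<lambda>_ _. False)"
    by (intro ext) (simp add: input_rels_def bit_at_def)
  from csem_reduceC[of "input_rels n (adj_matrix n F) ys" n e, OF this]
  show "T 1 = input_rels n (adj_matrix n F) ys 1" "T 4 = pos n F" "T 5 = mates n F"
    unfolding T_def pos_def mates_def input_rels_graph by simp_all
qed

lemma concat_map_filter: "concat (map (\<lambda>x. if P x then f x else []) xs) = concat (map f (filter P xs))"
  by (induction xs) simp_all

lemma char_vec_Suc: "char_vec n S = map (\<lambda>q. Suc q \<in> S) [0..<n]"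
proof -
  have "[1..<n + 1] = map Suc [0..<n]" by (simp add: map_Suc_upt)
  then show ?thesis by (simp add: char_vec_def comp_def)
qed

definition firstF :: fm where
  "firstF = Neg (Exi 2 (Conj (Less 2 0) (Rel 5 2 0)))"

text \<open>The filter \<open>zeroF 0 2\<close> admits only row 0. There variable 0 is 0, and
  \<open>Rel 1 0 2\<close> looks up variable 2 in the solution vector.\<close>

definition solutionF :: fm where
  "solutionF = Exi 2 (Conj (Rel 4 2 1) (Rel 1 0 2))"

lemma result_reduce:
  assumes "cycle_plus_triangles_graph k F"
  shows "result True firstF (Rel 5 0 1) reduceC k (adj_matrix (3 * k) F) [] =
    enc_instance (restrict_problem unfair_independent_set_in_cycle triple_partition_instances) (reduce (k, F))"
proof -
  let ?n = "3 * k" and ?R = "mates (3 * k) F"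
  have "rows ?n (csem reduceC ?n (\<lambda>_. 0) (input_rels ?n (adj_matrix ?n F) [])) (\<lambda>_. 0) 0 1 firstF (Rel 5 0 1) ?n =
    concat (map (\<lambda>u. if \<not> (\<exists>q<?n. q < u \<and> ?R q u) then map (\<lambda>v. ?R u v) [0..<?n] else []) [0..<?n])"
    unfolding rows_def firstF_def by (simp add: csem_reduceC_input cong: if_cong)
  also have "\<dots> = concat (map (char_vec ?n) (parts ?n ?R))"
    unfolding concat_map_filter parts_def map_map comp_def char_vec_Suc by simp
  finally show ?thesis
    using reduce_instance(2)[OF assms]
    by (simp add: result_def header_def reduce_def restrict_problem_def unfair_independent_set_in_cycle_def)
qed

lemma concat_map_zero:
  "0 < m \<Longrightarrow> concat (map (\<lambda>u. if u = 0 then f u else []) [0..<m]) = f (0 :: nat)"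
proof (induction m)
  case (Suc m)
  then show ?case by (cases "m = 0") simp_all
qed simp

lemma result_pull_back:
  assumes "0 < k"
  shows "result False (zeroF 0 2) solutionF reduceC k (adj_matrix (3 * k) F) (char_vec (3 * k) S) =
    enc_solution cycle_plus_triangles (k, F) (pull_back (k, F) S)"
proof -
  define n where "n = 3 * k"
  define T where "T = csem reduceC n (\<lambda>_. 0) (input_rels n (adj_matrix n F) (char_vec n S))"
  note T = csem_reduceC_input[of n "\<lambda>_. 0" F "char_vec n S", folded T_def]
  have sol: "sat solutionF n T ((\<lambda>_. 0)(0 := u, 1 := v)) \<longleftrightarrow> (\<exists>p<n. pos n F p v \<and> T 1 u p)" for u v
    unfolding solutionF_def by (simp add: T(2))
  have zero: "sat (zeroF 0 2) n T ((\<lambda>_. 0)(0 := u)) \<longleftrightarrow> u = 0" if "u < n" for u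
    by (subst sat_zeroF) (use that in simp_all)
  have "rows n T (\<lambda>_. 0) 0 1 (zeroF 0 2) solutionF n =
      concat (map (\<lambda>u. if u = 0 then map (\<lambda>v. \<exists>p<n. pos n F p v \<and> T 1 u p) [0..<n] else []) [0..<n])"
    unfolding rows_def sol by (intro arg_cong[where f = concat] map_cong HOL.refl) (simp add: zero)
  also have "\<dots> = map (\<lambda>v. \<exists>p<n. pos n F p v \<and> T 1 0 p) [0..<n]"
    by (rule concat_map_zero) (use assms n_def in simp)
  also have "\<dots> = char_vec n (pull_back (k, F) S)"
    unfolding char_vec_Suc[of _ "pull_back (k, F) S"]
  proof (intro map_cong HOL.refl)
    fix v assume "v \<in> set [0..<n]"
    then have "Suc v \<in> pull_back (k, F) S \<longleftrightarrow> (\<exists>p<n. pos n F p v \<and> Suc p \<in> S)"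
      by (auto simp: pull_back_def n_def)
    moreover have "T 1 0 p \<longleftrightarrow> Suc p \<in> S" if "p < n" for p
      unfolding T(1) by (rule input_rels_solution[OF that])
    ultimately show "(\<exists>p<n. pos n F p v \<and> T 1 0 p) \<longleftrightarrow> Suc v \<in> pull_back (k, F) S" by blast
  qed
  finally show ?thesis
    unfolding result_def header_def n_def T_def by (simp add: cycle_plus_triangles_def)
qed

theorem proposition4p1:
  "poly_time_reducible cycle_plus_triangles
     (restrict_problem unfair_independent_set_in_cycle triple_partition_instances)"
  unfolding poly_time_reducible_def
proof (intro exI[of _ reduce] exI[of _ pull_back] conjI ballI)
  let ?P = cycle_plus_triangles
  let ?Q = "restrict_problem unfair_independent_set_in_cycle triple_partition_instances"
  have inst: "x \<in> instances ?P \<longleftrightarrow> cycle_plus_triangles_graph (fst x) (snd x)" for x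
    by (cases x) (simp add: cycle_plus_triangles_def)
  have sol: "solutions ?Q y = solutions unfair_independent_set_in_cycle y" for y
    by (simp add: restrict_problem_def)
  have k: "0 < fst x" if "x \<in> instances ?P" for x
    using cycle_plus_triangles_decomp(1) that unfolding inst by fastforce
  have enc: "enc_instance ?P x = unary (fst x) @ adj_matrix (3 * fst x) (snd x)" for x
    by (cases x) (simp add: cycle_plus_triangles_def)
  have enc_sol: "enc_solution ?Q (reduce x) y = char_vec (3 * fst x) y" for x y
    by (cases x) (simp add: restrict_problem_def reduce_def unfair_independent_set_in_cycle_def)
  have len: "length (char_vec n S) \<le> n * n" for n S
    by (cases n) (simp_all add: char_vec_def)
  have out: "enc_instance ?Q (reduce x) =
      result True firstF (Rel 5 0 1) reduceC (fst x) (adj_matrix (3 * fst x) (snd x)) []" if "x \<in> instances ?P" for x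
    using result_reduce[of "fst x" "snd x"] that unfolding inst by simp
  have out_sol: "enc_solution ?P x (pull_back x y) =
      result False (zeroF 0 2) solutionF reduceC (fst x) (adj_matrix (3 * fst x) (snd x)) (char_vec (3 * fst x) y)"
    if "x \<in> instances ?P" for x y
    using result_pull_back[OF k[OF that], of "snd x" y] by simp
  show "reduce x \<in> instances ?Q" if "x \<in> instances ?P" for x
    using reduce_instance(1)[of "fst x" "snd x"] that unfolding inst by simp
  show "pull_back x y \<in> solutions ?P x" if "x \<in> instances ?P" "y \<in> solutions ?Q (reduce x)" for x y
    using pull_back_solution[of "fst x" "snd x" y] that unfolding inst sol by simp
  show "poly_time_on (instances ?P) (\<lambda>x. [enc_instance ?P x]) (\<lambda>x. enc_instance ?Q (reduce x))"
    by (rule poly_time_on_result[where k = fst and xs = "\<lambda>x. adj_matrix (3 * fst x) (snd x)" and ys = "\<lambda>_. []"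
          and h = True and \<phi> = firstF and \<psi> = "Rel 5 0 1" and c = reduceC])
      (simp_all only: enc out k length_adj_matrix list.size simp_thms order_refl zero_le)
  show "poly_time_on (SIGMA x : instances ?P. solutions ?Q (reduce x))
          (\<lambda>(x, y). [enc_instance ?P x, enc_solution ?Q (reduce x) y])
          (\<lambda>(x, y). enc_solution ?P x (pull_back x y))"
  proof (rule poly_time_on_result[where k = "\<lambda>a. fst (fst a)" and xs = "\<lambda>a. adj_matrix (3 * fst (fst a)) (snd (fst a))"
        and ys = "\<lambda>a. char_vec (3 * fst (fst a)) (snd a)" and h = False and \<phi> = "zeroF 0 2" and \<psi> = solutionF and c = reduceC])
    fix a assume "a \<in> (SIGMA x : instances ?P. solutions ?Q (reduce x))"
    then have a: "fst a \<in> instances ?P" by auto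
    show "0 < fst (fst a)" using k[OF a] .
    show "length (adj_matrix (3 * fst (fst a)) (snd (fst a))) \<le> 3 * fst (fst a) * (3 * fst (fst a))"
      by (simp add: length_adj_matrix)
    show "length (char_vec (3 * fst (fst a)) (snd a)) \<le> 3 * fst (fst a) * (3 * fst (fst a))"
      by (rule len)
    show "(case a of (x, y) \<Rightarrow> enc_solution ?P x (pull_back x y)) =
        result False (zeroF 0 2) solutionF reduceC (fst (fst a)) (adj_matrix (3 * fst (fst a)) (snd (fst a)))
          (char_vec (3 * fst (fst a)) (snd a))"
      unfolding case_prod_beta by (rule out_sol[OF a])
    show "(case a of (x, y) \<Rightarrow> [enc_instance ?P x, enc_solution ?Q (reduce x) y]) =
          [unary (fst (fst a)) @ adj_matrix (3 * fst (fst a)) (snd (fst a)), char_vec (3 * fst (fst a)) (snd a)] \<or>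
        (case a of (x, y) \<Rightarrow> [enc_instance ?P x, enc_solution ?Q (reduce x) y]) =
          [unary (fst (fst a)) @ adj_matrix (3 * fst (fst a)) (snd (fst a))] \<and> char_vec (3 * fst (fst a)) (snd a) = []"
      unfolding case_prod_beta enc enc_sol by (rule disjI1) (rule refl)
  qed
qed

end
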